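(* Let $n>2$, $K$ a field, and let $I$ be the ideal of $(n-1)$-minors of the generic $n\times n$ matrix $X=(x_{ij})$ in $K[x_{ij}]$. Set $V=\{x_{ij}:0\le j-i\le1\}\cup\{x_{n1}\}$ and $W=\{x_{ij}:x_{ij}\notin V\}$, and let $Y$ be the matrix obtained from $X$ by replacing $x_{ij}$ with $0$ whenever $x_{ij}\in W$. Let $\succ$ be any reverse lexicographic term order such that $x_{ij}\succ x_{hk}$ whenever $x_{ij}\in V$ and $x_{hk}\in W$. Then $\operatorname{in}_\succ(I)$ is a squarefree monomial ideal with the same (graded) Betti numbers as $I$, and the core of the associated initial complex is isomorphic to the boundary complex of the cyclic polytope with $2n$ vertices in $\mathbb R^{2n-4}$. More precisely, $\operatorname{in}_\succ(I)$ is the specialization of $I$ by the regular sequence $W$; that is, $\operatorname{in}_\succ(I)$ is the ideal of $(n-1)$-minors of $Y$.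
   Context: The initial complex of a squarefree monomial ideal is the simplicial complex whose Stanley–Reisner ideal it is; its core is its restriction to the vertices not lying in every facet. *)

theory Defs
  imports "HOL-Library.Poly_Mapping" "HOL-Combinatorics.Permutations" Complex_Main
begin

type_synonym var = "nat \<times> nat"
type_synonym mon = "var \<Rightarrow>\<^sub>0 nat"
type_synonym 'a mpoly = "mon \<Rightarrow>\<^sub>0 'a"

definition Vars :: "nat \<Rightarrow> var set" where
  "Vars n = {1..n} \<times> {1..n}"

definition PRing :: "nat \<Rightarrow> ('a::field) mpoly set" where
  "PRing n = {p. \<forall>m\<in>Poly_Mapping.keys p. Poly_Mapping.keys m \<subseteq> Vars n}"

definition mdeg :: "mon \<Rightarrow> nat" where
  "mdeg m = (\<Sum>v\<in>Poly_Mapping.keys m. Poly_Mapping.lookup m v)"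

definition homog :: "('a::field) mpoly \<Rightarrow> int \<Rightarrow> bool" where
  "homog p d \<longleftrightarrow> (\<forall>m\<in>Poly_Mapping.keys p. int (mdeg m) = d)"

definition homog_poly :: "('a::field) mpoly \<Rightarrow> bool" where
  "homog_poly p \<longleftrightarrow> (\<exists>d. homog p d)"

definition monom :: "mon \<Rightarrow> ('a::field) mpoly" where
  "monom m = Poly_Mapping.single m 1"

definition var_x :: "nat \<Rightarrow> nat \<Rightarrow> ('a::field) mpoly" where
  "var_x i j = monom (Poly_Mapping.single (i, j) 1)"

definition ideal_gen :: "nat \<Rightarrow> ('a::field) mpoly set \<Rightarrow> 'a mpoly set" where
  "ideal_gen n G = {p. \<exists>F c. finite F \<and> F \<subseteq> G \<and> (\<forall>g\<in>F. c g \<in> PRing n) \<and>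
                          p = (\<Sum>g\<in>F. c g * g)}"

definition det_sq :: "nat \<Rightarrow> (nat \<Rightarrow> nat \<Rightarrow> 'b::comm_ring_1) \<Rightarrow> 'b" where
  "det_sq k M = (\<Sum>p\<in>{p. p permutes {0..<k}}. of_int (sign p) * (\<Prod>i<k. M i (p i)))"

text \<open>skip a k: the k-th element (k = 1..n-1) of {1..n} - {a}.\<close>
definition skip :: "nat \<Rightarrow> nat \<Rightarrow> nat" where
  "skip a k = (if k < a then k else k + 1)"

definition minor_del :: "nat \<Rightarrow> (nat \<Rightarrow> nat \<Rightarrow> 'b::comm_ring_1) \<Rightarrow> nat \<Rightarrow> nat \<Rightarrow> 'b" where
  "minor_del n M a b = det_sq (n - 1) (\<lambda>i j. M (skip a (i + 1)) (skip b (j + 1)))"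

definition maxminors :: "nat \<Rightarrow> (nat \<Rightarrow> nat \<Rightarrow> 'b::comm_ring_1) \<Rightarrow> 'b set" where
  "maxminors n M = {minor_del n M a b | a b. a \<in> {1..n} \<and> b \<in> {1..n}}"

definition genX :: "nat \<Rightarrow> nat \<Rightarrow> ('a::field) mpoly" where
  "genX i j = var_x i j"

definition setV :: "nat \<Rightarrow> var set" where
  "setV n = {(i, j). (i, j) \<in> Vars n \<and> (j = i \<or> j = i + 1)} \<union> {(n, 1)}"

definition setW :: "nat \<Rightarrow> var set" where
  "setW n = Vars n - setV n"

definition matY :: "nat \<Rightarrow> nat \<Rightarrow> nat \<Rightarrow> ('a::field) mpoly" where
  "matY n i j = (if (i, j) \<in> setW n then 0 else var_x i j)"

text \<open>Variable u is larger than v iff rk u > rk v (rk injective on the variables).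
  The degree reverse lexicographic order: m > m' iff deg m > deg m', or the
  degrees agree and, at the smallest variable where m and m' differ, m has the
  smaller exponent.\<close>
definition revlex_gt :: "nat \<Rightarrow> (var \<Rightarrow> nat) \<Rightarrow> mon \<Rightarrow> mon \<Rightarrow> bool" where
  "revlex_gt n rk m m' \<longleftrightarrow>
     mdeg m > mdeg m' \<or>
     (mdeg m = mdeg m' \<and>
      (\<exists>v\<in>Vars n. Poly_Mapping.lookup m v < Poly_Mapping.lookup m' v \<and>
          (\<forall>u\<in>Vars n. rk u < rk v \<longrightarrow> Poly_Mapping.lookup m u = Poly_Mapping.lookup m' u)))"

definition lead_mon :: "nat \<Rightarrow> (var \<Rightarrow> nat) \<Rightarrow> ('a::field) mpoly \<Rightarrow> mon" where
  "lead_mon n rk p = (THE m. m \<in> Poly_Mapping.keys p \<and> (\<forall>m'\<in>Poly_Mapping.keys p. m' \<noteq> m \<longrightarrow> revlex_gt n rk m m'))"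

definition initial_ideal :: "nat \<Rightarrow> (var \<Rightarrow> nat) \<Rightarrow> ('a::field) mpoly set \<Rightarrow> 'a mpoly set" where
  "initial_ideal n rk I = ideal_gen n {monom (lead_mon n rk p) | p. p \<in> I \<and> p \<noteq> 0}"

definition squarefree_monomial_ideal :: "nat \<Rightarrow> ('a::field) mpoly set \<Rightarrow> bool" where
  "squarefree_monomial_ideal n J \<longleftrightarrow>
     (\<exists>G. (\<forall>m\<in>G. Poly_Mapping.keys m \<subseteq> Vars n \<and> (\<forall>v. Poly_Mapping.lookup m v \<le> 1)) \<and> J = ideal_gen n (monom ` G))"

definition free_mod :: "nat \<Rightarrow> nat \<Rightarrow> (nat \<Rightarrow> ('a::field) mpoly) set" where
  "free_mod n r = {v. (\<forall>l. v l \<in> PRing n) \<and> (\<forall>l\<ge>r. v l = 0)}"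

text \<open>A graded free resolution of the ideal I (viewed as a graded S-module):
  ranks r i, degree shifts d i l (basis element l of F_i has degree d i l),
  generators g l (images of the basis of F_0 in I), and differential matrices
  A i k l (entry of F_i -> F_(i-1), row k, column l), for i >= 1.\<close>
record (overloaded) ('a::zero) gres =
  rk :: "nat \<Rightarrow> nat"
  shift :: "nat \<Rightarrow> nat \<Rightarrow> int"
  gens :: "nat \<Rightarrow> 'a mpoly"
  diffm :: "nat \<Rightarrow> nat \<Rightarrow> nat \<Rightarrow> 'a mpoly"

definition dapply :: "('a::field) gres \<Rightarrow> nat \<Rightarrow> (nat \<Rightarrow> 'a mpoly) \<Rightarrow> (nat \<Rightarrow> 'a mpoly)" where
  "dapply R i v = (\<lambda>k. if k < rk R (i - 1) then (\<Sum>l<rk R i. diffm R i k l * v l) else 0)"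

definition augm :: "('a::field) gres \<Rightarrow> (nat \<Rightarrow> 'a mpoly) \<Rightarrow> 'a mpoly" where
  "augm R v = (\<Sum>l<rk R 0. gens R l * v l)"

definition minimal_graded_free_resolution :: "nat \<Rightarrow> ('a::field) mpoly set \<Rightarrow> 'a gres \<Rightarrow> bool" where
  "minimal_graded_free_resolution n I R \<longleftrightarrow>
     (\<exists>p. \<forall>i>p. rk R i = 0) \<and>
     (\<forall>l<rk R 0. gens R l \<in> I \<and> homog (gens R l) (shift R 0 l)) \<and>
     (\<forall>i\<ge>1. \<forall>k<rk R (i - 1). \<forall>l<rk R i.
         diffm R i k l \<in> PRing n \<and>
         homog (diffm R i k l) (shift R i l - shift R (i - 1) k) \<and>
         Poly_Mapping.lookup (diffm R i k l) 0 = 0) \<and>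
     augm R ` free_mod n (rk R 0) = I \<and>
     {v \<in> free_mod n (rk R 0). augm R v = 0} = dapply R 1 ` free_mod n (rk R 1) \<and>
     (\<forall>i\<ge>1. {v \<in> free_mod n (rk R i). dapply R i v = (\<lambda>_. 0)}
              = dapply R (i + 1) ` free_mod n (rk R (i + 1)))"

definition betti :: "('a::field) gres \<Rightarrow> nat \<Rightarrow> int \<Rightarrow> nat" where
  "betti R i j = card {l. l < rk R i \<and> shift R i l = j}"

definition same_graded_betti :: "nat \<Rightarrow> ('a::field) mpoly set \<Rightarrow> 'a mpoly set \<Rightarrow> bool" where
  "same_graded_betti n I J \<longleftrightarrow>
     (\<exists>R1 R2. minimal_graded_free_resolution n I R1 \<and> minimal_graded_free_resolution n J R2 \<and>
              (\<forall>i j. betti R1 i j = betti R2 i j))"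

definition regular_sequence_mod :: "nat \<Rightarrow> ('a::field) mpoly set \<Rightarrow> var set \<Rightarrow> bool" where
  "regular_sequence_mod n I W \<longleftrightarrow>
     (\<exists>ws. distinct ws \<and> set ws = W \<and>
        (\<forall>k<length ws. \<forall>f\<in>PRing n.
           var_x (fst (ws ! k)) (snd (ws ! k)) * f
             \<in> ideal_gen n (I \<union> {var_x (fst w) (snd w) | w. w \<in> set (take k ws)})
           \<longrightarrow> f \<in> ideal_gen n (I \<union> {var_x (fst w) (snd w) | w. w \<in> set (take k ws)})) \<and>
        1 \<notin> ideal_gen n (I \<union> {var_x (fst w) (snd w) | w. w \<in> W}))"

definition sqfree_monom :: "var set \<Rightarrow> ('a::field) mpoly" where
  "sqfree_monom F = monom (\<Sum>v\<in>F. Poly_Mapping.single v 1)"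

definition SR_complex :: "nat \<Rightarrow> ('a::field) mpoly set \<Rightarrow> var set set" where
  "SR_complex n J = {F. F \<subseteq> Vars n \<and> sqfree_monom F \<notin> J}"

definition facets :: "'v set set \<Rightarrow> 'v set set" where
  "facets \<Delta> = {F \<in> \<Delta>. \<forall>G\<in>\<Delta>. F \<subseteq> G \<longrightarrow> G = F}"

definition core :: "'v set set \<Rightarrow> 'v set set" where
  "core \<Delta> = (let U = {v \<in> \<Union>\<Delta>. \<exists>G\<in>facets \<Delta>. v \<notin> G} in {F \<in> \<Delta>. F \<subseteq> U})"

definition complex_iso :: "'u set set \<Rightarrow> 'v set set \<Rightarrow> bool" where
  "complex_iso \<Delta>1 \<Delta>2 \<longleftrightarrow>
     (\<exists>f. bij_betw f (\<Union>\<Delta>1) (\<Union>\<Delta>2) \<and> (\<forall>F. F \<subseteq> \<Union>\<Delta>1 \<longrightarrow> (F \<in> \<Delta>1 \<longleftrightarrow> f ` F \<in> \<Delta>2)))"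

text \<open>Boundary complex of the cyclic polytope C(N, d) = conv{(t, t^2, ..., t^d) : t = 1..N}
  in R^d, as a simplicial complex on the vertex labels {1..N}: F is a face iff F is the
  set of vertices lying on a supporting hyperplane (a.x <= b valid, equality exactly on F)
  and F is a proper face (not all vertices). The empty face is included.\<close>
definition cyclic_boundary :: "nat \<Rightarrow> nat \<Rightarrow> nat set set" where
  "cyclic_boundary N d =
     {F. F \<noteq> {1..N} \<and>
        (\<exists>(a::nat \<Rightarrow> real) b.
           (\<forall>t\<in>{1..N}. (\<Sum>c=1..d. a c * real t ^ c) \<le> b) \<and>
           F = {t\<in>{1..N}. (\<Sum>c=1..d. a c * real t ^ c) = b})}"

end

theory Submission
  imports "Jordan_Normal_Form.Determinant" "HOL-Library.Countable" Defs
begin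

text \<open>
  Setting the variables in W to 0 turns the (n-1)-minors, up to sign, into the squarefree monomials
  of the (n-1)-subsets of V without two entries in a common row or column. In the cyclic order
  \<open>x\<^sub>1\<^sub>1, x\<^sub>1\<^sub>2, x\<^sub>2\<^sub>2, x\<^sub>2\<^sub>3, \<dots>, x\<^sub>n\<^sub>n, x\<^sub>n\<^sub>1\<close> of V these are the independent (n-1)-subsets of a 2n-cycle.
  Their syzygies are generated by those that slide one entry to a neighbour, and the latter are
  specializations of the relations \<open>X adj X = adj X X = det X\<close>; so all syzygies lift to the minors of X.
  Hence W is a regular sequence modulo I, the minimal free resolution of I stays
  exact and minimal after setting W to 0, and, W being last in the reverse lexicographic order,
  the initial ideal is the specialization.

  A set lies in the boundary complex of the cyclic polytope iff it is the zero set in \<open>{1..2n}\<close> of a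
  polynomial of degree at most 2n-4 that is nonnegative there. If it contained an independent
  (n-1)-set S of the 2n-cycle, the divided difference over S and the successors of S would force the
  polynomial to vanish at all these 2n-2 points. This matches the Stanley-Reisner description.
\<close>

hide_const (open) Polynomial.monom

text \<open>Quotients by variables are replaced by a retraction: \<open>kill U\<close> sends the
  variables in \<open>U\<close> to 0 and lands in the subring without them, so all specializations
  live in one polynomial type and can be carried out one variable at a time. No explicit resolution
  is written down. A minimal one is produced abstractly from finite generation of graded submodules,
  its length is bounded by killing every variable, and its ranks and shifts are only shown to be
  unchanged by specialization. Lifting syzygies takes two nested inductions, because lifting modulo
  one variable \<open>w\<close> leaves an error \<open>X w * q\<close> whose quotient
  \<open>q\<close> is again a syzygy, of smaller degree. This is why everything is kept homogeneous.
  The same division by the smallest variable of W controls the leading monomials. The combinatorial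
  input is that for each omitted row and column exactly one independent set of the cycle uses
  precisely the remaining rows and columns, so every minor of Y has a single term and nothing can
  cancel.\<close>

abbreviation "lkp \<equiv> Poly_Mapping.lookup"
abbreviation "kys \<equiv> Poly_Mapping.keys"
abbreviation "sgl \<equiv> Poly_Mapping.single"

section \<open>Supports and degrees of monomials, and restriction of polynomials to selected
  monomials\<close>

lemma keys_add_nat: "kys (m + m' :: 'v \<Rightarrow>\<^sub>0 nat) = kys m \<union> kys m'"
  by (auto simp: in_keys_iff lookup_add)

lemma mdeg_superset: "finite F \<Longrightarrow> kys m \<subseteq> F \<Longrightarrow> mdeg m = (\<Sum>v\<in>F. lkp m v)"
  unfolding mdeg_def by (rule sum.mono_neutral_left) (auto simp: in_keys_iff)

lemma mdeg_add: "mdeg (m + m') = mdeg m + mdeg m'"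
  using mdeg_superset[of "kys m \<union> kys m'" m] mdeg_superset[of "kys m \<union> kys m'" m']
    mdeg_superset[of "kys m \<union> kys m'" "m + m'"]
  by (simp add: keys_add_nat lookup_add sum.distrib)

lemma mdeg_0 [simp]: "mdeg 0 = 0"
  by (simp add: mdeg_def)

lemma mdeg_single [simp]: "mdeg (sgl v k) = k"
  by (simp add: mdeg_def)

lemma mdeg_eq_0_iff: "mdeg m = 0 \<longleftrightarrow> m = 0"
proof
  assume "mdeg m = 0"
  then have "\<forall>v\<in>kys m. lkp m v = 0"
    by (simp add: mdeg_def)
  then have "lkp m v = lkp 0 v" for v
    by (cases "v \<in> kys m") (auto simp: not_in_keys_iff_lookup_eq_zero)
  then show "m = 0" by (rule poly_mapping_eqI)
qed simp

lemma poly_expand: "p = (\<Sum>m\<in>kys p. sgl m (lkp p m))"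
proof (rule poly_mapping_eqI)
  fix k
  have "lkp (\<Sum>m\<in>kys p. sgl m (lkp p m)) k = (\<Sum>m\<in>kys p. if m = k then lkp p m else 0)"
    by (simp add: lookup_sum lookup_single when_def)
  also have "\<dots> = lkp p k"
    by (auto simp: sum.delta in_keys_iff)
  finally show "lkp p k = lkp (\<Sum>m\<in>kys p. sgl m (lkp p m)) k" by simp
qed

definition flt :: "('k \<Rightarrow> bool) \<Rightarrow> ('k \<Rightarrow>\<^sub>0 'b::zero) \<Rightarrow> ('k \<Rightarrow>\<^sub>0 'b)" where
  "flt P p = Abs_poly_mapping (\<lambda>m. if P m then lkp p m else 0)"

lemma lookup_flt: "lkp (flt P p) m = (if P m then lkp p m else 0)"
proof -
  have "finite {m. (if P m then lkp p m else 0) \<noteq> 0}"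
    by (rule finite_subset[of _ "{m. lkp p m \<noteq> 0}"]) auto
  then show ?thesis unfolding flt_def by simp
qed

lemma keys_flt: "kys (flt P p) = {m \<in> kys p. P m}"
  by (auto simp: in_keys_iff lookup_flt split: if_splits)

lemma flt_0 [simp]: "flt P 0 = 0"
  by (rule poly_mapping_eqI) (simp add: lookup_flt)

lemma flt_add: "flt P (p + q) = flt P p + flt P (q :: 'k \<Rightarrow>\<^sub>0 'b::monoid_add)"
  by (rule poly_mapping_eqI) (simp add: lookup_flt lookup_add)

lemma flt_diff: "flt P (p - q) = flt P p - flt P (q :: 'k \<Rightarrow>\<^sub>0 'b::ab_group_add)"
  by (rule poly_mapping_eqI) (simp add: lookup_flt lookup_minus)

lemma flt_sum: "flt P (sum f A) = (\<Sum>x\<in>A. flt P (f x :: 'k \<Rightarrow>\<^sub>0 'b::comm_monoid_add))"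
  by (induction A rule: infinite_finite_induct) (auto simp: flt_add)

lemma flt_single: "flt P (sgl m c) = (if P m then sgl m c else 0)"
  by (rule poly_mapping_eqI) (auto simp: lookup_flt lookup_single when_def)

lemma flt_flt: "flt P (flt Q p) = flt (\<lambda>m. P m \<and> Q m) p"
  by (rule poly_mapping_eqI) (auto simp: lookup_flt)

lemma flt_id: "(\<And>m. m \<in> kys p \<Longrightarrow> P m) \<Longrightarrow> flt P p = p"
  by (rule poly_mapping_eqI) (auto simp: lookup_flt in_keys_iff)

text \<open>Both sides are sums over pairs of terms. Two uses shape the three predicates: avoiding a
  set of variables splits over a product of monomials, so \<open>kill\<close> is multiplicative; and
  a homogeneous right factor merely shifts the degree asked of the left one.\<close>

lemma flt_mult:
  fixes p q :: "('k::comm_monoid_add) \<Rightarrow>\<^sub>0 ('b::comm_semiring_0)"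
  assumes "\<And>m m'. m \<in> kys p \<Longrightarrow> m' \<in> kys q \<Longrightarrow> Q (m + m') \<longleftrightarrow> P m \<and> R m'"
  shows "flt Q (p * q) = flt P p * flt R q"
proof -
  have "p * q = (\<Sum>m\<in>kys p. sgl m (lkp p m)) * (\<Sum>m\<in>kys q. sgl m (lkp q m))"
    using poly_expand[of p] poly_expand[of q] by simp
  also have "\<dots> = (\<Sum>m\<in>kys p. \<Sum>m'\<in>kys q. sgl (m + m') (lkp p m * lkp q m'))"
    by (simp add: sum_product mult_single)
  finally have "flt Q (p * q) = (\<Sum>m\<in>kys p. \<Sum>m'\<in>kys q. flt Q (sgl (m + m') (lkp p m * lkp q m')))"
    by (simp add: flt_sum)
  also have "\<dots> = (\<Sum>m\<in>kys p. \<Sum>m'\<in>kys q. flt P (sgl m (lkp p m)) * flt R (sgl m' (lkp q m')))"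
    by (intro sum.cong refl) (auto simp: flt_single mult_single assms)
  also have "\<dots> = (\<Sum>m\<in>kys p. flt P (sgl m (lkp p m))) * (\<Sum>m'\<in>kys q. flt R (sgl m' (lkp q m')))"
    by (simp add: sum_product)
  also have "\<dots> = flt P p * flt R q"
    using poly_expand[of p] poly_expand[of q] by (simp flip: flt_sum)
  finally show ?thesis .
qed

lemma lookup_single_mult:
  fixes q :: "('k::cancel_comm_monoid_add) \<Rightarrow>\<^sub>0 ('b::comm_semiring_0)"
  shows "lkp (sgl a c * q) (a + k) = c * lkp q k"
proof -
  have "lkp (sgl a c * q) (a + k) = lkp (\<Sum>m\<in>kys q. sgl (a + m) (c * lkp q m)) (a + k)"
    by (subst poly_expand[of q]) (simp add: sum_distrib_left mult_single)
  also have "\<dots> = (\<Sum>m\<in>kys q. if m = k then c * lkp q m else 0)"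
    by (simp add: lookup_sum lookup_single when_def)
  also have "\<dots> = c * lkp q k"
    by (auto simp: sum.delta in_keys_iff)
  finally show ?thesis .
qed

lemma keys_single_mult:
  fixes q :: "('k::cancel_comm_monoid_add) \<Rightarrow>\<^sub>0 ('b::comm_semiring_0)"
  shows "kys (sgl a c * q) \<subseteq> (+) a ` kys q"
  using keys_mult[of "sgl a c" q] by (auto split: if_splits)

section \<open>Polynomials in a subset of the variables\<close>

definition PR :: "var set \<Rightarrow> ('a::field) mpoly set" where
  "PR A = {p. \<forall>m\<in>kys p. kys m \<subseteq> A}"

text \<open>Setting the variables of \<open>U\<close> to 0. It is a ring retraction onto the
  polynomials without them, so the quotient by these variables is handled as a subring.\<close>

definition kill :: "var set \<Rightarrow> ('a::field) mpoly \<Rightarrow> 'a mpoly" where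
  "kill U = flt (\<lambda>m. kys m \<inter> U = {})"

text \<open>The homogeneous component. Degrees are integers so that shifted degrees such as
  \<open>d - s l\<close> make sense when negative; the component is then 0.\<close>

definition hc :: "int \<Rightarrow> ('a::field) mpoly \<Rightarrow> 'a mpoly" where
  "hc d = flt (\<lambda>m. int (mdeg m) = d)"

definition X :: "var \<Rightarrow> ('a::field) mpoly" where
  "X v = monom (sgl v 1)"

text \<open>Division by the variable \<open>w\<close>: coefficients are read at shifted monomials,
  so terms without \<open>w\<close> disappear. With \<open>kill {w}\<close> as remainder this is the
  division that drives the inductions on degree.\<close>

definition quo :: "var \<Rightarrow> ('a::field) mpoly \<Rightarrow> 'a mpoly" where
  "quo w p = Poly_Mapping.map_key (\<lambda>m. m + sgl w 1) p"

lemma PRing_PR: "PRing n = PR (Vars n)"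
  by (simp add: PRing_def PR_def)

lemma var_x_X: "var_x i j = X (i, j)"
  by (simp add: var_x_def X_def)

lemma PR_mono: "p \<in> PR A \<Longrightarrow> A \<subseteq> B \<Longrightarrow> p \<in> PR B"
  by (auto simp: PR_def)

lemma PR_0 [simp]: "0 \<in> PR A"
  by (simp add: PR_def)

lemma PR_1 [simp]: "1 \<in> PR A"
  by (simp add: PR_def)

lemma PR_single: "kys m \<subseteq> A \<Longrightarrow> sgl m c \<in> PR A"
  by (simp add: PR_def)

lemma PR_monom: "kys m \<subseteq> A \<Longrightarrow> monom m \<in> PR A"
  by (simp add: monom_def PR_single)

lemma PR_X: "w \<in> A \<Longrightarrow> X w \<in> PR A"
  by (simp add: X_def PR_monom)

lemma PR_add: "p \<in> PR A \<Longrightarrow> q \<in> PR A \<Longrightarrow> p + q \<in> PR A"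
  using keys_add[of p q] by (auto simp: PR_def)

lemma PR_uminus: "p \<in> PR A \<Longrightarrow> - p \<in> PR A"
  by (auto simp: PR_def in_keys_iff)

lemma PR_diff: "p \<in> PR A \<Longrightarrow> q \<in> PR A \<Longrightarrow> p - q \<in> PR A"
  using PR_add[of p A "- q"] PR_uminus[of q A] by simp

lemma PR_mult: "p \<in> PR A \<Longrightarrow> q \<in> PR A \<Longrightarrow> p * q \<in> PR A"
  using keys_mult[of p q] by (fastforce simp: PR_def keys_add_nat)

lemma PR_sum: "(\<And>x. x \<in> B \<Longrightarrow> f x \<in> PR A) \<Longrightarrow> sum f B \<in> PR A"
  by (induction B rule: infinite_finite_induct) (auto intro: PR_add)

lemma PR_prod: "(\<And>x. x \<in> B \<Longrightarrow> f x \<in> PR A) \<Longrightarrow> prod f B \<in> PR A"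
  by (induction B rule: infinite_finite_induct) (auto intro: PR_mult)

lemma PR_flt: "p \<in> PR A \<Longrightarrow> flt P p \<in> PR A"
  by (auto simp: PR_def keys_flt)

lemma PR_of_int: "of_int k \<in> PR A"
proof -
  have "(of_int k :: 'a mpoly) = sgl 0 (of_int k)" by simp
  then show ?thesis by (metis PR_single keys_zero empty_subsetI)
qed

lemma kill_0 [simp]: "kill U 0 = 0" by (simp add: kill_def)
lemma kill_add: "kill U (p + q) = kill U p + kill U q" by (simp add: kill_def flt_add)
lemma kill_diff: "kill U (p - q) = kill U p - kill U q" by (simp add: kill_def flt_diff)
lemma kill_sum: "kill U (sum f A) = (\<Sum>x\<in>A. kill U (f x))" by (simp add: kill_def flt_sum)

lemma kill_mult: "kill U (p * q) = kill U p * kill U q"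
  unfolding kill_def by (rule flt_mult) (auto simp: keys_add_nat)

lemma kill_1 [simp]: "kill U 1 = 1"
  by (rule poly_mapping_eqI) (auto simp: kill_def lookup_flt lookup_one when_def)

lemma kill_prod: "kill U (prod f A) = (\<Prod>x\<in>A. kill U (f x))"
  by (induction A rule: infinite_finite_induct) (auto simp: kill_mult)

lemma kill_of_int [simp]: "kill U (of_int k) = of_int k"
proof -
  have "kill U (sgl 0 (of_int k :: 'a)) = sgl 0 (of_int k)" by (simp add: kill_def flt_single del: single_of_int)
  then show ?thesis by simp
qed

lemma kill_kill: "kill U (kill U' p) = kill (U \<union> U') p"
proof -
  have "(\<lambda>m. kys m \<inter> U = {} \<and> kys m \<inter> U' = {}) = (\<lambda>m::mon. kys m \<inter> (U \<union> U') = {})" by auto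
  then show ?thesis unfolding kill_def flt_flt by simp
qed

lemma kill_monom: "kill U (monom m) = (if kys m \<inter> U = {} then monom m else 0)"
  by (simp add: kill_def flt_single monom_def)

lemma kill_X: "kill U (X v) = (if v \<in> U then 0 else X v)"
  by (auto simp: X_def kill_monom)

lemma kill_PR: "p \<in> PR A \<Longrightarrow> kill U p \<in> PR (A - U)"
  by (auto simp: PR_def kill_def keys_flt)

lemma kill_PR': "p \<in> PR A \<Longrightarrow> kill U p \<in> PR A"
  by (auto simp: PR_def kill_def keys_flt)

lemma kill_id: "p \<in> PR A \<Longrightarrow> A \<inter> U = {} \<Longrightarrow> kill U p = p"
  unfolding kill_def by (rule flt_id) (auto simp: PR_def)

lemma lookup_0_kill: "lkp (kill U p) 0 = lkp p 0"
  by (simp add: kill_def lookup_flt)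

lemma hc_0 [simp]: "hc d 0 = 0" by (simp add: hc_def)
lemma hc_diff: "hc d (p - q) = hc d p - hc d q" by (simp add: hc_def flt_diff)
lemma hc_sum: "hc d (sum f A) = (\<Sum>x\<in>A. hc d (f x))" by (simp add: hc_def flt_sum)
lemma hc_PR: "p \<in> PR A \<Longrightarrow> hc d p \<in> PR A" by (simp add: hc_def PR_flt)

lemma hc_mult_homog: "homog q e \<Longrightarrow> hc d (p * q) = hc (d - e) p * q"
proof -
  assume q: "homog q e"
  have "hc d (p * q) = hc (d - e) p * flt (\<lambda>_. True) q"
    unfolding hc_def by (rule flt_mult) (use q in \<open>auto simp: homog_def mdeg_add\<close>)
  then show ?thesis by (simp add: flt_id)
qed

lemma homog_hc: "homog (hc d p) d"
  by (auto simp: homog_def hc_def keys_flt)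

lemma hc_homog: "homog p d \<Longrightarrow> hc d p = p"
  unfolding hc_def by (rule flt_id) (auto simp: homog_def)

lemma hc_homog_iff: "homog p d \<longleftrightarrow> hc d p = p"
  using hc_homog homog_hc by metis

lemma homog_0 [simp]: "homog 0 d" by (simp add: homog_def)

lemma homog_diff: "homog p d \<Longrightarrow> homog q d \<Longrightarrow> homog (p - q) d"
  by (simp add: hc_homog_iff hc_diff)

lemma homog_sum: "(\<And>x. x \<in> A \<Longrightarrow> homog (f x) d) \<Longrightarrow> homog (sum f A) d"
  by (simp add: hc_homog_iff hc_sum)

lemma homog_mult: "homog p d \<Longrightarrow> homog q e \<Longrightarrow> homog (p * q) (d + e)"
  by (simp add: hc_homog_iff hc_mult_homog)

lemma homog_single: "homog (sgl m c) (int (mdeg m))"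
  by (simp add: homog_def)

lemma homog_X: "homog (X w) 1"
  by (simp add: homog_def X_def monom_def)

lemma homog_flt: "homog p d \<Longrightarrow> homog (flt P p) d"
  by (simp add: homog_def keys_flt)

lemma homog_kill: "homog p d \<Longrightarrow> homog (kill U p) d"
  by (simp add: kill_def homog_flt)

lemma hc_kill: "hc d (kill U p) = kill U (hc d p)"
  by (simp add: hc_def kill_def flt_flt conj_commute)

lemma homog_neg: "homog p d \<Longrightarrow> d < 0 \<Longrightarrow> p = 0"
proof (rule ccontr)
  assume "homog p d" "d < 0" "p \<noteq> 0"
  then have "kys p \<noteq> {}" by simp
  then obtain m where "m \<in> kys p" by blast
  with \<open>homog p d\<close> \<open>d < 0\<close> show False by (auto simp: homog_def)
qed

lemma homog_const: "homog p 0 \<Longrightarrow> p = sgl 0 (lkp p 0)"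
  by (rule poly_mapping_eqI)
    (auto simp: homog_def lookup_single when_def in_keys_iff mdeg_eq_0_iff)

lemma hc_expand: 
  assumes "finite D" "\<And>m. m \<in> kys p \<Longrightarrow> int (mdeg m) \<in> D"
  shows "p = (\<Sum>d\<in>D. hc d p)"
proof (rule poly_mapping_eqI)
  fix m
  have "lkp (\<Sum>d\<in>D. hc d p) m = (\<Sum>d\<in>D. if int (mdeg m) = d then lkp p m else 0)"
    by (simp add: lookup_sum hc_def lookup_flt)
  also have "\<dots> = lkp p m"
    using assms by (auto simp: sum.delta' in_keys_iff)
  finally show "lkp p m = lkp (\<Sum>d\<in>D. hc d p) m" by simp
qed

lemma lookup_quo: "lkp (quo w p) m = lkp p (m + sgl w 1)"
proof -
  have "inj (\<lambda>m::mon. m + sgl w 1)" by (simp add: inj_def)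
  then show ?thesis unfolding quo_def by (simp add: map_key.rep_eq)
qed

lemma quo_0 [simp]: "quo w 0 = 0"
  by (rule poly_mapping_eqI) (simp add: lookup_quo)

lemma quo_split: "p = kill {w} p + X w * quo w p"
proof (rule poly_mapping_eqI)
  fix m
  show "lkp p m = lkp (kill {w} p + X w * quo w p) m"
  proof (cases "lkp m w = 0")
    case True
    then have "m \<notin> kys (X w * quo w p)"
      using keys_single_mult[of "sgl w 1" "1::'a" "quo w p"] by (auto simp: X_def monom_def lookup_add)
    then have "lkp (X w * quo w p) m = 0" by (simp add: in_keys_iff)
    moreover have "kys m \<inter> {w} = {}" using True by (auto simp: in_keys_iff)
    ultimately show ?thesis by (simp add: lookup_add kill_def lookup_flt)
  next
    case False
    define k where "k = m - sgl w 1"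
    have m: "m = sgl w 1 + k"
      by (rule poly_mapping_eqI) (use False in \<open>auto simp: k_def lookup_add lookup_minus lookup_single when_def\<close>)
    have "lkp (X w * quo w p) m = lkp p m"
      by (simp only: m X_def monom_def lookup_single_mult lookup_quo add.commute[of k] mult_1_left)
    moreover have "w \<in> kys m" using False by (auto simp: in_keys_iff)
    ultimately show ?thesis by (simp add: lookup_add kill_def lookup_flt)
  qed
qed

lemma quo_X_mult: "quo w (X w * p) = p"
  by (rule poly_mapping_eqI)
    (simp only: lookup_quo X_def monom_def add.commute[of _ "sgl w 1"] lookup_single_mult mult_1_left)

lemma X_mult_cancel: "X w * p = X w * q \<Longrightarrow> p = q"
  by (metis quo_X_mult)

lemma X_mult_0: "X w * p = 0 \<Longrightarrow> p = 0"
  using X_mult_cancel[of w p 0] by simp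

lemma keys_quo: "m \<in> kys (quo w p) \<Longrightarrow> m + sgl w 1 \<in> kys p"
  by (simp add: in_keys_iff lookup_quo)

lemma PR_quo: "p \<in> PR A \<Longrightarrow> quo w p \<in> PR A"
proof -
  assume p: "p \<in> PR A"
  have "kys m \<subseteq> A" if "m \<in> kys (quo w p)" for m
  proof -
    have "kys (m + sgl w 1) \<subseteq> A" using keys_quo[OF that] p unfolding PR_def by blast
    then show ?thesis by (simp only: keys_add_nat) simp
  qed
  then show ?thesis by (simp add: PR_def)
qed

lemma homog_quo: "homog p d \<Longrightarrow> homog (quo w p) (d - 1)"
  unfolding homog_def using keys_quo[of _ w p] by (force simp: mdeg_add)

lemma kill_eq_0: "kill {w} p = 0 \<Longrightarrow> p = X w * quo w p"
  using quo_split[of p w] by simp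

lemma kill_X_mult [simp]: "kill {w} (X w * p) = 0"
  by (simp add: kill_mult kill_X)

lemma PR_kill_split:
  "p \<in> PR (A - {w}) \<Longrightarrow> q \<in> PR A \<Longrightarrow> p + X w * q = 0 \<Longrightarrow> p = 0 \<and> q = 0"
proof -
  assume p: "p \<in> PR (A - {w})" and e: "p + X w * q = 0"
  have "kill {w} (p + X w * q) = p" using kill_id[OF p, of "{w}"] by (simp add: kill_add)
  then have "p = 0" using e by simp
  then show ?thesis using e X_mult_0[of w q] by auto
qed

section \<open>Matrices over polynomial rings: exactness when a variable is killed or
  adjoined\<close>

definition free :: "var set \<Rightarrow> nat \<Rightarrow> (nat \<Rightarrow> ('a::field) mpoly) set" where
  "free A r = {v. (\<forall>l. v l \<in> PR A) \<and> (\<forall>l\<ge>r. v l = 0)}"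

lemma free_mod_free: "free_mod n r = free (Vars n) r"
  by (simp add: free_mod_def free_def PRing_PR)

text \<open>Vectors are functions on all naturals that vanish from the rank on. Cutting the product
  off at \<open>r\<close> keeps this convention, so equality of vectors is equality of
  functions.\<close>

definition gmap :: "nat \<Rightarrow> nat \<Rightarrow> (nat \<Rightarrow> nat \<Rightarrow> ('a::field) mpoly) \<Rightarrow> (nat \<Rightarrow> 'a mpoly) \<Rightarrow> nat \<Rightarrow> 'a mpoly" where
  "gmap r s M v = (\<lambda>k. if k < r then (\<Sum>l<s. M k l * v l) else 0)"

definition img where "img A r s M = gmap r s M ` free A s"
definition ker where "ker A r s M = {v \<in> free A s. gmap r s M v = (\<lambda>_. 0)}"

lemma freeI: "(\<And>l. v l \<in> PR A) \<Longrightarrow> (\<And>l. l \<ge> r \<Longrightarrow> v l = 0) \<Longrightarrow> v \<in> free A r"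
  by (auto simp: free_def)

lemma free_PR: "v \<in> free A r \<Longrightarrow> v l \<in> PR A" by (auto simp: free_def)
lemma free_mono: "v \<in> free A r \<Longrightarrow> A \<subseteq> B \<Longrightarrow> v \<in> free B r"
  by (auto simp: free_def intro: PR_mono)

lemma free_add: "u \<in> free A r \<Longrightarrow> v \<in> free A r \<Longrightarrow> (\<lambda>l. u l + v l) \<in> free A r"
  by (auto simp: free_def intro: PR_add)

lemma free_diff: "u \<in> free A r \<Longrightarrow> v \<in> free A r \<Longrightarrow> (\<lambda>l. u l - v l) \<in> free A r"
  by (auto simp: free_def intro: PR_diff)

lemma free_smult: "p \<in> PR A \<Longrightarrow> v \<in> free A r \<Longrightarrow> (\<lambda>l. p * v l) \<in> free A r"
  by (auto simp: free_def intro: PR_mult)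

lemma free_kill: "v \<in> free A r \<Longrightarrow> (\<lambda>l. kill U (v l)) \<in> free (A - U) r"
  by (auto simp: free_def intro: kill_PR)

lemma free_quo: "v \<in> free A r \<Longrightarrow> (\<lambda>l. quo w (v l)) \<in> free A r"
  by (auto simp: free_def intro: PR_quo)

lemma free_0 [simp]: "(\<lambda>_. 0) \<in> free A r" by (simp add: free_def)

lemma gmap_add: "gmap r s M (\<lambda>l. u l + v l) = (\<lambda>k. gmap r s M u k + gmap r s M v k)"
  by (auto simp: gmap_def fun_eq_iff distrib_left sum.distrib)

lemma gmap_diff: "gmap r s M (\<lambda>l. u l - v l) = (\<lambda>k. gmap r s M u k - gmap r s M v k)"
  by (auto simp: gmap_def fun_eq_iff right_diff_distrib sum_subtractf)

lemma gmap_smult: "gmap r s M (\<lambda>l. p * v l) = (\<lambda>k. p * gmap r s M v k)"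
  by (auto simp: gmap_def fun_eq_iff sum_distrib_left mult_ac)

lemma gmap_0 [simp]: "gmap r s M (\<lambda>l. 0) = (\<lambda>k. 0)"
  by (auto simp: gmap_def fun_eq_iff)

lemma gmap_kill: "gmap r s (\<lambda>k l. kill U (M k l)) (\<lambda>l. kill U (v l)) = (\<lambda>k. kill U (gmap r s M v k))"
  by (auto simp: gmap_def fun_eq_iff kill_sum kill_mult)

lemma gmap_free:
  "(\<And>k l. k < r \<Longrightarrow> l < s \<Longrightarrow> M k l \<in> PR A) \<Longrightarrow> v \<in> free A s \<Longrightarrow> gmap r s M v \<in> free A r"
  by (rule freeI) (auto simp: gmap_def free_def intro!: PR_sum PR_mult)

lemma free_kill_id: "v \<in> free (A - U) r \<Longrightarrow> (\<lambda>l. kill U (v l)) = v"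
  by (auto simp: fun_eq_iff intro!: kill_id[of _ "A - U"] free_PR)

text \<open>The hypothesis \<open>reg\<close> says that \<open>w\<close> is a nonzerodivisor on the
  cokernel of \<open>M\<close>; this is the elementary form of a vanishing Tor. If
  \<open>M v\<close> is 0 modulo \<open>w\<close>, then \<open>M v = w u\<close>, regularity gives
  \<open>u = M x\<close>, and \<open>v - w x\<close> is a true cycle that reduces to
  \<open>v\<close>.\<close>

lemma kill_exact:
  fixes M N :: "nat \<Rightarrow> nat \<Rightarrow> ('a::field) mpoly"
  assumes w: "w \<in> A"
    and M: "\<And>k l. k < r \<Longrightarrow> l < s \<Longrightarrow> M k l \<in> PR A"
    and N: "\<And>k l. k < s \<Longrightarrow> l < t \<Longrightarrow> N k l \<in> PR A"
    and reg: "\<And>u. u \<in> free A r \<Longrightarrow> (\<lambda>k. X w * u k) \<in> img A r s M \<Longrightarrow> u \<in> img A r s M"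
    and ex: "ker A r s M = img A s t N"
  shows "ker (A - {w}) r s (\<lambda>k l. kill {w} (M k l)) = img (A - {w}) s t (\<lambda>k l. kill {w} (N k l))"
proof (intro equalityI subsetI)
  fix v assume "v \<in> ker (A - {w}) r s (\<lambda>k l. kill {w} (M k l))"
  then have v: "v \<in> free (A - {w}) s" and z: "gmap r s (\<lambda>k l. kill {w} (M k l)) v = (\<lambda>_. 0)"
    by (auto simp: ker_def)
  have vA: "v \<in> free A s" using free_mono[OF v] by auto
  have "(\<lambda>k. kill {w} (gmap r s M v k)) = (\<lambda>_. 0)"
    using z gmap_kill[of r s "{w}" M v] free_kill_id[OF v] by simp
  then have u: "gmap r s M v = (\<lambda>k. X w * quo w (gmap r s M v k))"
    by (metis kill_eq_0)
  define u where "u = (\<lambda>k. quo w (gmap r s M v k))"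
  have "u \<in> free A r" unfolding u_def by (intro free_quo gmap_free M vA)
  moreover have "(\<lambda>k. X w * u k) \<in> img A r s M"
    using u vA unfolding u_def img_def by (metis imageI)
  ultimately obtain x where x: "x \<in> free A s" "u = gmap r s M x"
    using reg by (auto simp: img_def)
  \<comment> \<open>The correction by a multiple of \<open>X w\<close> turns \<open>v\<close> into a
    cycle of \<open>M\<close> without changing its value under \<open>kill {w}\<close>.\<close>
  define y where "y = (\<lambda>l. v l - X w * x l)"
  have "gmap r s M y = (\<lambda>k. 0)"
    using u x unfolding y_def gmap_diff gmap_smult u_def[symmetric]
    by (metis cancel_comm_monoid_add_class.diff_cancel u_def)
  then have "y \<in> ker A r s M"
    unfolding ker_def y_def using vA x w by (auto intro!: free_diff free_smult PR_X)
  then obtain z where z: "z \<in> free A t" "y = gmap s t N z"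
    using ex by (auto simp: img_def)
  have "v = (\<lambda>l. kill {w} (y l))"
    unfolding y_def by (simp add: kill_diff fun_cong[OF free_kill_id[OF v]])
  also have "\<dots> = gmap s t (\<lambda>k l. kill {w} (N k l)) (\<lambda>l. kill {w} (z l))"
    by (simp add: gmap_kill z)
  finally show "v \<in> img (A - {w}) s t (\<lambda>k l. kill {w} (N k l))"
    using free_kill[OF z(1), of "{w}"] by (auto simp: img_def)
next
  fix v assume "v \<in> img (A - {w}) s t (\<lambda>k l. kill {w} (N k l))"
  then obtain z where z: "z \<in> free (A - {w}) t" "v = gmap s t (\<lambda>k l. kill {w} (N k l)) z"
    by (auto simp: img_def)
  have zA: "z \<in> free A t" using free_mono[OF z(1)] by auto
  have v: "v = (\<lambda>l. kill {w} (gmap s t N z l))"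
    using z(2) gmap_kill[of s t "{w}" N z] free_kill_id[OF z(1)] by simp
  have "gmap s t N z \<in> ker A r s M" using ex zA by (auto simp: img_def)
  then have k: "gmap s t N z \<in> free A s" "gmap r s M (gmap s t N z) = (\<lambda>_. 0)" by (auto simp: ker_def)
  show "v \<in> ker (A - {w}) r s (\<lambda>k l. kill {w} (M k l))"
    unfolding ker_def v using free_kill[OF k(1), of "{w}"] by (simp add: gmap_kill k(2))
qed

text \<open>A kernel is closed under division by a variable, because a variable can be cancelled in
  each coordinate. Exactness at one position thus supplies the hypothesis \<open>reg\<close> of
  \<open>kill_exact\<close> at the next, and only the augmentation needs a separate
  argument.\<close>

lemma exact_reg:
  fixes L M :: "nat \<Rightarrow> nat \<Rightarrow> ('a::field) mpoly"
  assumes "ker A q r L = img A r s M" 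
    and "u \<in> free A r" "(\<lambda>k. X w * u k) \<in> img A r s M"
  shows "u \<in> img A r s M"
proof -
  have "gmap q r L (\<lambda>k. X w * u k) = (\<lambda>_. 0)" using assms by (auto simp: ker_def)
  then have "gmap q r L u = (\<lambda>_. 0)" unfolding gmap_smult using X_mult_0 by (metis (no_types))
  then show ?thesis using assms by (auto simp: ker_def)
qed

text \<open>Adjoining a variable is a free extension. Writing \<open>v = a + X w * b\<close> with
  \<open>a\<close> free of \<open>w\<close>, a matrix without \<open>w\<close> maps \<open>v\<close>
  to 0 only if it maps \<open>a\<close> and \<open>b\<close> to 0; the part \<open>a\<close> is
  handled over the small ring and \<open>b\<close> has smaller degree.\<close>

lemma ker_ext1:
  fixes M N :: "nat \<Rightarrow> nat \<Rightarrow> ('a::field) mpoly"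
  assumes w: "w \<notin> A"
    and M: "\<And>k l. k < r \<Longrightarrow> l < s \<Longrightarrow> M k l \<in> PR A"
    and N: "\<And>k l. k < s \<Longrightarrow> l < t \<Longrightarrow> N k l \<in> PR A"
    and ex: "ker A r s M = img A s t N"
  shows "ker (insert w A) r s M = img (insert w A) s t N"
proof -
  have split: "f k = 0 \<and> g k = 0" if "f \<in> free A r" "g \<in> free (insert w A) r" "(\<lambda>k. f k + X w * g k) = (\<lambda>_. 0)" for f g :: "nat \<Rightarrow> 'a mpoly" and k
    using PR_kill_split[of "f k" "insert w A" w "g k"] that w by (auto simp: free_def fun_eq_iff)
  have killM: "\<And>v. v \<in> free (insert w A) s \<Longrightarrow> (\<lambda>l. kill {w} (v l)) \<in> free A s"
    using free_kill[of _ "insert w A" s "{w}"] w by auto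
  \<comment> \<open>\<open>D\<close> is a strict bound on the degrees of all terms:
    \<open>D = 0\<close> leaves only the zero vector, and passing to the quotient by
    \<open>w\<close> lowers the bound by one.\<close>
  have main: "v \<in> free (insert w A) s \<Longrightarrow> gmap r s M v = (\<lambda>_. 0) \<Longrightarrow> (\<forall>l<s. \<forall>m\<in>kys (v l). mdeg m < D)
     \<Longrightarrow> v \<in> img (insert w A) s t N" for v D
  proof (induction D arbitrary: v)
    case 0
    then have "v l = 0" for l by (cases "l < s") (auto simp: free_def)
    then have "v = gmap s t N (\<lambda>_. 0)" by auto
    then show ?case unfolding img_def by (metis free_0 imageI)
  next
    case (Suc D)
    define a where "a = (\<lambda>l. kill {w} (v l))"
    define b where "b = (\<lambda>l. quo w (v l))"
    have a: "a \<in> free A s" unfolding a_def using killM Suc by auto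
    have b: "b \<in> free (insert w A) s" unfolding b_def by (rule free_quo) (rule Suc)
    have v: "v = (\<lambda>l. a l + X w * b l)" unfolding a_def b_def by (simp flip: quo_split)
    have "(\<lambda>k. gmap r s M a k + X w * gmap r s M b k) = (\<lambda>_. 0)"
      using Suc.prems(2) unfolding v gmap_add gmap_smult .
    moreover have "gmap r s M a \<in> free A r" by (intro gmap_free M a)
    moreover have "gmap r s M b \<in> free (insert w A) r"
      by (intro gmap_free b) (use M PR_mono in blast)
    ultimately have za: "gmap r s M a = (\<lambda>_. 0)" and zb: "gmap r s M b = (\<lambda>_. 0)"
      using split by (auto simp: fun_eq_iff)
    have "b \<in> img (insert w A) s t N"
    proof (rule Suc.IH[OF b zb], intro allI impI ballI)
      fix l m assume "l < s" "m \<in> kys (b l)"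
      then have "mdeg (m + sgl w 1) < Suc D" using Suc.prems(3) keys_quo unfolding b_def by metis
      then show "mdeg m < D" by (simp add: mdeg_add)
    qed
    then obtain y where y: "y \<in> free (insert w A) t" "b = gmap s t N y" by (auto simp: img_def)
    have "a \<in> img A s t N" using ex a za by (auto simp: ker_def)
    then obtain x where x: "x \<in> free A t" "a = gmap s t N x" by (auto simp: img_def)
    have "v = gmap s t N (\<lambda>l. x l + X w * y l)"
      unfolding gmap_add gmap_smult v x(2)[symmetric] y(2)[symmetric] ..
    moreover have "(\<lambda>l. x l + X w * y l) \<in> free (insert w A) t"
      using x(1) y(1) by (intro free_add free_smult PR_X) (auto intro: free_mono)
    ultimately show ?case by (auto simp: img_def)
  qed
  show ?thesis
  proof (intro equalityI subsetI)
    fix v assume "v \<in> ker (insert w A) r s M"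
    then have v: "v \<in> free (insert w A) s" "gmap r s M v = (\<lambda>_. 0)" by (auto simp: ker_def)
    define D where "D = Suc (\<Sum>l<s. \<Sum>m\<in>kys (v l). mdeg m)"
    have "mdeg m < D" if "l < s" "m \<in> kys (v l)" for l m
    proof -
      have "mdeg m \<le> (\<Sum>m\<in>kys (v l). mdeg m)" using that by (intro member_le_sum) auto
      also have "\<dots> \<le> (\<Sum>l<s. \<Sum>m\<in>kys (v l). mdeg m)" using that by (intro member_le_sum[of l]) auto
      finally show ?thesis by (simp add: D_def)
    qed
    then show "v \<in> img (insert w A) s t N" using main v by blast
  next
    fix v assume "v \<in> img (insert w A) s t N"
    then obtain z where z: "z \<in> free (insert w A) t" "v = gmap s t N z" by (auto simp: img_def)
    have vin: "v \<in> free (insert w A) s" unfolding z(2) by (intro gmap_free z(1)) (use N PR_mono in blast)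
    \<comment> \<open>That \<open>M\<close> annihilates the image of \<open>N\<close> is known only
      for vectors over the small ring; the same splitting by powers of \<open>w\<close> carries it
      over.\<close>
    have "z \<in> free (insert w A) t \<Longrightarrow> (\<forall>l<t. \<forall>m\<in>kys (z l). mdeg m < D) \<Longrightarrow> gmap r s M (gmap s t N z) = (\<lambda>_. 0)" for z D
    proof (induction D arbitrary: z)
      case 0
      then have "z l = 0" for l by (cases "l < t") (auto simp: free_def)
      then have "z = (\<lambda>_. 0)" by auto
      then show ?case by simp
    next
      case (Suc D)
      define a where "a = (\<lambda>l. kill {w} (z l))"
      define b where "b = (\<lambda>l. quo w (z l))"
      have a: "a \<in> free A t" unfolding a_def using free_kill[OF Suc.prems(1), of "{w}"] w by auto
      have b: "b \<in> free (insert w A) t" unfolding b_def by (rule free_quo) (rule Suc)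
      have z: "z = (\<lambda>l. a l + X w * b l)" unfolding a_def b_def by (simp flip: quo_split)
      have "gmap r s M (gmap s t N b) = (\<lambda>_. 0)"
      proof (rule Suc.IH[OF b], intro allI impI ballI)
        fix l m assume "l < t" "m \<in> kys (b l)"
        then have "mdeg (m + sgl w 1) < Suc D" using Suc.prems(2) keys_quo unfolding b_def by metis
        then show "mdeg m < D" by (simp add: mdeg_add)
      qed
      moreover have "gmap r s M (gmap s t N a) = (\<lambda>_. 0)"
        using ex a by (force simp: ker_def img_def)
      ultimately show ?case unfolding z gmap_add gmap_smult by simp
    qed
    note main2 = this
    define D where "D = Suc (\<Sum>l<t. \<Sum>m\<in>kys (z l). mdeg m)"
    have "mdeg m < D" if "l < t" "m \<in> kys (z l)" for l m
    proof -
      have "mdeg m \<le> (\<Sum>m\<in>kys (z l). mdeg m)" using that by (intro member_le_sum) auto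
      also have "\<dots> \<le> (\<Sum>l<t. \<Sum>m\<in>kys (z l). mdeg m)" using that by (intro member_le_sum[of l]) auto
      finally show ?thesis by (simp add: D_def)
    qed
    then have "gmap r s M v = (\<lambda>_. 0)" using main2 z by blast
    then show "v \<in> ker (insert w A) r s M" using vin by (auto simp: ker_def)
  qed
qed

lemma ker_ext:
  fixes M N :: "nat \<Rightarrow> nat \<Rightarrow> ('a::field) mpoly"
  assumes "finite W"
    and M: "\<And>k l. k < r \<Longrightarrow> l < s \<Longrightarrow> M k l \<in> PR A"
    and N: "\<And>k l. k < s \<Longrightarrow> l < t \<Longrightarrow> N k l \<in> PR A"
    and ex: "ker A r s M = img A s t N"
  shows "ker (W \<union> A) r s M = img (W \<union> A) s t N"
  using assms(1)
proof (induction W)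
  case empty
  then show ?case using ex by simp
next
  case (insert w W)
  show ?case
  proof (cases "w \<in> A")
    case True
    then have "insert w W \<union> A = W \<union> A" by auto
    then show ?thesis using insert.IH by simp
  next
    case False
    have "ker (insert w (W \<union> A)) r s M = img (insert w (W \<union> A)) s t N"
      by (rule ker_ext1) (use False insert M N PR_mono in \<open>auto, blast+\<close>)
    then show ?thesis by simp
  qed
qed

section \<open>Noetherianity\<close>

lemma incseq_subseq:
  fixes f :: "nat \<Rightarrow> nat"
  shows "\<exists>r::nat \<Rightarrow> nat. strict_mono r \<and> (\<forall>i j. i \<le> j \<longrightarrow> f (r i) \<le> f (r j))"
proof -
  obtain r :: "nat \<Rightarrow> nat" where r: "strict_mono r" "monoseq (f \<circ> r)"
    using seq_monosub[of f] unfolding o_def by blast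
  show ?thesis
  proof (cases "incseq (f \<circ> r)")
    case True
    then have "f (r i) \<le> f (r j)" if "i \<le> j" for i j using that by (auto simp: incseq_def)
    then show ?thesis using r(1) by blast
  next
    case False
    then have d: "\<And>i j. i \<le> j \<Longrightarrow> f (r j) \<le> f (r i)" using r(2) by (auto simp: monoseq_def incseq_def)
    \<comment> \<open>A decreasing sequence of naturals is constant from the point where it attains
      its least value, and the constant tail is also increasing.\<close>
    define m where "m = (LEAST v. v \<in> range (f \<circ> r))"
    have "m \<in> range (f \<circ> r)" unfolding m_def by (rule LeastI_ex) auto
    then obtain N where N: "f (r N) = m" by auto
    have "f (r (N + i)) = m" for i
    proof (rule antisym)
      show "f (r (N + i)) \<le> m" using d[of N "N + i"] N by simp
      show "m \<le> f (r (N + i))" unfolding m_def by (rule Least_le) auto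
    qed
    moreover have "strict_mono (\<lambda>i. r (N + i))" using r(1) by (auto simp: strict_mono_def)
    ultimately show ?thesis by (metis le_refl)
  qed
qed

lemma incseq_subseq_fin:
  fixes f :: "nat \<Rightarrow> 'v \<Rightarrow> nat"
  assumes "finite A"
  shows "\<exists>r::nat \<Rightarrow> nat. strict_mono r \<and> (\<forall>v\<in>A. \<forall>i j. i \<le> j \<longrightarrow> f (r i) v \<le> f (r j) v)"
  using assms
proof (induction A rule: finite_induct)
  case empty
  have "strict_mono (\<lambda>i::nat. i)" by (simp add: strict_mono_def)
  then show ?case by blast
next
  case (insert w A)
  from insert.IH obtain r :: "nat \<Rightarrow> nat" where r': "strict_mono r \<and> (\<forall>v\<in>A. \<forall>i j. i \<le> j \<longrightarrow> f (r i) v \<le> f (r j) v)" ..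
  note r = conjunct1[OF r'] conjunct2[OF r']
  obtain s :: "nat \<Rightarrow> nat" where s': "strict_mono s \<and> (\<forall>i j. i \<le> j \<longrightarrow> f (r (s i)) w \<le> f (r (s j)) w)"
    using incseq_subseq[of "\<lambda>i. f (r i) w"] ..
  note s = conjunct1[OF s'] conjunct2[OF s']
  show ?case
  proof (intro exI conjI ballI allI impI)
    show "strict_mono (\<lambda>i. r (s i))" using r(1) s(1) by (simp add: strict_mono_def)
    fix v i j assume v: "v \<in> insert w A" and ij: "i \<le> (j::nat)"
    show "f (r (s i)) v \<le> f (r (s j)) v"
    proof (cases "v = w")
      case True
      then show ?thesis using s(2) ij by simp
    next
      case False
      moreover have "s i \<le> s j" using strict_mono_less_eq[OF s(1)] ij by simp
      ultimately show ?thesis using r(2) v by simp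
    qed
  qed
qed

definition mdvd :: "mon \<Rightarrow> mon \<Rightarrow> bool" where
  "mdvd a b \<longleftrightarrow> (\<exists>t. b = a + t)"

lemma mdvd_iff: "mdvd a b \<longleftrightarrow> (\<forall>v. lkp a v \<le> lkp b v)"
proof
  assume le: "\<forall>v. lkp a v \<le> lkp b v"
  have "b = a + (b - a)"
  proof (rule poly_mapping_eqI)
    fix v
    show "lkp b v = lkp (a + (b - a)) v" using spec[OF le, of v] by (simp add: lookup_add lookup_minus)
  qed
  then show "mdvd a b" unfolding mdvd_def by blast
qed (auto simp: mdvd_def lookup_add)

text \<open>If no finite subset suffices, one can choose forever monomials not divisible by any
  earlier choice. A subsequence along which every exponent is nondecreasing then contains an earlier
  element dividing a later one.\<close>

lemma dickson:
  assumes "finite A" and L: "\<And>m. m \<in> L \<Longrightarrow> kys m \<subseteq> A"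
  shows "\<exists>B. finite B \<and> B \<subseteq> L \<and> (\<forall>m\<in>L. \<exists>b\<in>B. mdvd b m)"
proof (rule ccontr)
  assume neg: "\<not> ?thesis"
  have step: "\<exists>m. m \<in> L \<and> (\<forall>b\<in>B. \<not> mdvd b m)" if B: "finite B" "B \<subseteq> L" for B
  proof (rule ccontr)
    assume "\<not> ?thesis"
    then have "\<forall>m\<in>L. \<exists>b\<in>B. mdvd b m" by blast
    with B have "finite B \<and> B \<subseteq> L \<and> (\<forall>m\<in>L. \<exists>b\<in>B. mdvd b m)" by (intro conjI)
    then have "\<exists>B. finite B \<and> B \<subseteq> L \<and> (\<forall>m\<in>L. \<exists>b\<in>B. mdvd b m)" by (rule exI)
    then show False using neg by (rule notE[rotated])
  qed
  define g where "g = (\<lambda>B. SOME m. m \<in> L \<and> (\<forall>b\<in>B. \<not> mdvd b m))"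
  have g: "g B \<in> L \<and> (\<forall>b\<in>B. \<not> mdvd b (g B))" if "finite B" "B \<subseteq> L" for B
    unfolding g_def by (rule someI_ex) (rule step[OF that])
  define S where "S = rec_nat {} (\<lambda>_ B. insert (g B) B)"
  have S0: "S 0 = {}" and SS: "\<And>k. S (Suc k) = insert (g (S k)) (S k)" by (simp_all add: S_def)
  have Sf: "finite (S k) \<and> S k \<subseteq> L" for k
    by (induction k) (auto simp: S0 SS g)
  have mono: "S i \<subseteq> S j" if "i \<le> j" for i j
    using lift_Suc_mono_le[of S i j] that by (auto simp: SS)
  define a where "a k = g (S k)" for k
  have bad: "\<not> mdvd (a i) (a j)" if "i < j" for i j
  proof -
    have "a i \<in> S (Suc i)" by (simp add: SS a_def)
    then have "a i \<in> S j" using mono[of "Suc i" j] that by auto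
    then show ?thesis using g[of "S j"] Sf[of j] by (auto simp: a_def)
  qed
  have aL: "a k \<in> L" for k using g Sf by (auto simp: a_def)
  have "\<exists>r::nat \<Rightarrow> nat. strict_mono r \<and> (\<forall>v\<in>A. \<forall>i j. i \<le> j \<longrightarrow> lkp (a (r i)) v \<le> lkp (a (r j)) v)"
    by (rule incseq_subseq_fin[OF assms(1), of "\<lambda>k. lkp (a k)"])
  then obtain r :: "nat \<Rightarrow> nat" where r': "strict_mono r \<and> (\<forall>v\<in>A. \<forall>i j. i \<le> j \<longrightarrow> lkp (a (r i)) v \<le> lkp (a (r j)) v)" ..
  note r = conjunct1[OF r'] conjunct2[OF r']
  have "mdvd (a (r 0)) (a (r 1))"
    unfolding mdvd_iff
  proof
    fix v
    show "lkp (a (r 0)) v \<le> lkp (a (r 1)) v"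
    proof (cases "v \<in> A")
      case False
      then have "v \<notin> kys (a (r 0))" using L[OF aL] by blast
      then show ?thesis by (simp add: in_keys_iff)
    next
      case True
      then show ?thesis using bspec[OF r(2), of v] by simp
    qed
  qed
  moreover have "r 0 < r 1" using r(1) by (simp add: strict_mono_def)
  ultimately show False using bad by blast
qed

section \<open>Graded submodules of free modules and their finite generation\<close>

definition hcv :: "(nat \<Rightarrow> int) \<Rightarrow> int \<Rightarrow> (nat \<Rightarrow> ('a::field) mpoly) \<Rightarrow> nat \<Rightarrow> 'a mpoly" where
  "hcv s d v = (\<lambda>l. hc (d - s l) (v l))"

definition homogv :: "nat \<Rightarrow> (nat \<Rightarrow> int) \<Rightarrow> int \<Rightarrow> (nat \<Rightarrow> ('a::field) mpoly) \<Rightarrow> bool" where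
  "homogv r s d v \<longleftrightarrow> (\<forall>l<r. homog (v l) (d - s l))"

text \<open>A graded submodule of the free module whose basis elements have degrees
  \<open>s l\<close>. Closure under \<open>hcv\<close> is the graded condition: with an element, all
  its homogeneous components belong to the submodule.\<close>

definition gsub :: "var set \<Rightarrow> nat \<Rightarrow> (nat \<Rightarrow> int) \<Rightarrow> (nat \<Rightarrow> ('a::field) mpoly) set \<Rightarrow> bool" where
  "gsub A r s M \<longleftrightarrow> M \<subseteq> free A r \<and> (\<lambda>_. 0) \<in> M \<and>
     (\<forall>u\<in>M. \<forall>v\<in>M. (\<lambda>l. u l + v l) \<in> M) \<and>
     (\<forall>p\<in>PR A. \<forall>v\<in>M. (\<lambda>l. p * v l) \<in> M) \<and>
     (\<forall>v\<in>M. \<forall>d. hcv s d v \<in> M)"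

lemma gsub_free: "gsub A r s M \<Longrightarrow> v \<in> M \<Longrightarrow> v \<in> free A r"
  by (auto simp: gsub_def)
lemma gsub_0: "gsub A r s M \<Longrightarrow> (\<lambda>_. 0) \<in> M" by (simp add: gsub_def)
lemma gsub_add: "gsub A r s M \<Longrightarrow> u \<in> M \<Longrightarrow> v \<in> M \<Longrightarrow> (\<lambda>l. u l + v l) \<in> M"
  by (simp add: gsub_def)
lemma gsub_smult: "gsub A r s M \<Longrightarrow> p \<in> PR A \<Longrightarrow> v \<in> M \<Longrightarrow> (\<lambda>l. p * v l) \<in> M"
  by (simp add: gsub_def)
lemma gsub_hcv: "gsub A r s M \<Longrightarrow> v \<in> M \<Longrightarrow> hcv s d v \<in> M"
  by (simp add: gsub_def)
lemma gsub_diff: "gsub A r s M \<Longrightarrow> u \<in> M \<Longrightarrow> v \<in> M \<Longrightarrow> (\<lambda>l. u l - v l) \<in> M"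
  using gsub_add[of A r s M u "\<lambda>l. -1 * v l"] gsub_smult[of A r s M "-1" v] by (simp add: PR_uminus)

lemma gsub_sum: "gsub A r s M \<Longrightarrow> (\<And>x. x \<in> B \<Longrightarrow> f x \<in> M) \<Longrightarrow> (\<lambda>l. \<Sum>x\<in>B. f x l) \<in> M"
  by (induction B rule: infinite_finite_induct) (auto simp: gsub_0 gsub_add)

lemma homogv_hcv: "homogv r s d (hcv s d v)"
  by (simp add: homogv_def hcv_def homog_hc)

lemma hcv_expand:
  assumes "v \<in> free A r"
  shows "\<exists>D. finite D \<and> v = (\<lambda>l. \<Sum>d\<in>D. hcv s d v l)"
proof -
  define D where "D = (\<Union>l<r. (\<lambda>m. int (mdeg m) + s l) ` kys (v l))"
  have "v l = (\<Sum>d\<in>D. hcv s d v l)" for l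
  proof (cases "l < r")
    case True
    have "v l = (\<Sum>e\<in>(\<lambda>d. d - s l) ` D. hc e (v l))"
      by (rule hc_expand) (use True in \<open>force simp: D_def\<close>)+
    also have "\<dots> = (\<Sum>d\<in>D. hc (d - s l) (v l))"
      by (subst sum.reindex) (auto simp: inj_on_def)
    finally show ?thesis by (simp add: hcv_def)
  next
    case False
    then show ?thesis using assms by (simp add: hcv_def free_def)
  qed
  then have "v = (\<lambda>l. \<Sum>d\<in>D. hcv s d v l)" by blast
  moreover have "finite D" by (simp add: D_def)
  ultimately show ?thesis by blast
qed

definition gen_by :: "var set \<Rightarrow> (nat \<Rightarrow> ('a::field) mpoly) set \<Rightarrow> (nat \<Rightarrow> 'a mpoly) set" where
  "gen_by A G = {v. \<exists>c. (\<forall>g\<in>G. c g \<in> PR A) \<and> v = (\<lambda>l. \<Sum>g\<in>G. c g * g l)}"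

lemma gen_by_mono:
  assumes "v \<in> gen_by A G" "G \<subseteq> G'" "finite G'"
  shows "v \<in> gen_by A G'"
proof -
  obtain c where c: "\<forall>g\<in>G. c g \<in> PR A" "v = (\<lambda>l. \<Sum>g\<in>G. c g * g l)" using assms by (auto simp: gen_by_def)
  have "v = (\<lambda>l. \<Sum>g\<in>G'. (if g \<in> G then c g else 0) * g l)"
    unfolding c(2) by (intro ext sum.mono_neutral_cong_left) (use assms in auto)
  then show ?thesis unfolding gen_by_def using c(1) by (auto intro!: exI[of _ "\<lambda>g. if g \<in> G then c g else 0"])
qed

lemma gen_by_add: "u \<in> gen_by A G \<Longrightarrow> v \<in> gen_by A G \<Longrightarrow> (\<lambda>l. u l + v l) \<in> gen_by A G"
proof -
  assume "u \<in> gen_by A G" "v \<in> gen_by A G"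
  then obtain c d where "\<forall>g\<in>G. c g \<in> PR A" "u = (\<lambda>l. \<Sum>g\<in>G. c g * g l)" "\<forall>g\<in>G. d g \<in> PR A" "v = (\<lambda>l. \<Sum>g\<in>G. d g * g l)"
    unfolding gen_by_def by blast
  then show ?thesis unfolding gen_by_def
    by (auto intro!: exI[of _ "\<lambda>g. c g + d g"] PR_add simp: distrib_right sum.distrib)
qed

lemma gen_by_0: "(\<lambda>_. 0) \<in> gen_by A G"
  unfolding gen_by_def by (auto intro!: exI[of _ "\<lambda>_. 0"])

lemma gen_by_smult: "v \<in> gen_by A G \<Longrightarrow> p \<in> PR A \<Longrightarrow> (\<lambda>l. p * v l) \<in> gen_by A G"
proof -
  assume p: "p \<in> PR A" and "v \<in> gen_by A G"
  then obtain c where "\<forall>g\<in>G. c g \<in> PR A" "v = (\<lambda>l. \<Sum>g\<in>G. c g * g l)"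
    unfolding gen_by_def by blast
  then show ?thesis unfolding gen_by_def using p
    by (auto intro!: exI[of _ "\<lambda>g. p * c g"] PR_mult simp: sum_distrib_left mult.assoc)
qed

lemma gen_by_sum: "(\<And>x. x \<in> B \<Longrightarrow> f x \<in> gen_by A G) \<Longrightarrow> (\<lambda>l. \<Sum>x\<in>B. f x l) \<in> gen_by A G"
  by (induction B rule: infinite_finite_induct) (auto simp: gen_by_0 gen_by_add)

lemma gen_by_base: "finite G \<Longrightarrow> g \<in> G \<Longrightarrow> g \<in> gen_by A G"
proof -
  assume G: "finite G" "g \<in> G"
  have "(\<Sum>h\<in>G. (if h = g then 1 else 0) * h l) = g l" for l
  proof -
    have "(\<Sum>h\<in>G. (if h = g then 1 else 0) * h l) = (\<Sum>h\<in>G. if h = g then g l else 0)"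
      by (rule sum.cong) auto
    then show ?thesis using G by (simp add: sum.delta)
  qed
  then show ?thesis unfolding gen_by_def by (auto intro!: exI[of _ "\<lambda>h. if h = g then 1 else 0"])
qed

lemma gen_by_gsub: "gsub A r s M \<Longrightarrow> G \<subseteq> M \<Longrightarrow> gen_by A G \<subseteq> M"
  unfolding gen_by_def by (auto intro!: gsub_sum gsub_smult)

text \<open>Any injective rank turns the monomials in finitely many variables into a totally ordered set;
  the order used here compares the exponents of the variable of smallest rank where they differ.\<close>
definition mlt :: "(var \<Rightarrow> nat) \<Rightarrow> mon \<Rightarrow> mon \<Rightarrow> bool" where
  "mlt k m m' \<longleftrightarrow> (\<exists>v. lkp m v > lkp m' v \<and> (\<forall>u. k u < k v \<longrightarrow> lkp m u = lkp m' u))"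

lemma mlt_irrefl: "\<not> mlt k m m" by (simp add: mlt_def)

lemma mlt_trans:
  assumes "inj k" "mlt k a b" "mlt k b c"
  shows "mlt k a c"
proof -
  obtain v where v: "lkp a v > lkp b v" "\<And>u. k u < k v \<Longrightarrow> lkp a u = lkp b u" using assms(2) by (auto simp: mlt_def)
  obtain w where w: "lkp b w > lkp c w" "\<And>u. k u < k w \<Longrightarrow> lkp b u = lkp c u" using assms(3) by (auto simp: mlt_def)
  consider "k v < k w" | "k w < k v" | "v = w" using assms(1) by (metis injD linorder_cases)
  then show ?thesis
  proof cases
    case 1
    then show ?thesis unfolding mlt_def using v w by (intro exI[of _ v]) auto
  next
    case 2
    then show ?thesis unfolding mlt_def using v w by (intro exI[of _ w]) auto
  next
    case 3
    then show ?thesis unfolding mlt_def using v w by (intro exI[of _ v]) auto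
  qed
qed

lemma mlt_total:
  assumes "inj k" "m \<noteq> m'"
  shows "mlt k m m' \<or> mlt k m' m"
proof -
  define D where "D = {v. lkp m v \<noteq> lkp m' v}"
  have "\<exists>v. lkp m v \<noteq> lkp m' v"
  proof (rule ccontr)
    assume "\<not> ?thesis"
    then have "m = m'" by (intro poly_mapping_eqI) blast
    then show False using assms(2) by simp
  qed
  then obtain v0 where "v0 \<in> D" by (auto simp: D_def)
  then obtain v where v: "v \<in> D" "\<And>u. u \<in> D \<Longrightarrow> k v \<le> k u"
    using ex_has_least_nat[of "\<lambda>v. v \<in> D" v0 k] by blast
  have "\<And>u. k u < k v \<Longrightarrow> lkp m u = lkp m' u" using v(2) by (force simp: D_def)
  moreover have "lkp m v > lkp m' v \<or> lkp m' v > lkp m v" using v(1) by (auto simp: D_def)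
  ultimately show ?thesis unfolding mlt_def by metis
qed

lemma mlt_add: "mlt k (t + m) (t + m') \<longleftrightarrow> mlt k m m'"
  by (simp add: mlt_def lookup_add)

lemma finite_mlt_max:
  assumes "inj k" "finite S" "S \<noteq> {}"
  shows "\<exists>m\<in>S. \<forall>m'\<in>S. m' \<noteq> m \<longrightarrow> mlt k m' m"
  using assms(2,3)
proof (induction S rule: finite_ne_induct)
  case (insert x S)
  then obtain m where m: "m \<in> S" "\<And>m'. m' \<in> S \<Longrightarrow> m' \<noteq> m \<Longrightarrow> mlt k m' m" by blast
  show ?case
  proof (cases "mlt k x m")
    case True
    then show ?thesis using m by blast
  next
    case False
    then have "mlt k m x" using mlt_total[OF assms(1), of x m] insert m by auto
    then show ?thesis using m mlt_trans[OF assms(1)] by (intro bexI[of _ x]) blast+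
  qed
qed auto

lemma finite_mons:
  assumes "finite A"
  shows "finite {m. kys m \<subseteq> A \<and> mdeg m = D}"
proof -
  have "finite (lkp ` {m. kys m \<subseteq> A \<and> mdeg m = D})"
  proof (rule finite_subset)
    show "lkp ` {m. kys m \<subseteq> A \<and> mdeg m = D} \<subseteq> {f. \<forall>v. (v \<in> A \<longrightarrow> f v \<in> {..D}) \<and> (v \<notin> A \<longrightarrow> f v = 0)}"
    proof (clarsimp)
      fix m a b assume m: "kys m \<subseteq> A" "D = mdeg m"
      show "((a, b) \<in> A \<longrightarrow> lkp m (a, b) \<le> mdeg m) \<and> ((a, b) \<notin> A \<longrightarrow> lkp m (a, b) = 0)"
        using mdeg_superset[OF assms m(1)] member_le_sum[of "(a, b)" A "lkp m"] assms m(1)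
        by (auto simp: in_keys_iff)
    qed
    show "finite {f. \<forall>v. (v \<in> A \<longrightarrow> f v \<in> {..D}) \<and> (v \<notin> A \<longrightarrow> f v = (0::nat))}"
      by (rule finite_set_of_finite_funs) (use assms in auto)
  qed
  then show ?thesis by (rule finite_imageD) (rule inj_onI, erule poly_mapping_eq_iff[THEN iffD2])
qed

text \<open>Hilbert's basis theorem by division: Dickson's lemma gives finitely many homogeneous
  elements whose leading monomials divide all others, and leading terms are cancelled one after
  another. The order \<open>mlt\<close> is not a well-order, as the powers of a variable decrease;
  division terminates because a homogeneous element can only meet the finitely many monomials of its
  degree.\<close>

lemma homog_ideal_fg:
  fixes I :: "('a::field) mpoly set"
  assumes A: "finite A" and I: "I \<subseteq> PR A" and add: "\<And>p q. p \<in> I \<Longrightarrow> q \<in> I \<Longrightarrow> p + q \<in> I"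
    and smult: "\<And>p q. p \<in> PR A \<Longrightarrow> q \<in> I \<Longrightarrow> p * q \<in> I"
  shows "\<exists>G. finite G \<and> G \<subseteq> {f\<in>I. \<exists>d. homog f d} \<and>
           (\<forall>f\<in>I. (\<exists>d. homog f d) \<longrightarrow> (\<exists>c. (\<forall>g\<in>G. c g \<in> PR A) \<and> f = (\<Sum>g\<in>G. c g * g)))"
proof -
  define k where "k = (to_nat :: var \<Rightarrow> nat)"
  have k: "inj k" by (simp add: k_def)
  define ld where "ld f = (SOME m. m \<in> kys f \<and> (\<forall>m'\<in>kys f. m' \<noteq> m \<longrightarrow> mlt k m' m))" for f :: "'a mpoly"
  have ld: "ld f \<in> kys f" "\<And>m'. m' \<in> kys f \<Longrightarrow> m' \<noteq> ld f \<Longrightarrow> mlt k m' (ld f)" if "f \<noteq> 0" for f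
  proof -
    have "kys f \<noteq> {}" using that by simp
    from finite_mlt_max[OF k finite_keys this]
    have "\<exists>m. m \<in> kys f \<and> (\<forall>m'\<in>kys f. m' \<noteq> m \<longrightarrow> mlt k m' m)" by blast
    from someI_ex[OF this] have "ld f \<in> kys f \<and> (\<forall>m'\<in>kys f. m' \<noteq> ld f \<longrightarrow> mlt k m' (ld f))"
      unfolding ld_def .
    then show "ld f \<in> kys f" "\<And>m'. m' \<in> kys f \<Longrightarrow> m' \<noteq> ld f \<Longrightarrow> mlt k m' (ld f)" by auto
  qed
  define HI where "HI = {f \<in> I. f \<noteq> 0 \<and> (\<exists>d. homog f d)}"
  have kA: "kys (ld f) \<subseteq> A" if "f \<in> HI" for f
    using that ld(1)[of f] I by (auto simp: HI_def PR_def)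
  have "\<exists>B. finite B \<and> B \<subseteq> ld ` HI \<and> (\<forall>m\<in>ld ` HI. \<exists>b\<in>B. mdvd b m)"
    by (rule dickson[OF A]) (use kA in auto)
  then obtain B where B': "finite B \<and> B \<subseteq> ld ` HI \<and> (\<forall>m\<in>ld ` HI. \<exists>b\<in>B. mdvd b m)" ..
  note B = conjunct1[OF B'] conjunct1[OF conjunct2[OF B']] bspec[OF conjunct2[OF conjunct2[OF B']]]
  define F where "F b = (SOME f. f \<in> HI \<and> ld f = b)" for b
  have F: "F b \<in> HI \<and> ld (F b) = b" if "b \<in> B" for b
    unfolding F_def by (rule someI_ex) (use B(2) that in auto)
  define G where "G = F ` B"
  define P where "P f \<longleftrightarrow> (\<exists>c. (\<forall>g\<in>G. c g \<in> PR A) \<and> f = (\<Sum>g\<in>G. c g * g))" for f :: "'a mpoly"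
  have finG: "finite G" using B(1) by (simp add: G_def)
  have P_add: "P (f + t * g)" if "P f" "g \<in> G" "t \<in> PR A" for f g t
  proof -
    obtain c where c: "\<forall>g\<in>G. c g \<in> PR A" "f = (\<Sum>g\<in>G. c g * g)" using \<open>P f\<close> by (auto simp: P_def)
    have "(\<Sum>h\<in>G. (c h + (if h = g then t else 0)) * h) = (\<Sum>h\<in>G. c h * h) + (\<Sum>h\<in>G. if h = g then t * g else 0)"
      by (subst sum.distrib[symmetric]) (rule sum.cong, auto simp: distrib_right)
    also have "\<dots> = f + t * g" using c that finG by (simp add: sum.delta)
    finally show ?thesis unfolding P_def using c that
      by (intro exI[of _ "\<lambda>h. c h + (if h = g then t else 0)"]) (auto intro: PR_add)
  qed
  \<comment> \<open>The cardinality counts the monomials of degree \<open>D\<close> that are terms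
    of \<open>f\<close> or lie below one. Cancelling the leading term removes it from this set and
    adds nothing.\<close>
  have main: "P f" if "f \<in> I" "homog f (int D)" "card {m. kys m \<subseteq> A \<and> mdeg m = D \<and> (\<exists>m'\<in>kys f. m = m' \<or> mlt k m m')} < N" for f D N
    using that
  proof (induction N arbitrary: f)
    case (Suc N)
    show ?case
    proof (cases "f = 0")
      case True
      then show ?thesis unfolding P_def by (intro exI[of _ "\<lambda>_. 0"]) auto
    next
      case False
      then have fHI: "f \<in> HI" using Suc.prems by (auto simp: HI_def)
      then obtain b where b: "b \<in> B" "mdvd b (ld f)" using B(3) by blast
      then obtain t where t: "ld f = b + t" by (auto simp: mdvd_def)
      define g where "g = F b"
      have g: "g \<in> HI" "ld g = b" "g \<in> G" using F[OF b(1)] b(1) by (auto simp: g_def G_def)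
      have g0: "g \<noteq> 0" "g \<in> I" using g(1) by (auto simp: HI_def)
      define q where "q = sgl t (lkp f (ld f) / lkp g b)"
      define f' where "f' = f - q * g"
      have qPR: "q \<in> PR A" unfolding q_def by (rule PR_single) (use kA[OF fHI] t keys_add_nat[of b t] in auto)
      have f'I: "f' \<in> I" using add[OF Suc.prems(1) smult[OF _ g0(2), of "- q"]] qPR by (simp add: f'_def PR_uminus)
      obtain e where e: "homog g e" using g(1) by (auto simp: HI_def)
      have gb: "b \<in> kys g" using ld(1)[OF g0(1)] g by simp
      have "e = int (mdeg b)" using e gb by (auto simp: homog_def)
      moreover have "int D = int (mdeg (ld f))" using Suc.prems(2) ld(1)[OF False] by (auto simp: homog_def)
      ultimately have "int (mdeg t) + e = int D" by (simp add: t mdeg_add)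
      then have f'h: "homog f' (int D)" unfolding f'_def q_def
        using homog_diff[OF Suc.prems(2)] homog_mult[OF homog_single e] by metis
      have less: "mlt k m (ld f)" if m: "m \<in> kys f'" for m
      proof -
        have "m \<in> kys f \<union> kys (q * g)" using m keys_diff[of f "q * g"] by (auto simp: f'_def)
        moreover have "m \<noteq> ld f"
        proof
          assume "m = ld f"
          then have "lkp f' m = lkp f (ld f) - lkp (q * g) (t + b)" by (simp add: f'_def lookup_minus t add.commute)
          also have "\<dots> = 0" using gb by (simp add: q_def lookup_single_mult in_keys_iff)
          finally show False using m by (simp add: in_keys_iff)
        qed
        moreover have "mlt k m (ld f)" if "m \<in> kys (q * g)" "m \<noteq> ld f"
        proof -
          have "m \<in> (+) t ` kys g" using that(1) keys_single_mult unfolding q_def by (rule rev_subsetD)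
          then obtain m' where m': "m' \<in> kys g" "m = t + m'" by (elim imageE)
          then have "m' \<noteq> b" using that(2) t by (auto simp: add.commute)
          then have "mlt k m' b" using ld(2)[OF g0(1) m'(1)] g by simp
          then show ?thesis using m' t by (simp add: add.commute[of b t] mlt_add)
        qed
        ultimately show ?thesis using ld(2)[OF False] by blast
      qed
      define SF where "SF = (\<lambda>f::'a mpoly. {m. kys m \<subseteq> A \<and> mdeg m = D \<and> (\<exists>m'\<in>kys f. m = m' \<or> mlt k m m')})"
      have fin: "finite (SF f)" unfolding SF_def by (rule finite_subset[OF _ finite_mons[OF A, of D]]) auto
      have below: "mlt k m (ld f)" if "m \<in> SF f'" for m
      proof -
        obtain m' where m': "m' \<in> kys f'" "m = m' \<or> mlt k m m'" using \<open>m \<in> SF f'\<close> by (auto simp: SF_def)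
        then show ?thesis using less[OF m'(1)] mlt_trans[OF k, of m m' "ld f"] by metis
      qed
      have "SF f' \<subset> SF f"
      proof
        show "SF f' \<subseteq> SF f"
        proof
          fix m assume m: "m \<in> SF f'"
          then have "kys m \<subseteq> A" "mdeg m = D" by (auto simp: SF_def)
          then show "m \<in> SF f" using below[OF m] ld(1)[OF False] by (auto simp: SF_def)
        qed
        have "ld f \<in> SF f" using ld(1)[OF False] kA[OF fHI] Suc.prems(2) by (auto simp: homog_def SF_def)
        moreover have "ld f \<notin> SF f'" using below[of "ld f"] mlt_irrefl[of k "ld f"] by auto
        ultimately show "SF f' \<noteq> SF f" by metis
      qed
      then have "card (SF f') < card (SF f)" using psubset_card_mono[OF fin] by simp
      then have "card {m. kys m \<subseteq> A \<and> mdeg m = D \<and> (\<exists>m'\<in>kys f'. m = m' \<or> mlt k m m')} < N"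
        using Suc.prems(3) by (simp add: SF_def)
      then have "P f'" using Suc.IH[OF f'I f'h] by simp
      then have "P (f' + q * g)" by (rule P_add) (use g qPR in auto)
      then show ?thesis by (simp add: f'_def)
    qed
  qed auto
  have "P f" if f: "f \<in> I" "homog f d" for f d
  proof (cases "d < 0")
    case True
    then have "f = 0" using homog_neg f by blast
    then show ?thesis unfolding P_def by (intro exI[of _ "\<lambda>_. 0"]) auto
  next
    case False
    then have "homog f (int (nat d))" using f by simp
    then show ?thesis using main f(1) by blast
  qed
  moreover have "G \<subseteq> {f\<in>I. \<exists>d. homog f d}" using F by (auto simp: G_def HI_def)
  ultimately show ?thesis using finG unfolding P_def[abs_def] by (intro exI[of _ G] conjI ballI impI) auto
qed

text \<open>Induction on the rank. The last coordinates of the elements of \<open>M\<close> form an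
  ideal with finitely many homogeneous generators; these are lifted to homogeneous vectors, and what
  remains after subtracting lifts has last coordinate 0 and lives in smaller rank.\<close>

lemma gsub_fg:
  fixes M :: "(nat \<Rightarrow> ('a::field) mpoly) set"
  assumes A: "finite A"
  shows "gsub A r s M \<Longrightarrow> \<exists>G. finite G \<and> G \<subseteq> {v\<in>M. \<exists>d. homogv r s d v} \<and> M = gen_by A G"
proof (induction r arbitrary: M)
  case 0
  then have "M = {\<lambda>_. 0}" by (auto simp: gsub_def free_def)
  then show ?case by (intro exI[of _ "{}"]) (auto simp: gen_by_def)
next
  case (Suc r)
  note M = Suc.prems
  define M' where "M' = {v \<in> M. v r = 0}"
  have "gsub A r s M'" 
    unfolding gsub_def
  proof (intro conjI ballI allI)
    show "M' \<subseteq> free A r"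
    proof
      fix v assume "v \<in> M'"
      then have "v \<in> free A (Suc r)" "v r = 0" using M by (auto simp: M'_def gsub_def)
      then have v: "\<And>l. v l \<in> PR A" "\<And>l. l \<ge> Suc r \<Longrightarrow> v l = 0" "v r = 0" by (auto simp: free_def)
      have "v l = 0" if "l \<ge> r" for l using v(2)[of l] v(3) that by (cases "l = r") simp_all
      then show "v \<in> free A r" using v(1) by (intro freeI)
    qed
  qed (use M in \<open>auto simp: M'_def gsub_0 gsub_add gsub_smult gsub_hcv hcv_def\<close>, simp add: gsub_def hcv_def)
  from Suc.IH[OF this] obtain G' where G': "finite G'" "G' \<subseteq> {v\<in>M'. \<exists>d. homogv r s d v}" "M' = gen_by A G'"
    by blast
  define I where "I = (\<lambda>v. v r) ` M"
  obtain F where F: "finite F" "F \<subseteq> {f\<in>I. \<exists>d. homog f d}"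
    "\<And>f d. f \<in> I \<Longrightarrow> homog f d \<Longrightarrow> \<exists>c. (\<forall>g\<in>F. c g \<in> PR A) \<and> f = (\<Sum>g\<in>F. c g * g)"
  proof -
    have "\<exists>G. finite G \<and> G \<subseteq> {f\<in>I. \<exists>d. homog f d} \<and>
           (\<forall>f\<in>I. (\<exists>d. homog f d) \<longrightarrow> (\<exists>c. (\<forall>g\<in>G. c g \<in> PR A) \<and> f = (\<Sum>g\<in>G. c g * g)))"
    proof (rule homog_ideal_fg[OF A])
      show "I \<subseteq> PR A" using M by (auto simp: I_def gsub_def free_def)
      show "p + q \<in> I" if pq: "p \<in> I" "q \<in> I" for p q
      proof -
        obtain u where "p = u r" "u \<in> M" using pq(1) unfolding I_def by (rule imageE)
        moreover obtain v where "q = v r" "v \<in> M" using pq(2) unfolding I_def by (rule imageE)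
        ultimately show ?thesis unfolding I_def using gsub_add[OF M] by (intro image_eqI[of _ _ "\<lambda>l. u l + v l"]) auto
      qed
      show "p * q \<in> I" if pq: "p \<in> PR A" "q \<in> I" for p q
      proof -
        obtain v where "q = v r" "v \<in> M" using pq(2) unfolding I_def by (rule imageE)
        then show ?thesis unfolding I_def using gsub_smult[OF M pq(1)] by (intro image_eqI[of _ _ "\<lambda>l. p * v l"]) auto
      qed
    qed
    then obtain G where G: "finite G \<and> G \<subseteq> {f\<in>I. \<exists>d. homog f d} \<and>
           (\<forall>f\<in>I. (\<exists>d. homog f d) \<longrightarrow> (\<exists>c. (\<forall>g\<in>G. c g \<in> PR A) \<and> f = (\<Sum>g\<in>G. c g * g)))" ..
    show ?thesis
    proof (rule that)
      show "finite G" "G \<subseteq> {f\<in>I. \<exists>d. homog f d}" using G by simp_all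
      fix f d assume "f \<in> I" and "homog f d"
      then have "\<exists>d. homog f d" by blast
      with bspec[OF conjunct2[OF conjunct2[OF G]] \<open>f \<in> I\<close>]
      show "\<exists>c. (\<forall>g\<in>G. c g \<in> PR A) \<and> f = (\<Sum>g\<in>G. c g * g)" by (rule mp)
    qed
  qed
  have lift: "\<exists>v\<in>M. v r = f \<and> (\<exists>d. homogv (Suc r) s d v)" if "f \<in> F" for f
  proof -
    have "f \<in> I" "\<exists>d. homog f d" using that F(2) by auto
    then obtain d where d: "homog f d" by blast
    obtain v where v: "f = v r" "v \<in> M" using \<open>f \<in> I\<close> unfolding I_def by (rule imageE)
    \<comment> \<open>The shift by \<open>s r\<close> makes the component in position
      \<open>r\<close> the one of degree \<open>d\<close>, so it returns \<open>f\<close>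
      itself.\<close>
    then have "hcv s (d + s r) v \<in> M" "hcv s (d + s r) v r = f"
      using gsub_hcv[OF M v(2)] hc_homog[OF d] v(1) by (simp_all add: hcv_def)
    then show ?thesis using homogv_hcv by blast
  qed
  then obtain L where L: "\<And>f. f \<in> F \<Longrightarrow> L f \<in> M \<and> L f r = f \<and> (\<exists>d. homogv (Suc r) s d (L f))" by metis
  define G where "G = G' \<union> L ` F"
  have finG: "finite G" using G' F by (simp add: G_def)
  have GM: "G \<subseteq> {v\<in>M. \<exists>d. homogv (Suc r) s d v}"
  proof
    fix g assume "g \<in> G"
    then consider "g \<in> G'" | f where "f \<in> F" "g = L f" by (auto simp: G_def)
    then show "g \<in> {v\<in>M. \<exists>d. homogv (Suc r) s d v}"
    proof cases
      case 1
      then obtain d where d: "g \<in> M" "g r = 0" "homogv r s d g" using G' by (auto simp: M'_def)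
      then have "homogv (Suc r) s d g" by (auto simp: homogv_def less_Suc_eq)
      then show ?thesis using d by blast
    qed (use L in blast)
  qed
  have hom: "v \<in> gen_by A G" if v: "v \<in> M" "homogv (Suc r) s d v" for v d
  proof -
    have "homog (v r) (d - s r)" "v r \<in> I" using v by (auto simp: homogv_def I_def)
    from F(3)[OF this(2,1)] obtain c where c': "(\<forall>g\<in>F. c g \<in> PR A) \<and> v r = (\<Sum>g\<in>F. c g * g)" ..
    note c = conjunct1[OF c'] conjunct2[OF c']
    define u where "u = (\<lambda>l. \<Sum>f\<in>F. c f * L f l)"
    have uM: "u \<in> M" unfolding u_def using gsub_sum[OF M, of F "\<lambda>f l. c f * L f l"] gsub_smult[OF M] c L by auto
    have "(\<lambda>l. v l - u l) \<in> M'" unfolding M'_def using gsub_diff[OF M v(1) uM] L by (simp add: u_def c)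
    then have "(\<lambda>l. v l - u l) \<in> gen_by A G" using gen_by_mono[OF _ _ finG, of _ A G'] G' by (auto simp: G_def)
    moreover have "u \<in> gen_by A G" unfolding u_def
    proof (rule gen_by_sum[where f = "\<lambda>f l. c f * L f l"])
      fix f assume f: "f \<in> F"
      then have "L f \<in> G" by (simp add: G_def)
      from gen_by_smult[OF gen_by_base[OF finG this]] c(1) f
      show "(\<lambda>l. c f * L f l) \<in> gen_by A G" by blast
    qed
    ultimately have "(\<lambda>l. (v l - u l) + u l) \<in> gen_by A G" by (rule gen_by_add)
    then show ?thesis by simp
  qed
  have "M = gen_by A G"
  proof
    show "gen_by A G \<subseteq> M" by (rule gen_by_gsub[OF M]) (use GM in blast)
    show "M \<subseteq> gen_by A G"
    proof
      fix v assume v: "v \<in> M"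
      obtain D where D: "finite D" "v = (\<lambda>l. \<Sum>d\<in>D. hcv s d v l)" using hcv_expand[OF gsub_free[OF M v]] by blast
      have "(\<lambda>l. \<Sum>d\<in>D. hcv s d v l) \<in> gen_by A G"
        by (rule gen_by_sum) (rule hom[OF gsub_hcv[OF M v] homogv_hcv])
      then show "v \<in> gen_by A G" using D(2) by simp
    qed
  qed
  then show ?case using finG GM by blast
qed

section \<open>Minimal graded free resolutions\<close>

lemma img_mem: "v \<in> img A r s M \<longleftrightarrow> (\<exists>x\<in>free A s. v = gmap r s M x)"
  by (auto simp: img_def)

lemma img_add: "u \<in> img A r s M \<Longrightarrow> v \<in> img A r s M \<Longrightarrow> (\<lambda>l. u l + v l) \<in> img A r s M"
proof -
  assume "u \<in> img A r s M" "v \<in> img A r s M"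
  then obtain x y where xy: "x \<in> free A s" "u = gmap r s M x" "y \<in> free A s" "v = gmap r s M y" by (auto simp: img_def)
  show ?thesis unfolding img_mem xy(2,4) gmap_add[symmetric] by (rule bexI[OF refl free_add[OF xy(1,3)]])
qed

lemma img_smult: "p \<in> PR A \<Longrightarrow> v \<in> img A r s M \<Longrightarrow> (\<lambda>l. p * v l) \<in> img A r s M"
proof -
  assume p: "p \<in> PR A" and "v \<in> img A r s M"
  then obtain x where x: "x \<in> free A s" "v = gmap r s M x" by (auto simp: img_def)
  show ?thesis unfolding img_mem x(2) gmap_smult[symmetric] by (rule bexI[OF refl free_smult[OF p x(1)]])
qed

lemma img_column:
  assumes "l < s" "\<And>k. k \<ge> r \<Longrightarrow> c k = 0" "\<And>k. k < r \<Longrightarrow> c k = M k l"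
  shows "c \<in> img A r s M"
proof -
  define e where "e = (\<lambda>j. if j = l then 1 else 0 :: 'a mpoly)"
  have "e \<in> free A s" unfolding e_def by (rule freeI) (use assms(1) in auto)
  moreover have "gmap r s M e k = c k" for k
  proof (cases "k < r")
    case True
    have "(\<Sum>j<s. M k j * e j) = (\<Sum>j<s. if j = l then M k l else 0)"
      unfolding e_def by (rule sum.cong) auto
    then show ?thesis using assms True by (simp add: gmap_def)
  next
    case False
    then show ?thesis using assms(2) by (simp add: gmap_def)
  qed
  ultimately show ?thesis unfolding img_mem by (metis ext)
qed

lemma ker_gsub:
  assumes M: "\<And>k l. k < r \<Longrightarrow> l < t \<Longrightarrow> M k l \<in> PR A \<and> homog (M k l) (sh l - s k)"
  shows "gsub A t sh (ker A r t M)"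
proof -
  have "hcv sh d v \<in> ker A r t M" if v: "v \<in> ker A r t M" for d v
  proof -
    have "gmap r t M (hcv sh d v) k = 0" for k
    proof (cases "k < r")
      case True
      have "(\<Sum>l<t. M k l * hc (d - sh l) (v l)) = (\<Sum>l<t. hc (d - s k) (M k l * v l))"
      proof (rule sum.cong[OF refl])
        fix l assume "l \<in> {..<t}"
        then have h: "homog (M k l) (sh l - s k)" using M True by simp
        show "M k l * hc (d - sh l) (v l) = hc (d - s k) (M k l * v l)"
          using hc_mult_homog[OF h, of "d - s k" "v l"] by (simp add: mult.commute)
      qed
      also have "\<dots> = hc (d - s k) (gmap r t M v k)" using True by (simp add: gmap_def hc_sum)
      also have "\<dots> = 0" using v by (simp add: ker_def)
      finally show ?thesis using True by (simp add: gmap_def hcv_def)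
    qed (simp add: gmap_def)
    moreover have "hcv sh d v \<in> free A t"
      using v unfolding ker_def hcv_def by (auto simp: free_def hc_PR)
    ultimately show ?thesis by (auto simp: ker_def)
  qed
  then show ?thesis
    by (auto simp: gsub_def ker_def gmap_add gmap_smult intro: free_add free_smult)
qed

lemma gen_by_img:
  assumes h: "bij_betw h {..<t} G" and G: "\<And>g. g \<in> G \<Longrightarrow> g \<in> free A r"
  shows "gen_by A G = img A r t (\<lambda>k l. h l k)"
proof (intro equalityI subsetI)
  have fr: "k \<ge> r \<Longrightarrow> l < t \<Longrightarrow> h l k = 0" for k l using h G by (auto simp: bij_betw_def free_def)
  fix v assume "v \<in> gen_by A G"
  then obtain c where c: "\<forall>g\<in>G. c g \<in> PR A" "v = (\<lambda>k. \<Sum>g\<in>G. c g * g k)" by (auto simp: gen_by_def)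
  define x where "x = (\<lambda>l. if l < t then c (h l) else 0)"
  have "x \<in> free A t" unfolding x_def by (rule freeI) (use c(1) h in \<open>auto simp: bij_betw_def\<close>)
  moreover have "v k = gmap r t (\<lambda>k l. h l k) x k" for k
  proof -
    have "v k = (\<Sum>l<t. c (h l) * h l k)" unfolding c(2) by (rule sum.reindex_bij_betw[OF h, symmetric])
    then show ?thesis using fr by (simp add: gmap_def x_def mult.commute)
  qed
  ultimately show "v \<in> img A r t (\<lambda>k l. h l k)" unfolding img_mem by (metis ext)
next
  have fr: "k \<ge> r \<Longrightarrow> l < t \<Longrightarrow> h l k = 0" for k l using h G by (auto simp: bij_betw_def free_def)
  fix v assume "v \<in> img A r t (\<lambda>k l. h l k)"
  then obtain x where x: "x \<in> free A t" "v = gmap r t (\<lambda>k l. h l k) x" by (auto simp: img_def)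
  define c where "c = (\<lambda>g. x (the_inv_into {..<t} h g))"
  have ch: "c (h l) = x l" if "l < t" for l
    using the_inv_into_f_f[of h "{..<t}" l] h that by (simp add: c_def bij_betw_def)
  have "v k = (\<Sum>g\<in>G. c g * g k)" for k
  proof -
    have "(\<Sum>g\<in>G. c g * g k) = (\<Sum>l<t. c (h l) * h l k)" by (rule sum.reindex_bij_betw[OF h, symmetric])
    also have "\<dots> = (\<Sum>l<t. h l k * x l)" by (rule sum.cong) (simp_all add: ch mult.commute)
    also have "\<dots> = v k" using fr by (simp add: x(2) gmap_def)
    finally show ?thesis by simp
  qed
  moreover have "\<forall>g\<in>G. c g \<in> PR A" using x(1) by (simp add: c_def free_PR)
  ultimately show "v \<in> gen_by A G" unfolding gen_by_def by blast
qed

text \<open>One step of a minimal resolution: a graded matrix with image \<open>N\<close>. The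
  clause on constant terms expresses minimality, since a constant coefficient in a relation would
  make a generator redundant; in the next step it becomes the absence of constants in the
  matrix.\<close>

definition mstep :: "var set \<Rightarrow> nat \<Rightarrow> (nat \<Rightarrow> int) \<Rightarrow> (nat \<Rightarrow> ('a::field) mpoly) set \<Rightarrow>
    nat \<Rightarrow> (nat \<Rightarrow> int) \<Rightarrow> (nat \<Rightarrow> nat \<Rightarrow> 'a mpoly) \<Rightarrow> bool" where
  "mstep A r s N t sh M \<longleftrightarrow>
     (\<forall>k<r. \<forall>l<t. M k l \<in> PR A \<and> homog (M k l) (sh l - s k)) \<and> N = img A r t M \<and>
     (\<forall>v\<in>ker A r t M. \<forall>l<t. lkp (v l) 0 = 0)"

text \<open>A generating set of least cardinality admits no relation with a unit coefficient.\<close>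
lemma mstep_exists:
  assumes A: "finite A" and N: "gsub A r s N"
  shows "\<exists>t sh M. mstep A r s N t sh M"
proof -
  define Q where "Q G \<longleftrightarrow> finite G \<and> G \<subseteq> {v\<in>N. \<exists>d. homogv r s d v} \<and> N = gen_by A G" for G
  obtain G0 where "Q G0" using gsub_fg[OF A N] unfolding Q_def by blast
  from ex_has_least_nat[of Q G0 card, OF this] obtain G where G: "Q G" "\<And>G'. Q G' \<Longrightarrow> card G \<le> card G'" by blast
  have fin: "finite G" and gN: "N = gen_by A G" using G(1) by (auto simp: Q_def)
  define t where "t = card G"
  from ex_bij_betw_nat_finite[OF fin] obtain h where "bij_betw h {0..<card G} G" ..
  then have h: "bij_betw h {..<t} G" by (simp add: t_def atLeast0LessThan)
  have "\<forall>g\<in>G. \<exists>d. homogv r s d g" using G(1) unfolding Q_def by blast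
  then obtain dg where dg: "\<forall>g\<in>G. homogv r s (dg g) g" by (rule bchoice[THEN exE])
  define sh where "sh l = dg (h l)" for l
  define M where "M = (\<lambda>k l. h l k)"
  have hG: "h l \<in> G" if "l < t" for l using h that by (auto simp: bij_betw_def)
  have gf: "g \<in> free A r" if "g \<in> G" for g using G(1) gsub_free[OF N] that unfolding Q_def by blast
  have entries: "M k l \<in> PR A \<and> homog (M k l) (sh l - s k)" if "k < r" "l < t" for k l
    using gf[OF hG[OF that(2)]] dg hG[OF that(2)] that(1) by (simp add: M_def sh_def homogv_def free_PR)
  have img: "N = img A r t M" unfolding gN M_def by (rule gen_by_img[OF h gf])
  have "lkp (v l0) 0 = 0" if v: "v \<in> ker A r t M" and l0: "l0 < t" for v l0
  proof (rule ccontr)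
    assume nz: "lkp (v l0) 0 \<noteq> 0"
    define c where "c = lkp (v l0) 0"
    \<comment> \<open>In degree \<open>sh l0\<close> the coordinate at \<open>l0\<close> must have
      degree 0, so it is a constant and a unit. The relation can then be solved for the generator
      \<open>h l0\<close>.\<close>
    define u where "u = hcv sh (sh l0) v"
    have "u \<in> ker A r t M" unfolding u_def by (rule gsub_hcv[OF ker_gsub v]) (rule entries)
    then have u: "u \<in> free A t" "gmap r t M u = (\<lambda>_. 0)" by (auto simp: ker_def)
    have u0: "u l0 = sgl 0 c"
    proof -
      have "u l0 = hc 0 (v l0)" by (simp add: u_def hcv_def)
      moreover have "lkp (hc 0 (v l0)) 0 = c" by (simp add: hc_def lookup_flt c_def)
      ultimately show ?thesis using homog_const[OF homog_hc, of "v l0"] by simp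
    qed
    define g where "g = h l0"
    define G' where "G' = G - {g}"
    define h' where "h' = the_inv_into {..<t} h"
    have hh: "h' (h l) = l" if "l < t" for l
      using the_inv_into_f_f[of h "{..<t}" l] h that by (simp add: h'_def bij_betw_def)
    have "g k = (\<Sum>f\<in>G'. (sgl 0 (- inverse c) * u (h' f)) * f k)" for k
    proof (cases "k < r")
      case True
      have "(\<Sum>l<t. u l * h l k) = gmap r t M u k" using True by (simp add: gmap_def M_def mult.commute)
      then have "0 = (\<Sum>l<t. u l * h l k)" using u(2) by simp
      also have "\<dots> = (\<Sum>l<t. u (h' (h l)) * h l k)" by (rule sum.cong) (simp_all add: hh)
      also have "\<dots> = (\<Sum>f\<in>G. u (h' f) * f k)" by (rule sum.reindex_bij_betw[OF h])
      also have "\<dots> = u (h' g) * g k + (\<Sum>f\<in>G'. u (h' f) * f k)"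
        unfolding G'_def by (rule sum.remove[OF fin]) (use hG[OF l0] in \<open>simp add: g_def\<close>)
      also have "u (h' g) = sgl 0 c" by (simp add: g_def hh[OF l0] u0)
      finally have e: "sgl 0 c * g k = - (\<Sum>f\<in>G'. u (h' f) * f k)" by (simp add: eq_neg_iff_add_eq_0)
      have one: "sgl 0 (inverse c) * sgl 0 c = (1 :: 'a mpoly)" using nz by (simp add: mult_single c_def)
      have "g k = (sgl 0 (inverse c) * sgl 0 c) * g k" by (simp only: one mult_1_left)
      also have "\<dots> = sgl 0 (inverse c) * - (\<Sum>f\<in>G'. u (h' f) * f k)" by (simp only: mult.assoc e)
      also have "\<dots> = sgl 0 (- inverse c) * (\<Sum>f\<in>G'. u (h' f) * f k)" by (simp add: single_uminus)
      finally show ?thesis by (simp add: sum_distrib_left mult.assoc)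
    next
      case False
      then have z: "\<And>f. f \<in> G \<Longrightarrow> f k = 0" using gf by (simp add: free_def)
      have "(\<Sum>f\<in>G'. (sgl 0 (- inverse c) * u (h' f)) * f k) = 0"
        by (rule sum.neutral) (simp add: z G'_def)
      then show ?thesis using z[OF hG[OF l0]] by (simp only: g_def)
    qed
    then have "g = (\<lambda>k. \<Sum>f\<in>G'. (sgl 0 (- inverse c) * u (h' f)) * f k)" by (rule ext)
    moreover have "\<forall>f\<in>G'. sgl 0 (- inverse c) * u (h' f) \<in> PR A"
      by (intro ballI PR_mult PR_single free_PR[OF u(1)]) simp
    ultimately have gG': "g \<in> gen_by A G'" unfolding gen_by_def
      by (intro CollectI exI[of _ "\<lambda>f. sgl 0 (- inverse c) * u (h' f)"] conjI)
    have finG': "finite G'" using fin by (simp add: G'_def)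
    have all: "f \<in> gen_by A G'" if "f \<in> G" for f
      using that gG' gen_by_base[OF finG', of f] by (cases "f = g") (auto simp: G'_def)
    have "N \<subseteq> gen_by A G'"
    proof
      fix x assume "x \<in> N"
      then obtain b where b: "\<forall>f\<in>G. b f \<in> PR A" "x = (\<lambda>k. \<Sum>f\<in>G. b f * f k)" unfolding gN by (auto simp: gen_by_def)
      show "x \<in> gen_by A G'" unfolding b(2)
        by (rule gen_by_sum) (use b(1) all in \<open>auto intro: gen_by_smult\<close>)
    qed
    moreover have "gen_by A G' \<subseteq> N" by (rule gen_by_gsub[OF N]) (use G(1) in \<open>auto simp: Q_def G'_def\<close>)
    ultimately have "Q G'" using G(1) finG' unfolding Q_def G'_def by blast
    then have "card G \<le> card G'" by (rule G(2))
    moreover have "card G' < card G" unfolding G'_def g_def using fin hG[OF l0] by (rule card_Diff1_less)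
    ultimately show False by simp
  qed
  then have "mstep A r s N t sh M" unfolding mstep_def using entries img by blast
  then show ?thesis by blast
qed

text \<open>The terms of the complex are indexed with the augmentation in position 0.\<close>
definition mcx :: "var set \<Rightarrow> (nat \<Rightarrow> ('a::field) mpoly) set \<Rightarrow> (nat \<Rightarrow> nat) \<Rightarrow> (nat \<Rightarrow> nat \<Rightarrow> int) \<Rightarrow>
    (nat \<Rightarrow> nat \<Rightarrow> nat \<Rightarrow> 'a mpoly) \<Rightarrow> bool" where
  "mcx A N r s M \<longleftrightarrow> r 0 = 1 \<and> s 0 0 = 0 \<and>
     (\<forall>i. \<forall>k<r i. \<forall>l<r (Suc i). M i k l \<in> PR A \<and> homog (M i k l) (s (Suc i) l - s i k)) \<and>
     img A (r 0) (r (Suc 0)) (M 0) = N \<and>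
     (\<forall>i. ker A (r i) (r (Suc i)) (M i) = img A (r (Suc i)) (r (Suc (Suc i))) (M (Suc i))) \<and>
     (\<forall>i. \<forall>k<r (Suc i). \<forall>l<r (Suc (Suc i)). lkp (M (Suc i) k l) 0 = 0)"

lemma mcx_exists:
  fixes N :: "(nat \<Rightarrow> ('a::field) mpoly) set"
  assumes A: "finite A" and N: "gsub A 1 (\<lambda>_. 0) N"
  shows "\<exists>r s M. mcx A N r s M"
proof -
  define nxt where "nxt = (\<lambda>(r, s, N :: (nat \<Rightarrow> 'a mpoly) set). SOME x. mstep A r s N (fst x) (fst (snd x)) (snd (snd x)))"
  have nxt: "mstep A r s N (fst (nxt (r, s, N))) (fst (snd (nxt (r, s, N)))) (snd (snd (nxt (r, s, N))))"
    if gN: "gsub A r s N" for r s and N :: "(nat \<Rightarrow> 'a mpoly) set"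
  proof -
    obtain t sh M where "mstep A r s N t sh M" using mstep_exists[OF A gN] by blast
    then have "\<exists>x. mstep A r s N (fst x) (fst (snd x)) (snd (snd x))" by (intro exI[of _ "(t, sh, M)"]) simp
    from someI_ex[OF this] show ?thesis by (simp add: nxt_def)
  qed
  define step where "step = (\<lambda>(r, s, N). (fst (nxt (r, s, N)), fst (snd (nxt (r, s, N))),
      ker A r (fst (nxt (r, s, N))) (snd (snd (nxt (r, s, N))))))"
  \<comment> \<open>A state holds the rank, the degrees of the basis and the submodule still to be
    covered; the next submodule is the kernel of the matrix just chosen.\<close>
  define St where "St = rec_nat (1, (\<lambda>_. 0), N) (\<lambda>_ x. step x)"
  have St0: "St 0 = (1, (\<lambda>_. 0), N)" and StS: "\<And>i. St (Suc i) = step (St i)" by (simp_all add: St_def)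
  define r where "r i = fst (St i)" for i
  define s where "s i = fst (snd (St i))" for i
  define K where "K i = snd (snd (St i))" for i
  define M where "M i = snd (snd (nxt (St i)))" for i
  have St: "St i = (r i, s i, K i)" for i by (simp add: r_def s_def K_def)
  have suc: "r (Suc i) = fst (nxt (St i))" "s (Suc i) = fst (snd (nxt (St i)))" "K (Suc i) = ker A (r i) (r (Suc i)) (M i)" for i
    unfolding r_def s_def K_def M_def StS step_def by (simp_all add: case_prod_beta)
  have ms: "mstep A (r i) (s i) (K i) (r (Suc i)) (s (Suc i)) (M i)" if "gsub A (r i) (s i) (K i)" for i
    using nxt[OF that] unfolding suc M_def St .
  have g: "gsub A (r i) (s i) (K i)" for i
  proof (induction i)
    case 0
    then show ?case using N by (simp add: r_def s_def K_def St0)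
  next
    case (Suc i)
    show ?case unfolding suc(3)
      by (rule ker_gsub[where s = "s i"]) (use ms[OF Suc] in \<open>simp add: mstep_def\<close>)
  qed
  have m: "mstep A (r i) (s i) (K i) (r (Suc i)) (s (Suc i)) (M i)" for i by (rule ms[OF g])
  have r0: "r 0 = 1" "s 0 0 = 0" "K 0 = N" by (simp_all add: r_def s_def K_def St0)
  have ex: "ker A (r i) (r (Suc i)) (M i) = img A (r (Suc i)) (r (Suc (Suc i))) (M (Suc i))" for i
    using m[of "Suc i"] unfolding mstep_def suc(3) by blast
  have "lkp (M (Suc i) k l) 0 = 0" if "k < r (Suc i)" "l < r (Suc (Suc i))" for i k l
  proof -
    \<comment> \<open>A column of the next matrix is a relation of the present one, so the
      minimality clause of \<open>mstep\<close> applies to it.\<close>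
    define c where "c = (\<lambda>k. if k < r (Suc i) then M (Suc i) k l else 0)"
    have "c \<in> img A (r (Suc i)) (r (Suc (Suc i))) (M (Suc i))"
      by (rule img_column[OF that(2)]) (simp_all add: c_def)
    then have "c \<in> ker A (r i) (r (Suc i)) (M i)" by (simp add: ex)
    then have "lkp (c k) 0 = 0" using m[of i] that(1) unfolding mstep_def by blast
    then show ?thesis using that(1) by (simp add: c_def)
  qed
  then have "mcx A N r s M"
    unfolding mcx_def using r0 ex m by (auto simp: mstep_def)
  then show ?thesis by blast
qed

text \<open>Each killed variable costs one position: exactness at \<open>i\<close> survives when
  \<open>w\<close> is regular on the cokernel there, and this follows from exactness at
  \<open>i - 1\<close>. With no regularity known for \<open>N\<close> itself, exactness remains from
  position \<open>card B\<close> on.\<close>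

lemma mcx_kill_exact:
  assumes A: "finite B" and M: "mcx A N r s M"
  shows "B \<subseteq> A \<Longrightarrow> i \<ge> card B \<Longrightarrow>
    ker (A - B) (r i) (r (Suc i)) (\<lambda>k l. kill B (M i k l)) =
    img (A - B) (r (Suc i)) (r (Suc (Suc i))) (\<lambda>k l. kill B (M (Suc i) k l))"
  using A
proof (induction B arbitrary: i rule: finite_induct)
  case empty
  have k: "kill {} p = p" for p :: "'a mpoly" by (simp add: kill_def flt_id)
  show ?case using M by (simp add: mcx_def k)
next
  case (insert w B)
  have MP: "kill B (M i k l) \<in> PR (A - B)" if "k < r i" "l < r (Suc i)" for i k l
    using M that by (intro kill_PR) (simp add: mcx_def)
  have wA: "w \<in> A - B" using insert by auto
  obtain j where j: "i = Suc j" "card B \<le> j" using insert.prems insert.hyps by (cases i) auto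
  have kk: "kill {w} (kill B p) = kill (insert w B) p" for p :: "'a mpoly" by (simp add: kill_kill)
  have "ker (A - B - {w}) (r i) (r (Suc i)) (\<lambda>k l. kill {w} (kill B (M i k l))) =
    img (A - B - {w}) (r (Suc i)) (r (Suc (Suc i))) (\<lambda>k l. kill {w} (kill B (M (Suc i) k l)))"
  proof (rule kill_exact[OF wA])
    show "ker (A - B) (r i) (r (Suc i)) (\<lambda>k l. kill B (M i k l)) =
      img (A - B) (r (Suc i)) (r (Suc (Suc i))) (\<lambda>k l. kill B (M (Suc i) k l))"
      using insert.IH[of i] insert.prems j by simp
    have ex: "ker (A - B) (r j) (r i) (\<lambda>k l. kill B (M j k l)) =
      img (A - B) (r i) (r (Suc i)) (\<lambda>k l. kill B (M i k l))"
      using insert.IH[of j] insert.prems j by simp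
    show "u \<in> img (A - B) (r i) (r (Suc i)) (\<lambda>k l. kill B (M i k l))"
      if "u \<in> free (A - B) (r i)" "(\<lambda>k. X w * u k) \<in> img (A - B) (r i) (r (Suc i)) (\<lambda>k l. kill B (M i k l))" for u
      by (rule exact_reg[OF ex that])
  qed (rule MP, assumption+)+
  moreover have "A - B - {w} = A - insert w B" by auto
  ultimately show ?case by (simp add: kk)
qed

text \<open>Hilbert's syzygy theorem. Killing all variables turns the matrices in positive positions
  into zero matrices, since they have no constant terms, while exactness persists far enough to the
  left. A zero map followed by a zero map is exact only if the module between them is 0.\<close>

lemma mcx_finite:
  assumes A: "finite A" and M: "mcx A N r s M" and i: "i > card A"
  shows "r (Suc i) = 0"
proof -
  have z: "kill A (M j k l) = 0" if jkl: "j > 0" "k < r j" "l < r (Suc j)" for j k l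
  proof (rule poly_mapping_eqI)
    fix m
    obtain j' where j': "j = Suc j'" using jkl(1) by (cases j) auto
    have "M j k l \<in> PR A" "lkp (M j k l) 0 = 0" using M jkl unfolding mcx_def j' by auto
    then have "\<not> (kys m \<inter> A = {} \<and> lkp (M j k l) m \<noteq> 0)"
    proof (intro notI)
      assume a: "M j k l \<in> PR A" "lkp (M j k l) 0 = 0" "kys m \<inter> A = {} \<and> lkp (M j k l) m \<noteq> 0"
      then have "kys m \<subseteq> A" by (auto simp: PR_def in_keys_iff)
      then have "kys m = {}" using a(3) by blast
      then show False using a by simp
    qed
    then show "lkp (kill A (M j k l)) m = lkp 0 m" by (simp add: kill_def lookup_flt)
  qed
  have ex: "ker {} (r i) (r (Suc i)) (\<lambda>k l. kill A (M i k l)) =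
    img {} (r (Suc i)) (r (Suc (Suc i))) (\<lambda>k l. kill A (M (Suc i) k l))"
    using mcx_kill_exact[OF A M subset_refl, of i] i by simp
  show ?thesis
  proof (rule ccontr)
    assume nz: "r (Suc i) \<noteq> 0"
    define e where "e = (\<lambda>j::nat. if j = 0 then 1 else 0 :: 'a mpoly)"
    have "e \<in> free {} (r (Suc i))" unfolding e_def by (rule freeI) (use nz in auto)
    moreover have "gmap (r i) (r (Suc i)) (\<lambda>k l. kill A (M i k l)) e = (\<lambda>_. 0)"
      using i by (auto simp: gmap_def fun_eq_iff z)
    ultimately have "e \<in> ker {} (r i) (r (Suc i)) (\<lambda>k l. kill A (M i k l))" by (simp add: ker_def)
    then obtain x where x: "e = gmap (r (Suc i)) (r (Suc (Suc i))) (\<lambda>k l. kill A (M (Suc i) k l)) x"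
      unfolding ex img_def by blast
    have "gmap (r (Suc i)) (r (Suc (Suc i))) (\<lambda>k l. kill A (M (Suc i) k l)) x 0 = 0"
      by (simp add: gmap_def z)
    then have "e 0 = 0" using x by simp
    then show False by (simp add: e_def)
  qed
qed

definition vec :: "('a::field) mpoly \<Rightarrow> nat \<Rightarrow> 'a mpoly" where
  "vec f = (\<lambda>l. if l = 0 then f else 0)"

text \<open>In the complex, position 0 is the ring and the matrix \<open>M 0\<close> is the
  augmentation, so the \<open>i\<close>-th free module of the resolution is term
  \<open>Suc i\<close> and the generators form the single row of \<open>M 0\<close>.\<close>

definition mk_res :: "(nat \<Rightarrow> nat) \<Rightarrow> (nat \<Rightarrow> nat \<Rightarrow> int) \<Rightarrow> (nat \<Rightarrow> nat \<Rightarrow> nat \<Rightarrow> ('a::field) mpoly) \<Rightarrow> 'a gres" where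
  "mk_res r s M = \<lparr>rk = (\<lambda>i. r (Suc i)), shift = (\<lambda>i. s (Suc i)), gens = M 0 0, diffm = M\<rparr>"

lemma mcx_resolution:
  assumes M: "mcx (Vars n) (vec ` I) r s M" and fin: "\<And>i. i > p \<Longrightarrow> r (Suc i) = 0"
  shows "minimal_graded_free_resolution n I (mk_res r s M)"
proof -
  have r0: "r 0 = 1" "s 0 0 = 0"
    and ent: "\<And>i k l. k < r i \<Longrightarrow> l < r (Suc i) \<Longrightarrow> M i k l \<in> PR (Vars n) \<and> homog (M i k l) (s (Suc i) l - s i k)"
    and im0: "img (Vars n) 1 (r (Suc 0)) (M 0) = vec ` I"
    and ex: "\<And>i. ker (Vars n) (r i) (r (Suc i)) (M i) = img (Vars n) (r (Suc i)) (r (Suc (Suc i))) (M (Suc i))"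
    and mn: "\<And>i k l. k < r (Suc i) \<Longrightarrow> l < r (Suc (Suc i)) \<Longrightarrow> lkp (M (Suc i) k l) 0 = 0"
    using M by (auto simp: mcx_def)
  have au: "gmap 1 (r (Suc 0)) (M 0) v = vec (augm (mk_res r s M) v)" for v
    by (auto simp: gmap_def augm_def vec_def mk_res_def fun_eq_iff)
  have vinj: "vec f = vec g \<Longrightarrow> f = g" for f g :: "'a mpoly" by (auto simp: vec_def fun_eq_iff split: if_splits)
  have da: "dapply (mk_res r s M) i v = gmap (r (Suc (i - 1))) (r (Suc i)) (M i) v" for i v
    by (auto simp: dapply_def mk_res_def gmap_def fun_eq_iff)
  have g: "M 0 0 l \<in> I" if "l < r (Suc 0)" for l
  proof -
    have "vec (M 0 0 l) \<in> img (Vars n) 1 (r (Suc 0)) (M 0)"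
      by (rule img_column[OF that]) (simp_all add: vec_def)
    then show ?thesis unfolding im0 using vinj by blast
  qed
  have aI: "augm (mk_res r s M) ` free (Vars n) (r (Suc 0)) = I"
  proof -
    have "vec ` (augm (mk_res r s M) ` free (Vars n) (r (Suc 0))) = vec ` I"
      unfolding im0[symmetric] img_def image_image by (rule image_cong[OF refl]) (simp only: au)
    then show ?thesis using vinj by (metis inj_image_eq_iff inj_def)
  qed
  have z: "gmap 1 (r (Suc 0)) (M 0) v = (\<lambda>_. 0) \<longleftrightarrow> augm (mk_res r s M) v = 0" for v
    unfolding au by (auto simp: vec_def fun_eq_iff)
  show ?thesis
    unfolding minimal_graded_free_resolution_def free_mod_free
  proof (intro conjI)
    show "\<exists>p. \<forall>i>p. rk (mk_res r s M) i = 0" using fin by (auto simp: mk_res_def)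
    show "\<forall>l<rk (mk_res r s M) 0. gens (mk_res r s M) l \<in> I \<and> homog (gens (mk_res r s M) l) (shift (mk_res r s M) 0 l)"
    proof (intro allI impI conjI)
      fix l assume "l < rk (mk_res r s M) 0"
      then have l: "l < r (Suc 0)" by (simp add: mk_res_def)
      show "gens (mk_res r s M) l \<in> I" using g[OF l] by (simp add: mk_res_def)
      show "homog (gens (mk_res r s M) l) (shift (mk_res r s M) 0 l)" using ent[of 0 0 l] l r0 by (simp add: mk_res_def)
    qed
    show "\<forall>i\<ge>1. \<forall>k<rk (mk_res r s M) (i - 1). \<forall>l<rk (mk_res r s M) i.
         diffm (mk_res r s M) i k l \<in> PRing n \<and>
         homog (diffm (mk_res r s M) i k l) (shift (mk_res r s M) i l - shift (mk_res r s M) (i - 1) k) \<and>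
         lkp (diffm (mk_res r s M) i k l) 0 = 0"
    proof (intro allI impI)
      fix i k l assume a: "1 \<le> i" "k < rk (mk_res r s M) (i - 1)" "l < rk (mk_res r s M) i"
      then obtain j where j: "i = Suc j" by (cases i) auto
      show "diffm (mk_res r s M) i k l \<in> PRing n \<and>
         homog (diffm (mk_res r s M) i k l) (shift (mk_res r s M) i l - shift (mk_res r s M) (i - 1) k) \<and>
         lkp (diffm (mk_res r s M) i k l) 0 = 0"
        using ent[of k "Suc j" l] mn[of k j l] a(2,3) unfolding j by (simp add: mk_res_def PRing_PR)
    qed
    show "augm (mk_res r s M) ` free (Vars n) (rk (mk_res r s M) 0) = I" using aI by (simp add: mk_res_def)
    have "{v \<in> free (Vars n) (r (Suc 0)). augm (mk_res r s M) v = 0} = ker (Vars n) 1 (r (Suc 0)) (M 0)"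
      unfolding ker_def z ..
    also have "\<dots> = img (Vars n) (r (Suc 0)) (r (Suc (Suc 0))) (M (Suc 0))" using ex[of 0] r0 by simp
    finally show "{v \<in> free (Vars n) (rk (mk_res r s M) 0). augm (mk_res r s M) v = 0} =
        dapply (mk_res r s M) 1 ` free (Vars n) (rk (mk_res r s M) 1)"
      unfolding img_def da[abs_def] by (simp add: mk_res_def da)
    show "\<forall>i\<ge>1. {v \<in> free (Vars n) (rk (mk_res r s M) i). dapply (mk_res r s M) i v = (\<lambda>_. 0)} =
        dapply (mk_res r s M) (i + 1) ` free (Vars n) (rk (mk_res r s M) (i + 1))"
    proof (intro allI impI)
      fix i :: nat assume "1 \<le> i"
      then obtain j where j: "i = Suc j" by (cases i) auto
      show "{v \<in> free (Vars n) (rk (mk_res r s M) i). dapply (mk_res r s M) i v = (\<lambda>_. 0)} =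
        dapply (mk_res r s M) (i + 1) ` free (Vars n) (rk (mk_res r s M) (i + 1))"
        using ex[of "Suc j"] unfolding j da ker_def img_def by (simp add: mk_res_def da)
    qed
  qed
qed

section \<open>The cycle of entries surviving in Y\<close>

definition nx :: "nat \<Rightarrow> nat \<Rightarrow> nat" where
  "nx n i = (if i = n then 1 else i + 1)"

lemma nx_in: "i \<in> {1..n} \<Longrightarrow> nx n i \<in> {1..n}"
  by (auto simp: nx_def)

lemma nx_inj: "i \<in> {1..n} \<Longrightarrow> j \<in> {1..n} \<Longrightarrow> nx n i = nx n j \<Longrightarrow> i = j"
  by (cases "i = n"; cases "j = n") (simp_all add: nx_def)

lemma nx_neq: "n > 1 \<Longrightarrow> nx n i \<noteq> i"
  by (auto simp: nx_def)

text \<open>Induction around a cycle: climbing from any element reaches \<open>n\<close>, wraps to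
  1, and from there reaches everything.\<close>

lemma nx_closed:
  assumes "C \<subseteq> {1..n}" "C \<noteq> {}" "\<And>i. i \<in> C \<Longrightarrow> nx n i \<in> C"
  shows "C = {1..n}"
proof -
  obtain i where i: "i \<in> C" using assms by auto
  have up: "k \<le> n \<Longrightarrow> j \<le> k \<Longrightarrow> j \<in> C \<Longrightarrow> k \<in> C" for j k
  proof (induction k)
    case (Suc k)
    then show ?case
      using assms(3)[of k] by (cases "j = Suc k") (auto simp: nx_def)
  qed auto
  have "n \<in> C" using up[of n i] i assms by auto
  then have "1 \<in> C" using assms(3)[of n] by (simp add: nx_def)
  then show ?thesis using up[of _ 1] assms(1) by auto
qed

lemma finite_Vars [simp]: "finite (Vars n)"
  by (simp add: Vars_def)

lemma setV_iff: "n > 1 \<Longrightarrow> (i, j) \<in> setV n \<longleftrightarrow> i \<in> {1..n} \<and> (j = i \<or> j = nx n i)"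
  by (auto simp: setV_def Vars_def nx_def)

lemma setV_Vars: "n > 1 \<Longrightarrow> setV n \<subseteq> Vars n"
  by (auto simp: setV_iff Vars_def nx_def)

lemma finite_setV: "n > 1 \<Longrightarrow> finite (setV n)"
  using finite_subset[OF setV_Vars] by simp

text \<open>The successor in the cycle of entries moves along a row from a diagonal entry and down a
  column from an off-diagonal one.\<close>

definition sucV :: "nat \<Rightarrow> var \<Rightarrow> var" where
  "sucV n v = (if snd v = fst v then (fst v, nx n (fst v)) else (snd v, snd v))"

lemma sucV_in: "n > 1 \<Longrightarrow> v \<in> setV n \<Longrightarrow> sucV n v \<in> setV n"
  using nx_in[of "fst v" n] by (cases v) (auto simp: setV_iff sucV_def)

lemma sucV_inj: "n > 1 \<Longrightarrow> inj_on (sucV n) (setV n)"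
proof (rule inj_onI)
  fix u v assume n: "n > 1" "u \<in> setV n" "v \<in> setV n" "sucV n u = sucV n v"
  obtain i j k l where [simp]: "u = (i, j)" "v = (k, l)" by (cases u, cases v)
  show "u = v" using n nx_neq[OF n(1)] nx_inj[of i n k]
    by (auto simp: setV_iff sucV_def split: if_splits)
qed

lemma sucV_surj: "n > 1 \<Longrightarrow> v \<in> setV n \<Longrightarrow> \<exists>u\<in>setV n. sucV n u = v"
  by (metis sucV_inj sucV_in endo_inj_surj finite_setV image_subsetI imageE)

text \<open>Two successor steps lead from one diagonal entry to the next, so
  \<open>nx_closed\<close> puts the whole diagonal into \<open>C\<close>, and one further step gives
  the other entries.\<close>

lemma sucV_closed:
  assumes n: "n > 1" and C: "C \<subseteq> setV n" "C \<noteq> {}" "\<And>v. v \<in> C \<Longrightarrow> sucV n v \<in> C"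
  shows "C = setV n"
proof -
  define D where "D = {i \<in> {1..n}. (i, i) \<in> C}"
  have D: "D = {1..n}"
  proof (rule nx_closed)
    obtain i j where ij: "(i, j) \<in> C" using C by auto
    have "(i, i) \<in> C \<or> (j, j) \<in> C" using C(3)[OF ij] ij by (auto simp: sucV_def split: if_splits)
    moreover have "i \<in> {1..n}" "j \<in> {1..n}" using ij C(1) setV_Vars[OF n] by (auto simp: Vars_def)
    ultimately show "D \<noteq> {}" by (auto simp: D_def)
  next
    fix i assume "i \<in> D"
    then have i: "i \<in> {1..n}" "(i, i) \<in> C" by (auto simp: D_def)
    then have "(i, nx n i) \<in> C" using C(3)[of "(i, i)"] by (simp add: sucV_def)
    then have "(nx n i, nx n i) \<in> C" using C(3)[of "(i, nx n i)"] nx_neq[OF n] by (simp add: sucV_def)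
    then show "nx n i \<in> D" using nx_in[OF i(1)] by (simp add: D_def)
  qed (auto simp: D_def)
  show ?thesis
  proof (intro equalityI C(1) subsetI)
    fix v assume v: "v \<in> setV n"
    obtain i j where [simp]: "v = (i, j)" by (cases v)
    have i: "i \<in> {1..n}" "j = i \<or> j = nx n i" using v n by (auto simp: setV_iff)
    have "i \<in> D" using i(1) unfolding D .
    then have ii: "(i, i) \<in> C" unfolding D_def by simp
    then have "(i, nx n i) \<in> C" using C(3)[of "(i, i)"] by (simp add: sucV_def)
    then show "v \<in> C" using i(2) ii by auto
  qed
qed

definition indep :: "nat \<Rightarrow> var set \<Rightarrow> bool" where
  "indep n S \<longleftrightarrow> S \<subseteq> setV n \<and> inj_on fst S \<and> inj_on snd S"

lemma indep_finite: "n > 1 \<Longrightarrow> indep n S \<Longrightarrow> finite S"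
  using finite_subset finite_setV unfolding indep_def by blast

text \<open>Two surviving entries lie in a common row or column iff they are neighbours in the cycle.\<close>
lemma indep_iff:
  assumes n: "n > 1"
  shows "indep n S \<longleftrightarrow> S \<subseteq> setV n \<and> (\<forall>v\<in>S. sucV n v \<notin> S)"
proof (intro iffI conjI ballI)
  assume S: "indep n S"
  then show "S \<subseteq> setV n" by (simp add: indep_def)
  fix v assume v: "v \<in> S"
  obtain i j where [simp]: "v = (i, j)" by (cases v)
  have ij: "(i, j) \<in> setV n" using S v by (auto simp: indep_def)
  show "sucV n v \<notin> S"
  proof
    assume "sucV n v \<in> S"
    then show False using S v ij nx_neq[OF n, of i]
      by (auto simp: indep_def sucV_def inj_on_def setV_iff[OF n] split: if_splits; force)
  qed
next
  assume "S \<subseteq> setV n \<and> (\<forall>v\<in>S. sucV n v \<notin> S)"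
  then have S: "S \<subseteq> setV n" and suc: "\<And>v. v \<in> S \<Longrightarrow> sucV n v \<notin> S" by auto
  have "inj_on fst S"
  proof (rule inj_onI)
    fix u v assume uv: "u \<in> S" "v \<in> S" "fst u = fst v"
    obtain i j l where [simp]: "u = (i, j)" "v = (i, l)" using uv by (cases u, cases v) auto
    have "(i, j) \<in> setV n" "(i, l) \<in> setV n" using S uv by auto
    then show "u = v" using suc[OF uv(1)] suc[OF uv(2)] uv
      by (auto simp: setV_iff[OF n] sucV_def)
  qed
  moreover have "inj_on snd S"
  proof (rule inj_onI)
    fix u v assume uv: "u \<in> S" "v \<in> S" "snd u = snd v"
    obtain i j l where [simp]: "u = (i, j)" "v = (l, j)" using uv by (cases u, cases v) auto
    have "(i, j) \<in> setV n" "(l, j) \<in> setV n" using S uv by auto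
    then show "u = v" using suc[OF uv(1)] suc[OF uv(2)] uv nx_inj[of i n l] nx_neq[OF n]
      by (auto simp: setV_iff[OF n] sucV_def)
  qed
  ultimately show "indep n S" using S by (simp add: indep_def)
qed

lemma card_setV:
  assumes n: "n > 1"
  shows "card (setV n) = 2 * n"
proof -
  have "setV n = (\<lambda>i. (i, i)) ` {1..n} \<union> (\<lambda>i. (i, nx n i)) ` {1..n}"
    using n by (auto simp: setV_iff)
  moreover have "(\<lambda>i. (i, i)) ` {1..n} \<inter> (\<lambda>i. (i, nx n i)) ` {1..n} = {}"
    using nx_neq[OF n] by (auto simp: image_iff) metis
  moreover have "inj_on (\<lambda>i. (i, i)) {1..n}" "inj_on (\<lambda>i. (i, nx n i)) {1..n}"
    by (auto simp: inj_on_def)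
  ultimately show ?thesis by (simp add: card_Un_disjoint card_image)
qed

text \<open>If no exchange is possible, both neighbours of every element of \<open>S' - S\<close>
  lie in \<open>S - S'\<close>. Counting makes the symmetric difference closed under the successor,
  hence equal to the cycle; but the cycle has 2n elements and the two sets together have at most 2n
  - 2.\<close>

lemma exchange:
  assumes n: "n > 1" and S: "indep n S" "card S = n - 1" and S': "indep n S'" "card S' = n - 1"
    and ne: "S \<noteq> S'"
  shows "\<exists>e f. e \<in> S - S' \<and> f \<in> S' - S \<and> indep n (insert f (S - {e}))"
proof (rule ccontr)
  assume neg: "\<not> ?thesis"
  note fin = indep_finite[OF n S(1)] indep_finite[OF n S'(1)]
  have cD: "card (S - S') = card (S' - S)"
    using card_Diff_subset_Int[of S S'] card_Diff_subset_Int[of S' S] fin S S' by (simp add: Int_commute)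
  have D'ne: "S - S' \<noteq> {}"
    using ne card_subset_eq[of S' S] fin S S' by auto
  have two: "\<exists>u\<in>S - S'. f = sucV n u" "sucV n f \<in> S - S'" if f: "f \<in> S' - S" for f
  proof -
    have fV: "f \<in> setV n" using S'(1) f by (auto simp: indep_def)
    obtain u where u: "u \<in> setV n" "sucV n u = f" using sucV_surj[OF n fV] by auto
    have uS': "u \<notin> S'" using f u S'(1) by (auto simp: indep_iff[OF n])
    have sS': "sucV n f \<notin> S'" using f S'(1) by (auto simp: indep_iff[OF n])
    have ins: "\<exists>e. e \<in> S - S' \<and> indep n (insert f (S - {e}))" if c: "u \<notin> S \<or> sucV n f \<notin> S"
    proof -
      \<comment> \<open>By the assumption at most one neighbour of \<open>f\<close> lies in
        \<open>S\<close>. It is the one to be removed; if there is none, any element of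
        \<open>S - S'\<close> will do.\<close>
      define e where "e = (if u \<in> S then u else if sucV n f \<in> S then sucV n f else (SOME e. e \<in> S - S'))"
      have e: "e \<in> S - S'" using uS' sS' D'ne some_in_eq[of "S - S'"] by (auto simp: e_def)
      have "u \<notin> S - {e}" "sucV n f \<notin> S - {e}" using c by (auto simp: e_def)
      moreover have "sucV n f \<noteq> f" 
        using f S'(1) by (auto simp: indep_iff[OF n])
      moreover have "v = u" if "sucV n v = f" "v \<in> S" for v
        using that u S(1) sucV_inj[OF n] by (auto simp: indep_def inj_on_def)
      ultimately have "indep n (insert f (S - {e}))"
        using S(1) fV by (auto simp: indep_iff[OF n])
      then show ?thesis using e by blast
    qed
    then have "u \<in> S" "sucV n f \<in> S" using neg f by blast+
    then show "\<exists>u\<in>S - S'. f = sucV n u" "sucV n f \<in> S - S'" using u uS' sS' by auto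
  qed
  have sV: "S - S' \<subseteq> setV n" "S' - S \<subseteq> setV n" using S S' by (auto simp: indep_def)
  \<comment> \<open>The successor maps \<open>B\<close> bijectively onto \<open>S' - S\<close>,
    which has as many elements as \<open>S - S'\<close>; hence \<open>B\<close> is all of
    \<open>S - S'\<close>.\<close>
  define B where "B = {u \<in> S - S'. sucV n u \<in> S' - S}"
  have "sucV n ` B = S' - S" using two(1) by (force simp: B_def)
  moreover have "inj_on (sucV n) B" using sucV_inj[OF n] sV by (rule_tac inj_on_subset) (auto simp: B_def)
  ultimately have "card B = card (S' - S)" by (metis card_image)
  then have "B = S - S'" using card_subset_eq[of "S - S'" B] fin cD by (auto simp: B_def)
  then have cl: "\<And>v. v \<in> (S - S') \<union> (S' - S) \<Longrightarrow> sucV n v \<in> (S - S') \<union> (S' - S)"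
    using two(2) by (auto simp: B_def)
  have "(S - S') \<union> (S' - S) = setV n"
    by (rule sucV_closed[OF n]) (use sV D'ne cl in auto)
  moreover have "card ((S - S') \<union> (S' - S)) \<le> card S + card S'"
    by (rule order_trans[OF card_Un_le]) (intro add_mono card_mono fin, auto)
  ultimately show False using card_setV[OF n] n S S' by simp
qed

text \<open>The possible support of a term of the minor of Y that omits row \<open>fst p\<close> and
  column \<open>snd p\<close>. Here \<open>p\<close> ranges over all positions, not only over those
  in V.\<close>

definition matching :: "nat \<Rightarrow> var \<Rightarrow> var set \<Rightarrow> bool" where
  "matching n p S \<longleftrightarrow> indep n S \<and> fst ` S = {1..n} - {fst p} \<and> snd ` S = {1..n} - {snd p}"

text \<open>An entry of one matching that is missing from the other has a row, if diagonal, or a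
  column, if not, that the other matching can cover only by the successor. So the symmetric
  difference of two different matchings is the whole cycle, which meets the omitted row
  \<open>fst p\<close>.\<close>

lemma matching_unique:
  assumes n: "n > 1" and p: "p \<in> Vars n" and S: "matching n p S" and S': "matching n p S'"
  shows "S = S'"
proof (rule ccontr)
  assume ne: "S \<noteq> S'"
  have step: "sucV n v \<in> T' - T" if v: "v \<in> T - T'" and T: "matching n p T" "matching n p T'" for T T' v
  proof -
    obtain i j where [simp]: "v = (i, j)" by (cases v)
    have ij: "i \<in> {1..n}" "j = i \<or> j = nx n i" using v T n by (auto simp: matching_def indep_def setV_iff subset_iff)
    have "sucV n v \<in> T'"
    proof (cases "j = i")
      case True
      have "i \<in> fst ` T" using v by force
      then have "i \<in> fst ` T'" using T by (auto simp: matching_def)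
      then obtain l where l: "(i, l) \<in> T'" by auto
      then have "(i, l) \<in> setV n" using T by (auto simp: matching_def indep_def)
      then show ?thesis using l v True by (auto simp: setV_iff[OF n] sucV_def)
    next
      case False
      have "j \<in> snd ` T" using v by force
      then have "j \<in> snd ` T'" using T by (auto simp: matching_def)
      then obtain l where l: "(l, j) \<in> T'" by auto
      then have lV: "(l, j) \<in> setV n" using T by (auto simp: matching_def indep_def)
      have "l \<noteq> i" using l v by auto
      then have "j = l" using lV ij False nx_inj[of l n i] by (auto simp: setV_iff[OF n])
      then show ?thesis using l False by (simp add: sucV_def)
    qed
    moreover have "sucV n v \<notin> T" using T v by (auto simp: matching_def indep_iff[OF n])
    ultimately show ?thesis by simp
  qed
  have "(S - S') \<union> (S' - S) = setV n"
    by (rule sucV_closed[OF n])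
      (use ne step[OF _ S S'] step[OF _ S' S] S S' in \<open>auto simp: matching_def indep_def\<close>)
  moreover have "(fst p, fst p) \<in> setV n" using p n by (cases p) (auto simp: setV_iff Vars_def)
  ultimately have "(fst p, fst p) \<in> S \<or> (fst p, fst p) \<in> S'" by blast
  then have "fst p \<in> fst ` S \<or> fst p \<in> fst ` S'" by (metis fst_conv imageI)
  then show False using S S' by (auto simp: matching_def)
qed

lemma matching_exists:
  assumes n: "n > 1" and p: "p \<in> Vars n"
  shows "\<exists>S. matching n p S"
proof -
  obtain a b where [simp]: "p = (a, b)" by (cases p)
  have ab: "a \<in> {1..n}" "b \<in> {1..n}" using p by (auto simp: Vars_def)
  \<comment> \<open>Starting from the diagonal, where column \<open>a\<close> is missing, the rows
    on the cyclic arc from \<open>b\<close> up to just before \<open>a\<close> are moved one column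
    on. This frees column \<open>b\<close> and fills column \<open>a\<close>.\<close>
  define c where "c i = (if (if b \<le> a then b \<le> i \<and> i < a else i < a \<or> i \<ge> b) then nx n i else i)" for i
  define S where "S = (\<lambda>i. (i, c i)) ` ({1..n} - {a})"
  define sh where "sh i = (if b \<le> a then b \<le> i \<and> i < a else i < a \<or> i \<ge> b)" for i
  have c: "c i = (if sh i then nx n i else i)" for i by (simp add: c_def sh_def)
  have mixed: "nx n i \<noteq> j" if "i \<in> {1..n}" "j \<in> {1..n}" "sh i" "\<not> sh j" "j \<noteq> a" for i j
  proof (cases "b \<le> a")
    case True
    then have "b \<le> i" "i < a" "j < b \<or> j > a" using that by (auto simp: sh_def)
    then show ?thesis using ab by (auto simp: nx_def)
  next
    case False
    then have "i < a \<or> i \<ge> b" "j > a" "j < b" using that by (auto simp: sh_def)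
    then show ?thesis using ab by (auto simp: nx_def)
  qed
  have inj: "inj_on c ({1..n} - {a})"
  proof (rule inj_onI)
    fix i j assume ij: "i \<in> {1..n} - {a}" "j \<in> {1..n} - {a}" "c i = c j"
    then show "i = j"
      using mixed[of i j] mixed[of j i] nx_inj[of i n j] unfolding c by (cases "sh i"; cases "sh j") auto
  qed
  have nb: "c i \<noteq> b" if "i \<in> {1..n} - {a}" for i
  proof (cases "sh i")
    case True
    then show ?thesis using that ab by (cases "b \<le> a") (auto simp: c sh_def nx_def)
  next
    case False
    then show ?thesis using that ab by (cases "b \<le> a") (auto simp: c sh_def)
  qed
  have cin: "c ` ({1..n} - {a}) \<subseteq> {1..n} - {b}"
  proof
    fix y assume "y \<in> c ` ({1..n} - {a})"
    then obtain i where i: "i \<in> {1..n} - {a}" "y = c i" by blast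
    moreover have "c i \<in> {1..n}" using i(1) nx_in[of i n] unfolding c by (cases "sh i") auto
    ultimately show "y \<in> {1..n} - {b}" using nb by blast
  qed
  have cim: "c ` ({1..n} - {a}) = {1..n} - {b}"
    by (rule card_subset_eq[OF _ cin]) (use ab in \<open>simp_all add: card_image[OF inj, simplified]\<close>)
  have "S \<subseteq> setV n" by (auto simp: S_def setV_iff[OF n] c split: if_splits)
  moreover have "inj_on fst S" by (auto simp: S_def inj_on_def)
  moreover have "inj_on snd S"
    by (rule inj_onI) (use inj_onD[OF inj] in \<open>fastforce simp: S_def\<close>)
  moreover have "fst ` S = {1..n} - {a}" by (force simp: S_def image_image)
  moreover have "snd ` S = {1..n} - {b}" using cim by (simp add: S_def image_image)
  ultimately show ?thesis by (auto simp: matching_def indep_def)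
qed

definition Em :: "nat \<Rightarrow> var \<Rightarrow> var set" where
  "Em n p = (SOME S. matching n p S)"

lemma Em_matching: "n > 1 \<Longrightarrow> p \<in> Vars n \<Longrightarrow> matching n p (Em n p)"
  unfolding Em_def by (rule someI_ex) (rule matching_exists)

lemma matching_Em: "n > 1 \<Longrightarrow> p \<in> Vars n \<Longrightarrow> matching n p S \<Longrightarrow> S = Em n p"
  using matching_unique Em_matching by blast

lemma matching_card:
  assumes p: "p \<in> Vars n" and S: "matching n p S"
  shows "card S = n - 1"
proof -
  have "card (fst ` S) = card S" by (rule card_image) (use S in \<open>simp add: matching_def indep_def\<close>)
  moreover have "card (fst ` S) = n - 1" using S p by (cases p) (auto simp: matching_def Vars_def)
  ultimately show ?thesis by simp
qed

text \<open>Distinct rows and distinct columns make \<open>n - 1\<close> entries omit exactly one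
  row and one column, and these two indices are the position \<open>p\<close>. Independent sets of
  this size thus correspond to the minors.\<close>

lemma indep_matching:
  assumes n: "n > 1" and S: "indep n S" "card S = n - 1"
  shows "\<exists>p\<in>Vars n. S = Em n p"
proof -
  have miss: "\<exists>a\<in>{1..n}. f ` S = {1..n} - {a}" if "inj_on f S" "f ` S \<subseteq> {1..n}" for f
  proof -
    have "card (f ` S) = n - 1" using that S by (simp add: card_image)
    then have "card ({1..n} - f ` S) = 1" using that n
      by (subst card_Diff_subset) (auto simp: finite_subset)
    then obtain a where "{1..n} - f ` S = {a}" by (auto simp: card_1_singleton_iff)
    then show ?thesis using that by (intro bexI[of _ a]) auto
  qed
  have V: "S \<subseteq> Vars n" using S setV_Vars[OF n] by (auto simp: indep_def)
  obtain a where a: "a \<in> {1..n}" "fst ` S = {1..n} - {a}"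
    using miss[of fst] S V by (force simp: indep_def Vars_def)
  obtain b where b: "b \<in> {1..n}" "snd ` S = {1..n} - {b}"
    using miss[of snd] S V by (force simp: indep_def Vars_def)
  have "matching n (a, b) S" using a b S by (simp add: matching_def)
  then have "S = Em n (a, b)" using matching_Em[OF n, of "(a, b)"] a b by (auto simp: Vars_def)
  moreover have "(a, b) \<in> Vars n" using a b by (simp add: Vars_def)
  ultimately show ?thesis by blast
qed

lemma Em_indep: "n > 1 \<Longrightarrow> p \<in> Vars n \<Longrightarrow> indep n (Em n p) \<and> card (Em n p) = n - 1"
  using Em_matching matching_card by (auto simp: matching_def)

section \<open>Faces of the cyclic polytope\<close>

definition cindep :: "nat \<Rightarrow> nat set \<Rightarrow> bool" where
  "cindep N S \<longleftrightarrow> S \<subseteq> {1..N} \<and> (\<forall>k\<in>S. nx N k \<notin> S)"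

lemma linear_prod:
  fixes B :: "real set"
  assumes "finite B"
  shows "degree (\<Prod>y\<in>B. [:- y, 1:]) = card B \<and> coeff (\<Prod>y\<in>B. [:- y, 1:]) (card B) = 1"
  using assms
proof (induction B rule: finite_induct)
  case (insert x B)
  let ?p = "\<Prod>y\<in>B. [:- y, 1:]"
  have p0: "?p \<noteq> 0" using insert by auto
  have "degree ([:- x, 1:] * ?p) = degree [:- x, 1:] + degree ?p" by (rule degree_mult_eq) (use p0 in auto)
  then have d: "degree ([:- x, 1:] * ?p) = Suc (card B)" using insert by simp
  have "coeff ([:- x, 1:] * ?p) (degree [:- x, 1:] + degree ?p) = lead_coeff [:- x, 1:] * lead_coeff ?p"
    by (rule coeff_mult_degree_sum)
  then have "coeff ([:- x, 1:] * ?p) (Suc (card B)) = 1" using insert by simp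
  then show ?case using d insert by simp
qed simp

lemma poly_agree:
  fixes p q :: "real poly"
  assumes "finite T" "degree p < card T" "degree q < card T" "\<And>x. x \<in> T \<Longrightarrow> poly p x = poly q x"
  shows "p = q"
proof (rule ccontr)
  assume "p \<noteq> q"
  then have ne: "p - q \<noteq> 0" by simp
  have "T \<subseteq> {x. poly (p - q) x = 0}" using assms(4) by auto
  then have "card T \<le> card {x. poly (p - q) x = 0}" using poly_roots_finite[OF ne] by (intro card_mono)
  also have "\<dots> \<le> degree (p - q)" by (rule card_poly_roots_bound[OF ne])
  also have "\<dots> < card T" using degree_diff_le_max[of p q] assms(2,3) by simp
  finally show False by simp
qed

text \<open>The sum is the top coefficient of the Lagrange interpolant.\<close>
lemma divided_difference_zero:
  fixes p :: "real poly"
  assumes T: "finite T" and d: "degree p + 1 < card T"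
  shows "(\<Sum>x\<in>T. poly p x / (\<Prod>y\<in>T - {x}. x - y)) = 0"
proof -
  define B where "B x = (\<Prod>y\<in>T - {x}. [:- y, 1:])" for x
  define w where "w x = (\<Prod>y\<in>T - {x}. x - y)" for x
  define L where "L = (\<Sum>x\<in>T. smult (poly p x / w x) (B x))"
  have dB: "degree (B x) = card T - 1" "coeff (B x) (card T - 1) = 1" if "x \<in> T" for x
    using linear_prod[of "T - {x}"] T that by (simp_all add: B_def)
  have pB: "poly (B x) x = w x" for x by (simp add: B_def w_def poly_prod)
  have pB0: "poly (B x) z = 0" if "z \<in> T" "z \<noteq> x" for x z
    unfolding B_def poly_prod using T that by (intro prod_zero bexI[of _ z]) auto
  have w0: "w x \<noteq> 0" for x using T by (simp add: w_def)
  have "p = L"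
  proof (rule poly_agree[OF T])
    have "degree L \<le> card T - 1" unfolding L_def
      by (rule degree_sum_le) (use T dB degree_smult_le in \<open>auto intro: order_trans\<close>)
    then show "degree L < card T" using d by simp
    show "degree p < card T" using d by simp
    fix z assume z: "z \<in> T"
    have "poly L z = (\<Sum>x\<in>T. if x = z then poly p z else 0)"
      unfolding L_def poly_sum by (rule sum.cong[OF refl]) (use z pB pB0 w0 in auto)
    then show "poly p z = poly L z" using T z by (simp add: sum.delta)
  qed
  moreover have "coeff L (card T - 1) = (\<Sum>x\<in>T. poly p x / w x)"
    unfolding L_def coeff_sum by (rule sum.cong[OF refl]) (simp only: coeff_smult dB mult_1_right)
  ultimately have "coeff p (card T - 1) = (\<Sum>x\<in>T. poly p x / w x)" by metis
  moreover have "coeff p (card T - 1) = 0" using d by (intro coeff_eq_0) simp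
  ultimately show ?thesis by (simp add: w_def)
qed

text \<open>The divided difference over \<open>S\<close> and its translate by \<open>e\<close>
  vanishes because the degree is too small. Its terms on \<open>S\<close> are 0 and the weights on
  the translate all have the sign of \<open>e\<close>, so nonnegative values there must vanish too.
  Then \<open>p\<close> has more zeros than its degree allows.\<close>

lemma interlaced_zero:
  fixes p :: "real poly" and S :: "int set"
  assumes S: "finite S" and d: "degree p + 1 < 2 * card S" and e: "e = 1 \<or> e = - 1"
    and disj: "\<And>s. s \<in> S \<Longrightarrow> s + e \<notin> S"
    and z: "\<And>s. s \<in> S \<Longrightarrow> poly p (of_int s) = 0" and nn: "\<And>s. s \<in> S \<Longrightarrow> poly p (of_int (s + e)) \<ge> 0"
  shows "p = 0"
proof -
  define U where "U = (\<lambda>s. s + e) ` S"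
  define T where "T = real_of_int ` (S \<union> U)"
  have SU: "S \<inter> U = {}" using disj by (auto simp: U_def)
  have fU: "finite U" using S by (simp add: U_def)
  have cU: "card U = card S" unfolding U_def by (rule card_image) (simp add: inj_on_def)
  have cT: "card T = 2 * card S"
    unfolding T_def by (subst card_image) (simp_all add: inj_on_def card_Un_disjoint S fU SU cU)
  have fT: "finite T" using S fU by (simp add: T_def)
  define w where "w x = (\<Prod>y\<in>T - {x}. x - y)" for x
  have pos: "w (of_int (s + e)) * of_int e > 0" if s: "s \<in> S" for s
  proof -
    let ?x = "real_of_int (s + e)"
    have ne: "e \<noteq> 0" using e by auto
    define R where "R = (S - {s}) \<union> (\<lambda>s. s + e) ` (S - {s})"
    have SUR: "S \<union> U = insert (s + e) (insert s R)" using s by (auto simp: R_def U_def)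
    have sR: "s \<notin> R"
    proof
      assume "s \<in> R"
      then obtain s' where "s' \<in> S" "s = s' + e" by (auto simp: R_def)
      then show False using disj[of s'] s by simp
    qed
    have seR: "s + e \<notin> insert s R" using disj[OF s] ne by (auto simp: R_def)
    have fR: "finite R" using S by (simp add: R_def)
    have "T = insert ?x (real_of_int ` insert s R)" unfolding T_def SUR by (rule image_insert)
    moreover have "?x \<notin> real_of_int ` insert s R"
    proof
      assume "?x \<in> real_of_int ` insert s R"
      then obtain y where y: "?x = real_of_int y" "y \<in> insert s R" by (rule imageE)
      from y(1) have "s + e = y" by (simp only: of_int_eq_iff)
      then show False using y(2) seR by simp
    qed
    ultimately have "T - {?x} = real_of_int ` insert s R" by simp
    then have "w ?x = (\<Prod>y\<in>real_of_int ` insert s R. ?x - y)" by (simp only: w_def)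
    also have "\<dots> = (\<Prod>y\<in>insert s R. ?x - of_int y)"
      by (subst prod.reindex) (simp_all add: inj_on_def)
    also have "\<dots> = (?x - of_int s) * (\<Prod>y\<in>R. ?x - of_int y)" by (rule prod.insert[OF fR sR])
    also have "(\<Prod>y\<in>R. ?x - of_int y) = (\<Prod>y\<in>(S - {s}) \<union> (\<lambda>s. s + e) ` (S - {s}). ?x - of_int y)"
      by (simp only: R_def)
    also have "\<dots> = (\<Prod>y\<in>S - {s}. ?x - of_int y) * (\<Prod>y\<in>(\<lambda>s. s + e) ` (S - {s}). ?x - of_int y)"
      by (rule prod.union_disjoint) (use S SU in \<open>auto simp: U_def\<close>)
    also have "(\<Prod>y\<in>(\<lambda>s. s + e) ` (S - {s}). ?x - of_int y) = (\<Prod>y\<in>S - {s}. ?x - of_int (y + e))"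
      by (subst prod.reindex) (simp_all add: inj_on_def)
    also have "(\<Prod>y\<in>S - {s}. ?x - of_int y) * (\<Prod>y\<in>S - {s}. ?x - of_int (y + e)) = (\<Prod>y\<in>S - {s}. of_int ((s + e - y) * (s - y)))"
      by (simp add: prod.distrib)
    finally have w: "w ?x = of_int e * (\<Prod>y\<in>S - {s}. real_of_int ((s + e - y) * (s - y)))" by simp
    have "(\<Prod>y\<in>S - {s}. real_of_int ((s + e - y) * (s - y))) > 0"
    proof (rule prod_pos)
      fix y assume "y \<in> S - {s}"
      then have y: "y \<in> S" "y \<noteq> s" by auto
      then have "s + e \<noteq> y" using disj[OF s] by auto
      \<comment> \<open>The two factors are consecutive integers and neither is 0, so no sign change
        lies between them.\<close>
      then have "(s + e - y > 0 \<and> s - y > 0) \<or> (s + e - y < 0 \<and> s - y < 0)"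
        using y e by auto
      then have "(s + e - y) * (s - y) > 0" by (auto intro: mult_pos_pos mult_neg_neg)
      then show "0 < real_of_int ((s + e - y) * (s - y))" by (simp only: of_int_0_less_iff)
    qed
    then show ?thesis unfolding w using e by auto
  qed
  have "(\<Sum>x\<in>T. poly p x / w x) = 0"
    unfolding w_def by (rule divided_difference_zero[OF fT]) (use d cT in simp)
  also have "(\<Sum>x\<in>T. poly p x / w x) = (\<Sum>y\<in>S \<union> U. poly p (of_int y) / w (of_int y))"
    unfolding T_def by (subst sum.reindex) (simp_all add: inj_on_def)
  also have "\<dots> = (\<Sum>y\<in>U. poly p (of_int y) / w (of_int y))"
    using S fU SU z by (subst sum.union_disjoint) auto
  also have "\<dots> = (\<Sum>s\<in>S. poly p (of_int (s + e)) / w (of_int (s + e)))"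
    unfolding U_def by (subst sum.reindex) (simp_all add: inj_on_def)
  finally have "(\<Sum>s\<in>S. poly p (of_int (s + e)) / w (of_int (s + e))) * of_int e = 0" by simp
  then have sum0: "(\<Sum>s\<in>S. poly p (of_int (s + e)) * of_int e / w (of_int (s + e))) = 0"
    by (simp add: sum_distrib_right)
  have ee: "of_int e * of_int e = (1::real)" using e by auto
  have quot: "poly p (of_int (s + e)) * of_int e / w (of_int (s + e)) = poly p (of_int (s + e)) / (w (of_int (s + e)) * of_int e)" for s
    using e by auto
  have "\<forall>s\<in>S. poly p (of_int (s + e)) / (w (of_int (s + e)) * of_int e) = 0"
    using sum0 unfolding quot
    by (subst (asm) sum_nonneg_eq_0_iff) (use S nn pos in \<open>auto intro: divide_nonneg_pos simp del: of_int_add\<close>)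
  then have zu: "poly p (of_int (s + e)) = 0" if "s \<in> S" for s
    using that pos[OF that] by (metis divide_eq_0_iff less_irrefl)
  show ?thesis
    by (rule poly_agree[OF fT]) (use d cT z zu in \<open>auto simp: T_def U_def\<close>)
qed

text \<open>This is Gale's evenness condition in covering form. Each chosen element will give one
  quadratic factor of the supporting polynomial, responsible for that element and possibly its
  successor.\<close>

lemma greedy_cover:
  assumes N: "N > 1"
  shows "F \<subseteq> {1..N} \<Longrightarrow> F \<noteq> {1..N} \<Longrightarrow> \<exists>S. cindep N S \<and> S \<subseteq> F \<and> F \<subseteq> S \<union> nx N ` S"
proof (induction "card F" arbitrary: F rule: less_induct)
  case less
  have fin: "finite F" using less.prems(1) finite_subset by blast
  show ?case
  proof (cases "F = {}")
    case True
    then show ?thesis by (intro exI[of _ "{}"]) (auto simp: cindep_def)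
  next
    case False
    \<comment> \<open>A proper nonempty subset of the cycle has an element whose predecessor is
      missing. Picking that first element of a run keeps it apart from the later choices.\<close>
    have "\<exists>c\<in>{1..N} - F. nx N c \<notin> {1..N} - F"
    proof (rule ccontr)
      assume "\<not> ?thesis"
      then have cl: "\<And>c. c \<in> {1..N} - F \<Longrightarrow> nx N c \<in> {1..N} - F" by blast
      have "{1..N} - F = {1..N}" by (rule nx_closed[OF _ _ cl]) (use less.prems in auto)
      then show False using False less.prems by blast
    qed
    then obtain c where c: "c \<in> {1..N}" "c \<notin> F" "nx N c \<in> F" using nx_in by blast
    define a where "a = nx N c"
    have a: "a \<in> F" "a \<in> {1..N}" using c less.prems by (auto simp: a_def)
    define F' where "F' = F - {a, nx N a}"
    have "card F' < card F" unfolding F'_def using a fin by (intro psubset_card_mono) auto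
    then obtain S where S: "cindep N S" "S \<subseteq> F'" "F' \<subseteq> S \<union> nx N ` S"
      using less.hyps[of F'] less.prems a by (auto simp: F'_def)
    have "nx N s \<noteq> a" if "s \<in> S" for s
    proof
      assume "nx N s = a"
      moreover have "s \<in> {1..N}" using S(1) that by (auto simp: cindep_def)
      ultimately have "s = c" using nx_inj[of s N c] c(1) by (simp add: a_def)
      then show False using c S(2) that by (auto simp: F'_def)
    qed
    then have "cindep N (insert a S)"
      using S a nx_neq[OF N, of a] by (auto simp: cindep_def F'_def)
    moreover have "F \<subseteq> insert a S \<union> nx N ` insert a S" using S(3) by (auto simp: F'_def)
    ultimately show ?thesis using S(2) a by (intro exI[of _ "insert a S"]) (auto simp: F'_def)
  qed
qed

definition poly_face :: "nat \<Rightarrow> nat \<Rightarrow> nat set \<Rightarrow> bool" where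
  "poly_face N d F \<longleftrightarrow> (\<exists>p::real poly. degree p \<le> d \<and> (\<forall>t\<in>{1..N}. poly p (real t) \<ge> 0) \<and> F = {t\<in>{1..N}. poly p (real t) = 0})"

text \<open>On the moment curve \<open>b - a.x\<close> is a polynomial in the parameter of degree at
  most \<open>d\<close> with constant term \<open>b\<close>; validity of the inequality is
  nonnegativity, and the points on the hyperplane are the zeros.\<close>

lemma cyclic_boundary_poly: "cyclic_boundary N d = {F. F \<noteq> {1..N} \<and> poly_face N d F}"
proof -
  have ev: "poly p x = coeff p 0 + (\<Sum>c = 1..d. coeff p c * x ^ c)" if "degree p \<le> d" for p :: "real poly" and x
  proof -
    have "poly p x = (\<Sum>c\<le>d. coeff p c * x ^ c)"
      unfolding poly_altdef by (rule sum.mono_neutral_left) (use that in \<open>auto simp: coeff_eq_0\<close>)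
    also have "{..d} = insert 0 {1..d}" by auto
    finally show ?thesis by simp
  qed
  have "(\<exists>(a::nat \<Rightarrow> real) b. (\<forall>t\<in>{1..N}. (\<Sum>c = 1..d. a c * real t ^ c) \<le> b) \<and>
           F = {t\<in>{1..N}. (\<Sum>c = 1..d. a c * real t ^ c) = b}) \<longleftrightarrow> poly_face N d F" for F
  proof
    assume "\<exists>(a::nat \<Rightarrow> real) b. (\<forall>t\<in>{1..N}. (\<Sum>c = 1..d. a c * real t ^ c) \<le> b) \<and>
           F = {t\<in>{1..N}. (\<Sum>c = 1..d. a c * real t ^ c) = b}"
    then obtain a b where ab: "\<forall>t\<in>{1..N}. (\<Sum>c = 1..d. a c * real t ^ c) \<le> b" "F = {t\<in>{1..N}. (\<Sum>c = 1..d. a c * real t ^ c) = b}"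
      by blast
    define p where "p = [:b:] - (\<Sum>c = 1..d. Polynomial.monom (a c) c)"
    have "degree (\<Sum>c = 1..d. Polynomial.monom (a c) c) \<le> d"
      by (rule degree_sum_le) (auto intro: order_trans[OF degree_monom_le])
    then have "degree p \<le> d" unfolding p_def by (intro degree_diff_le) auto
    moreover have "poly p x = b - (\<Sum>c = 1..d. a c * x ^ c)" for x
      by (simp add: p_def poly_sum poly_monom)
    ultimately show "poly_face N d F" unfolding poly_face_def using ab by (intro exI[of _ p]) auto
  next
    assume "poly_face N d F"
    then obtain p :: "real poly" where p: "degree p \<le> d" "\<forall>t\<in>{1..N}. poly p (real t) \<ge> 0" "F = {t\<in>{1..N}. poly p (real t) = 0}"
      by (auto simp: poly_face_def)
    have e: "(\<Sum>c = 1..d. - coeff p c * x ^ c) = coeff p 0 - poly p x" for x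
      by (simp add: ev[OF p(1)] sum_negf)
    show "\<exists>(a::nat \<Rightarrow> real) b. (\<forall>t\<in>{1..N}. (\<Sum>c = 1..d. a c * real t ^ c) \<le> b) \<and>
           F = {t\<in>{1..N}. (\<Sum>c = 1..d. a c * real t ^ c) = b}"
      by (rule exI[of _ "\<lambda>c. - coeff p c"], rule exI[of _ "coeff p 0"]) (use p(2,3) in \<open>simp only: e, auto\<close>)
  qed
  then show ?thesis unfolding cyclic_boundary_def by simp
qed

lemma cindep_subset: "cindep N S \<Longrightarrow> S' \<subseteq> S \<Longrightarrow> cindep N S'"
  by (auto simp: cindep_def)

text \<open>A greedy cover of \<open>F\<close> consists of independent points, so it has at most
  \<open>m\<close> of them: a larger one would contain an independent set of the excluded size. The
  product of one quadratic factor per point has degree at most \<open>2 * m\<close>.\<close>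

lemma poly_face_indep:
  assumes N: "N > 1" and F: "F \<subseteq> {1..N}" "F \<noteq> {1..N}"
    and m: "\<And>S. S \<subseteq> F \<Longrightarrow> cindep N S \<Longrightarrow> card S \<noteq> m + 1"
  shows "poly_face N (2 * m) F"
proof -
  obtain S where S: "cindep N S" "S \<subseteq> F" "F \<subseteq> S \<union> nx N ` S" using greedy_cover[OF N F] by blast
  have fS: "finite S" using finite_subset[OF S(2) finite_subset[OF F(1)]] by simp
  have SN: "S \<subseteq> {1..N}" using S(1) by (simp add: cindep_def)
  have cS: "card S \<le> m"
  proof (rule ccontr)
    assume "\<not> card S \<le> m"
    then have "m + 1 \<le> card S" by simp
    then obtain S' where "S' \<subseteq> S" "card S' = m + 1" by (meson obtain_subset_with_card_n)
    then show False using m[of S'] S cindep_subset by blast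
  qed
  \<comment> \<open>A factor vanishes doubly at \<open>a\<close> if the successor is not in
    \<open>F\<close>, and simply at \<open>a\<close> and its successor otherwise. Between
    consecutive integers no vertex sees a negative value; for the wrap-around pair 1 and
    \<open>N\<close> the opposite sign is taken, as all vertices lie between them.\<close>
  define g :: "nat \<Rightarrow> real poly" where
    "g a = (if nx N a \<notin> F then [:- real a, 1:] ^ 2
            else if a = N then - ([:- 1, 1:] * [:- real N, 1:]) else [:- real a, 1:] * [:- (real a + 1), 1:])" for a
  have dg: "degree (g a) \<le> 2" for a
  proof -
    have "degree ([:- x, 1:] * [:- y, 1:] :: real poly) \<le> 2" for x y
      by (rule order_trans[OF degree_mult_le]) simp
    then show ?thesis by (auto simp: g_def power2_eq_square)
  qed
  have pe: "poly (g a) x = (if nx N a \<notin> F then (x - real a)^2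
      else if a = N then (x - 1) * (real N - x) else (x - real a) * (x - (real a + 1)))" for a x
    by (simp add: g_def algebra_simps)
  have zg: "poly (g a) (real t) = 0 \<longleftrightarrow> t = a \<or> (nx N a \<in> F \<and> t = nx N a)" for a t
  proof -
    have "real t = real a + 1 \<longleftrightarrow> t = a + 1" by linarith
    then show ?thesis unfolding pe by (auto simp: nx_def)
  qed
  have pg: "poly (g a) (real t) \<ge> 0" if "t \<in> {1..N}" for a t
  proof -
    have "(real t - real a) * (real t - (real a + 1)) \<ge> 0"
    proof (cases "t \<le> a")
      case True
      then show ?thesis by (intro mult_nonpos_nonpos) auto
    next
      case False
      then show ?thesis by (intro mult_nonneg_nonneg) auto
    qed
    moreover have "(real t - 1) * (real N - real t) \<ge> 0" using that by (intro mult_nonneg_nonneg) auto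
    ultimately show ?thesis unfolding pe by (simp del: of_nat_diff)
  qed
  define p where "p = (\<Prod>a\<in>S. g a)"
  have "degree p \<le> (\<Sum>a\<in>S. degree (g a))" unfolding p_def using degree_prod_sum_le[OF fS, of g] by (simp add: o_def)
  also have "\<dots> \<le> (\<Sum>a\<in>S. 2)" by (rule sum_mono) (rule dg)
  also have "\<dots> \<le> 2 * m" using cS by simp
  finally have "degree p \<le> 2 * m" .
  moreover have "poly p (real t) \<ge> 0" if "t \<in> {1..N}" for t
    unfolding p_def poly_prod using pg that by (intro prod_nonneg) auto
  moreover have "poly p (real t) = 0 \<longleftrightarrow> t \<in> F" for t
  proof -
    have "poly p (real t) = 0 \<longleftrightarrow> (\<exists>a\<in>S. poly (g a) (real t) = 0)"
      unfolding p_def poly_prod using fS by simp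
    also have "\<dots> \<longleftrightarrow> (\<exists>a\<in>S. t = a \<or> (nx N a \<in> F \<and> t = nx N a))" using zg by auto
    also have "\<dots> \<longleftrightarrow> t \<in> F" using S(2,3) by blast
    finally show ?thesis .
  qed
  ultimately show ?thesis unfolding poly_face_def using F by (intro exI[of _ p]) auto
qed

lemma poly_face_not_indep:
  assumes F: "F \<noteq> {1..N}" "poly_face N (2 * m) F" and S: "S \<subseteq> F" "cindep N S" "card S = m + 1"
  shows False
proof -
  from F(2)[unfolded poly_face_def] obtain p :: "real poly" where
    p': "degree p \<le> 2 * m \<and> (\<forall>t\<in>{1..N}. poly p (real t) \<ge> 0) \<and> F = {t\<in>{1..N}. poly p (real t) = 0}" ..
  note p = conjunct1[OF p'] bspec[OF conjunct1[OF conjunct2[OF p']]] conjunct2[OF conjunct2[OF p']]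
  have SN: "S \<subseteq> {1..N}" "\<And>k. k \<in> S \<Longrightarrow> nx N k \<notin> S" using S by (auto simp: cindep_def)
  have fS: "finite S" using finite_subset[OF SN(1)] by simp
  \<comment> \<open>If \<open>N\<close> belongs to \<open>S\<close>, its successor wraps to 1 and is
    no neighbour on the real line. Predecessors serve instead, and they stay in range because then 1
    is not in \<open>S\<close>.\<close>
  define e :: int where "e = (if N \<in> S then -1 else 1)"
  have shift: "\<exists>t\<in>{1..N}. int s + e = int t \<and> t \<notin> S" if s: "s \<in> S" for s
  proof (cases "N \<in> S")
    case True
    then have "1 \<notin> S" using SN(2)[of N] by (simp add: nx_def)
    then have "s > 1" using s SN(1) by (cases "s = 1") auto
    moreover have "s - 1 \<notin> S"
      using SN(2)[of "s - 1"] s \<open>s > 1\<close> SN(1) by (auto simp: nx_def split: if_splits)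
    ultimately show ?thesis using s SN(1) True by (intro bexI[of _ "s - 1"]) (auto simp: e_def)
  next
    case False
    then have "s < N" using s SN(1) by (cases "s = N") auto
    moreover have "s + 1 \<notin> S" using SN(2)[OF s] \<open>s < N\<close> by (simp add: nx_def)
    ultimately show ?thesis using s SN(1) False by (intro bexI[of _ "s + 1"]) (auto simp: e_def)
  qed
  have "p = 0"
  proof (rule interlaced_zero[of "int ` S" p e])
    show "degree p + 1 < 2 * card (int ` S)" using p(1) S(3) by (simp add: card_image)
    show "e = 1 \<or> e = -1" by (simp add: e_def)
    show "s + e \<notin> int ` S" if "s \<in> int ` S" for s using that shift by fastforce
    show "poly p (of_int s) = 0" if "s \<in> int ` S" for s using that S(1) p(3) by auto
    show "0 \<le> poly p (of_int (s + e))" if "s \<in> int ` S" for s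
    proof -
      obtain t where "t \<in> {1..N}" "s + e = int t" using \<open>s \<in> int ` S\<close> shift by fastforce
      then show ?thesis using p(2)[of t] by (simp only: of_int_of_nat_eq)
    qed
  qed (use fS in simp)
  then have "F = {1..N}" using p(3) by auto
  then show False using F by simp
qed

theorem cyclic_boundary_faces:
  assumes "N > 1" "2 * m + 2 \<le> N"
  shows "cyclic_boundary N (2 * m) = {F. F \<subseteq> {1..N} \<and> (\<forall>S\<subseteq>F. cindep N S \<longrightarrow> card S \<noteq> m + 1)}"
proof (intro equalityI subsetI)
  fix F assume "F \<in> cyclic_boundary N (2 * m)"
  then have F: "F \<noteq> {1..N}" "poly_face N (2 * m) F" by (auto simp: cyclic_boundary_poly)
  then have "F \<subseteq> {1..N}" by (auto simp: poly_face_def)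
  then show "F \<in> {F. F \<subseteq> {1..N} \<and> (\<forall>S\<subseteq>F. cindep N S \<longrightarrow> card S \<noteq> m + 1)}"
    using poly_face_not_indep[OF F] by blast
next
  fix F assume "F \<in> {F. F \<subseteq> {1..N} \<and> (\<forall>S\<subseteq>F. cindep N S \<longrightarrow> card S \<noteq> m + 1)}"
  then have F: "F \<subseteq> {1..N}" "\<And>S. S \<subseteq> F \<Longrightarrow> cindep N S \<Longrightarrow> card S \<noteq> m + 1" by auto
  have "F \<noteq> {1..N}"
  proof
    assume FN: "F = {1..N}"
    \<comment> \<open>The odd numbers up to \<open>2 * m + 1\<close> are independent in the cycle
      since \<open>2 * m + 2\<close> still fits, so the whole vertex set is excluded.\<close>
    define S where "S = (\<lambda>i. 2 * i + 1) ` {..m}"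
    have "card S = m + 1" unfolding S_def by (subst card_image) (auto simp: inj_on_def)
    moreover have "cindep N S"
      unfolding cindep_def
    proof (intro conjI ballI)
      show "S \<subseteq> {1..N}" using assms by (auto simp: S_def)
      fix k assume "k \<in> S"
      then obtain i where i: "k = 2 * i + 1" "i \<le> m" by (auto simp: S_def)
      then have "nx N k = 2 * i + 2" using assms by (auto simp: nx_def)
      moreover have "2 * i + 2 \<noteq> 2 * j + 1" for j by presburger
      ultimately show "nx N k \<notin> S" by (auto simp: S_def)
    qed
    ultimately show False using F(2)[of S] FN by (auto simp: cindep_def)
  qed
  then show "F \<in> cyclic_boundary N (2 * m)"
    using poly_face_indep[OF assms(1) F(1) _ F(2)] by (simp add: cyclic_boundary_poly)
qed

section \<open>Minors\<close>

definition sqm :: "var set \<Rightarrow> mon" where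
  "sqm F = (\<Sum>v\<in>F. sgl v 1)"

lemma lookup_sqm: "finite F \<Longrightarrow> lkp (sqm F) v = (if v \<in> F then 1 else 0)"
  by (simp add: sqm_def lookup_sum lookup_single when_def)

lemma keys_sqm: "finite F \<Longrightarrow> kys (sqm F) = F"
  by (auto simp: in_keys_iff lookup_sqm split: if_splits)

lemma monom_add: "monom (m + m') = monom m * monom m'"
  by (simp add: monom_def mult_single)

lemma monom_0 [simp]: "monom 0 = 1"
  by (simp add: monom_def)

lemma monom_sqm: "finite F \<Longrightarrow> monom (sqm F) = (\<Prod>v\<in>F. X v)"
  by (induction F rule: finite_induct) (simp_all add: sqm_def monom_add X_def)

lemma kill_det_sq: "kill U (det_sq k M) = det_sq k (\<lambda>i j. kill U (M i j))"
  by (simp add: det_sq_def kill_sum kill_mult kill_prod)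

lemma kill_minor_del: "kill U (minor_del n M a b) = minor_del n (\<lambda>i j. kill U (M i j)) a b"
  by (simp add: minor_del_def kill_det_sq)

lemma skip_in: "a \<in> {1..n} \<Longrightarrow> k < n - 1 \<Longrightarrow> skip a (k + 1) \<in> {1..n} - {a}"
  by (auto simp: skip_def)

lemma skip_bij: "a \<in> {1..n} \<Longrightarrow> bij_betw (\<lambda>k. skip a (k + 1)) {..<n - 1} ({1..n} - {a})"
proof -
  assume a: "a \<in> {1..n}"
  have inj: "inj_on (\<lambda>k. skip a (k + 1)) {..<n - 1}"
  proof (rule inj_onI)
    fix x y assume "skip a (x + 1) = skip a (y + 1)"
    then show "x = y" by (cases "x + 1 < a"; cases "y + 1 < a") (simp_all add: skip_def)
  qed
  have "(\<lambda>k. skip a (k + 1)) ` {..<n - 1} = {1..n} - {a}"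
  proof (rule card_subset_eq)
    show "(\<lambda>k. skip a (k + 1)) ` {..<n - 1} \<subseteq> {1..n} - {a}"       by (rule image_subsetI) (rule skip_in[OF a], simp)
  qed (use a card_image[OF inj] in simp_all)
  then show ?thesis using inj by (simp add: bij_betw_def)
qed

lemma det_sq_det: "det_sq k M = det (mat k k (\<lambda>(i, j). M i j))"
proof -
  have "det (mat k k (\<lambda>(i, j). M i j)) = (\<Sum>p\<in>{p. p permutes {0..<k}}. of_int (sign p) * (\<Prod>i = 0..<k. mat k k (\<lambda>(i, j). M i j) $$ (i, p i)))"
    by (subst det_def'[of _ k]) (auto simp: sign_def)
  also have "\<dots> = det_sq k M"
    unfolding det_sq_def atLeast0LessThan[symmetric]
  proof (intro sum.cong refl arg_cong2[where f = "(*)"] prod.cong)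
    fix p i assume "p \<in> {p. p permutes {0..<k}}" "i \<in> {0..<k}"
    then show "mat k k (\<lambda>(i, j). M i j) $$ (i, p i) = M i (p i)"
      using permutes_in_image[of p "{0..<k}" i] by auto
  qed
  finally show ?thesis by simp
qed

section \<open>Cofactors and the adjugate relations\<close>

definition cofac :: "nat \<Rightarrow> (nat \<Rightarrow> nat \<Rightarrow> 'b::comm_ring_1) \<Rightarrow> var \<Rightarrow> 'b" where
  "cofac n M p = (-1) ^ (fst p + snd p) * minor_del n M (fst p) (snd p)"

lemma cofac_cofactor:
  assumes "a \<in> {1..n}" "b \<in> {1..n}"
  shows "cofactor (mat n n (\<lambda>(i, j). M (i + 1) (j + 1))) (a - 1) (b - 1) = cofac n M (a, b)"
proof -
  let ?A = "mat n n (\<lambda>(i, j). M (i + 1) (j + 1))"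
  have "mat_delete ?A (a - 1) (b - 1) = mat (n - 1) (n - 1) (\<lambda>(i, j). M (skip a (i + 1)) (skip b (j + 1)))"
    by (rule eq_matI) (use assms in \<open>auto simp: mat_delete_def skip_def insert_index_def\<close>)
  moreover have "(-1 :: 'a) ^ (a - 1 + (b - 1)) = (-1) ^ (a + b)"
  proof -
    have "a + b = (a - 1 + (b - 1)) + 2" using assms by auto
    then show ?thesis by (metis power_add power2_minus one_power2 mult_1_right)
  qed
  ultimately show ?thesis
    by (simp add: cofactor_def cofac_def minor_del_def det_sq_det)
qed

text \<open>These are the entries of the product of a matrix with its adjugate, with indices
  starting at 1. Both facts yield syzygies: the off-diagonal entries vanish, and the diagonal
  entries have a common value.\<close>

lemma row_rel:
  assumes "i \<in> {1..n}" "a \<in> {1..n}"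
  shows "(\<Sum>k\<in>{1..n}. M i k * cofac n M (a, k)) = (if i = a then det_sq n (\<lambda>i j. M (i + 1) (j + 1)) else 0)"
proof -
  let ?A = "mat n n (\<lambda>(i, j). M (i + 1) (j + 1))"
  have A: "?A \<in> carrier_mat n n" by simp
  have "(?A * adj_mat ?A) $$ (i - 1, a - 1) = (\<Sum>k = 0..<n. ?A $$ (i - 1, k) * cofactor ?A (a - 1) k)"
    using assms by (auto simp: times_mat_def scalar_prod_def adj_mat_def intro!: sum.cong)
  also have "\<dots> = (\<Sum>k\<in>{1..n}. M i k * cofac n M (a, k))"
    by (rule sum.reindex_bij_witness[of _ "\<lambda>k. k - 1" "\<lambda>k. k + 1"])
      (use assms cofac_cofactor[of a n "_ + 1" M] in \<open>auto\<close>)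
  finally show ?thesis using adj_mat(2)[OF A] assms eq_diff_iff[of 1 i a]
    by (auto simp: det_sq_det)
qed

lemma col_rel:
  assumes "j \<in> {1..n}" "b \<in> {1..n}"
  shows "(\<Sum>k\<in>{1..n}. M k j * cofac n M (k, b)) = (if j = b then det_sq n (\<lambda>i j. M (i + 1) (j + 1)) else 0)"
proof -
  let ?A = "mat n n (\<lambda>(i, j). M (i + 1) (j + 1))"
  have A: "?A \<in> carrier_mat n n" by simp
  have "(adj_mat ?A * ?A) $$ (b - 1, j - 1) = (\<Sum>k = 0..<n. ?A $$ (k, j - 1) * cofactor ?A k (b - 1))"
    using assms by (auto simp: times_mat_def scalar_prod_def adj_mat_def mult.commute intro!: sum.cong)
  also have "\<dots> = (\<Sum>k\<in>{1..n}. M k j * cofac n M (k, b))"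
    by (rule sum.reindex_bij_witness[of _ "\<lambda>k. k - 1" "\<lambda>k. k + 1"])
      (use assms cofac_cofactor[of "_ + 1" n b M] in \<open>auto\<close>)
  finally show ?thesis using adj_mat(3)[OF A] assms eq_diff_iff[of 1 j b]
    by (auto simp: det_sq_det)
qed

lemma matY_kill: "n > 1 \<Longrightarrow> matY n i j = kill (setW n) (X (i, j))"
  by (simp add: matY_def kill_X var_x_X)

lemma genX_X: "genX = (\<lambda>i j. X (i, j))"
  by (simp add: genX_def var_x_X fun_eq_iff)

lemma setW_iff: "v \<in> Vars n \<Longrightarrow> v \<in> setW n \<longleftrightarrow> v \<notin> setV n"
  by (auto simp: setW_def)

text \<open>A permutation contributes to the Leibniz sum only if its cells all lie in V, and these
  cells then form a matching for \<open>p\<close>. By uniqueness of the matching one permutation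
  survives, so the minor is a monomial up to its sign.\<close>

lemma minor_matY:
  assumes n: "n > 1" and p: "p \<in> Vars n"
  shows "\<exists>e. (e = 1 \<or> e = -1) \<and> minor_del n (matY n) (fst p) (snd p) = (of_int e * monom (sqm (Em n p)) :: 'a::field mpoly)"
proof -
  obtain a b where [simp]: "p = (a, b)" by (cases p)
  have ab: "a \<in> {1..n}" "b \<in> {1..n}" using p by (auto simp: Vars_def)
  define N where "N = n - 1"
  define rr where "rr k = skip a (k + 1)" for k
  define cc where "cc k = skip b (k + 1)" for k
  have rb: "bij_betw rr {0..<N} ({1..n} - {a})" and cb: "bij_betw cc {0..<N} ({1..n} - {b})"
    using skip_bij[OF ab(1)] skip_bij[OF ab(2)] by (simp_all add: rr_def[abs_def] cc_def[abs_def] N_def atLeast0LessThan)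
  define T where "T q = (\<lambda>i. (rr i, cc (q i))) ` {0..<N}" for q
  have inV: "(rr i, cc j) \<in> Vars n" if "i < N" "j < N" for i j
    using bij_betwE[OF rb] bij_betwE[OF cb] that by (auto simp: Vars_def)
  have injT: "inj_on (\<lambda>i. (rr i, cc (q i))) {0..<N}" for q
    using rb by (auto simp: bij_betw_def inj_on_def)
  have Tm: "matching n p (T q)" if q: "q permutes {0..<N}" and TV: "T q \<subseteq> setV n" for q
  proof -
    have f: "fst ` T q = {1..n} - {a}" using rb by (simp add: T_def image_image bij_betw_def)
    have "snd ` T q = cc ` (q ` {0..<N})" by (simp add: T_def image_image)
    then have s: "snd ` T q = {1..n} - {b}" using cb permutes_image[OF q] by (simp add: bij_betw_def)
    have "card (T q) = N" using card_image[OF injT[of q]] by (simp add: T_def)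
    moreover have "card (fst ` T q) = N" "card (snd ` T q) = N" using ab by (simp_all add: f s N_def)
    moreover have "finite (T q)" by (simp add: T_def)
    ultimately have "inj_on fst (T q)" "inj_on snd (T q)" by (auto intro: eq_card_imp_inj_on)
    then show ?thesis using f s TV by (simp add: matching_def indep_def)
  qed
  have tmq: "(\<Prod>i<N. matY n (rr i) (cc (q i))) = (if T q \<subseteq> setV n then monom (sqm (T q)) else 0 :: 'a mpoly)"
    if q: "q permutes {0..<N}" for q
  proof (cases "T q \<subseteq> setV n")
    case True
    have "(monom (sqm (T q)) :: 'a mpoly) = (\<Prod>v\<in>T q. X v)" by (rule monom_sqm) (simp add: T_def)
    also have "\<dots> = (\<Prod>i<N. X (rr i, cc (q i)))"
      unfolding T_def by (subst prod.reindex[OF injT]) (simp add: atLeast0LessThan)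
    also have "\<dots> = (\<Prod>i<N. matY n (rr i) (cc (q i)))"
    proof (rule prod.cong[OF refl])
      fix i assume "i \<in> {..<N}"
      then have "(rr i, cc (q i)) \<in> setV n" using True by (auto simp: T_def)
      then show "X (rr i, cc (q i)) = (matY n (rr i) (cc (q i)) :: 'a mpoly)"
        by (simp add: matY_def var_x_X setW_def)
    qed
    finally show ?thesis using True by simp
  next
    case False
    then obtain v where "v \<in> T q" "v \<notin> setV n" by blast
    then obtain i where i: "i < N" "(rr i, cc (q i)) \<notin> setV n" unfolding T_def by auto
    have "(rr i, cc (q i)) \<in> setW n"
      using i inV[of i "q i"] permutes_in_image[OF q, of i] by (auto simp: setW_def)
    then have "matY n (rr i) (cc (q i)) = (0 :: 'a mpoly)" by (simp add: matY_def)
    then have "(\<Prod>i<N. matY n (rr i) (cc (q i))) = (0 :: 'a mpoly)"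
      by (intro prod_zero bexI[of _ i]) (use i in auto)
    then show ?thesis using False by simp
  qed
  obtain q0 where q0: "q0 permutes {0..<N}" "T q0 \<subseteq> setV n"
  proof -
    let ?E = "Em n p"
    have E: "matching n p ?E" by (rule Em_matching[OF n p])
    have ex: "\<exists>l<N. (rr i, cc l) \<in> ?E" if "i < N" for i
    proof -
      have "rr i \<in> {1..n} - {a}" using bij_betwE[OF rb] that by simp
      then have "rr i \<in> fst ` ?E" using E by (simp add: matching_def)
      then obtain j where j: "(rr i, j) \<in> ?E" by auto
      then have "j \<in> snd ` ?E" by force
      then have "j \<in> {1..n} - {b}" using E by (simp add: matching_def)
      then have "j \<in> cc ` {0..<N}" using bij_betw_imp_surj_on[OF cb] by simp
      then show ?thesis using j by auto
    qed
    \<comment> \<open>The permutation is read off from the matching row by row; the identity outside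
      the index range is what \<open>permutes\<close> demands.\<close>
    define q where "q i = (if i < N then (SOME l. l < N \<and> (rr i, cc l) \<in> ?E) else i)" for i
    have q: "q i < N \<and> (rr i, cc (q i)) \<in> ?E" if "i < N" for i
      using someI_ex[OF ex[OF that]] that by (simp add: q_def)
    have "inj_on q {0..<N}"
    proof (rule inj_onI)
      fix i j assume ij: "i \<in> {0..<N}" "j \<in> {0..<N}" "q i = q j"
      have "(rr i, cc (q i)) \<in> ?E" "(rr j, cc (q i)) \<in> ?E" using q[of i] q[of j] ij by auto
      moreover have injE: "inj_on snd ?E" using E by (simp add: matching_def indep_def)
      ultimately have "(rr i, cc (q i)) = (rr j, cc (q i))" using inj_onD[OF injE] by (metis snd_conv)
      then show "i = j" using inj_onD[OF bij_betw_imp_inj_on[OF rb]] ij by simp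
    qed
    moreover have "q ` {0..<N} \<subseteq> {0..<N}" using q by auto
    ultimately have "bij_betw q {0..<N} {0..<N}" by (simp add: bij_betw_def endo_inj_surj)
    then have "q permutes {0..<N}" by (rule bij_imp_permutes) (simp add: q_def)
    moreover have "T q \<subseteq> setV n" using q E by (auto simp: T_def matching_def indep_def)
    ultimately show ?thesis by (rule that)
  qed
  have uniq: "q = q0" if q: "q permutes {0..<N}" "T q \<subseteq> setV n" for q
  proof
    fix i
    show "q i = q0 i"
    proof (cases "i < N")
      case True
      have "T q = T q0" using matching_unique[OF n p] Tm q q0 by blast
      moreover have "(rr i, cc (q i)) \<in> T q" using True by (auto simp: T_def)
      ultimately obtain j where j: "j < N" "rr i = rr j" "cc (q i) = cc (q0 j)" by (auto simp: T_def)
      then have "j = i" using inj_onD[OF bij_betw_imp_inj_on[OF rb], of i j] True by simp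
      then show ?thesis using j True permutes_in_image[OF q(1), of i] permutes_in_image[OF q0(1), of i]
          inj_onD[OF bij_betw_imp_inj_on[OF cb], of "q i" "q0 i"] by simp
    next
      case False
      then show ?thesis using q q0 by (simp add: permutes_def)
    qed
  qed
  have "minor_del n (matY n) a b = (\<Sum>q\<in>{q. q permutes {0..<N}}. of_int (sign q) * (\<Prod>i<N. matY n (rr i) (cc (q i))) :: 'a mpoly)"
    by (simp add: minor_del_def det_sq_def rr_def cc_def N_def)
  also have "\<dots> = (\<Sum>q\<in>{q. q permutes {0..<N}}. if q = q0 then of_int (sign q0) * monom (sqm (T q0)) else 0)"
  proof (rule sum.cong[OF refl])
    fix q assume "q \<in> {q. q permutes {0..<N}}"
    then have q: "q permutes {0..<N}" by simp
    show "of_int (sign q) * (\<Prod>i<N. matY n (rr i) (cc (q i))) = (if q = q0 then of_int (sign q0) * monom (sqm (T q0)) else 0 :: 'a mpoly)"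
    proof (cases "T q \<subseteq> setV n")
      case True
      then have "q = q0" by (rule uniq[OF q])
      then show ?thesis using tmq[OF q] True by simp
    next
      case False
      then have "q \<noteq> q0" using q0(2) by blast
      then show ?thesis using tmq[OF q] False by simp
    qed
  qed
  also have "\<dots> = of_int (sign q0) * monom (sqm (T q0))"
    using q0 by (subst sum.delta) (auto simp: finite_permutations)
  also have "T q0 = Em n p" by (rule matching_Em[OF n p Tm[OF q0]])
  finally have "minor_del n (matY n) (fst p) (snd p) = (of_int (sign q0) * monom (sqm (Em n p)) :: 'a mpoly)" by simp
  moreover have "sign q0 = 1 \<or> sign q0 = -1" by (simp add: sign_def)
  ultimately show ?thesis by blast
qed

section \<open>Lifting syzygies\<close>

abbreviation H :: "nat \<Rightarrow> var \<Rightarrow> ('a::field) mpoly" where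
  "H n \<equiv> cofac n genX"

lemma minor_PR:
  assumes "a \<in> {1..n}" "b \<in> {1..n}" "\<And>i j. (i, j) \<in> Vars n \<Longrightarrow> M i j \<in> PR A"
  shows "minor_del n M a b \<in> PR A"
  unfolding minor_del_def det_sq_def
proof (intro PR_sum PR_mult PR_of_int PR_prod assms(3))
  fix p i assume p: "p \<in> {p. p permutes {0..<n - 1}}" and i: "i \<in> {..<n - 1}"
  then have "p i < n - 1" using permutes_in_image[of p "{0..<n - 1}" i] by simp
  then show "(skip a (i + 1), skip b (p i + 1)) \<in> Vars n"
    using skip_in[OF assms(1), of i] skip_in[OF assms(2), of "p i"] i by (simp add: Vars_def)
qed

lemma homog_prod:
  "finite B \<Longrightarrow> (\<And>x. x \<in> B \<Longrightarrow> homog (f x) 1) \<Longrightarrow> homog (prod f B) (int (card B))"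
proof (induction B rule: finite_induct)
  case empty
  show ?case using homog_single[of 0 1] by simp
next
  case (insert x B)
  then show ?case using homog_mult[of "f x" 1 "prod f B" "int (card B)"] by simp
qed

lemma homog_of_int: "homog (of_int k :: ('a::field) mpoly) 0"
  using homog_single[of 0 "of_int k :: 'a"] by simp

lemma homog_minor: "(\<And>i j. homog (M i j) 1) \<Longrightarrow> homog (minor_del n M a b) (int (n - 1))"
  unfolding minor_del_def det_sq_def
proof (intro homog_sum)
  fix p assume M: "\<And>i j. homog (M i j) 1"
  show "homog (of_int (sign p) * (\<Prod>i<n - 1. M (skip a (i + 1)) (skip b (p i + 1)))) (int (n - 1))"
    using homog_mult[OF homog_of_int homog_prod[of "{..<n - 1}" "\<lambda>i. M (skip a (i + 1)) (skip b (p i + 1))"], of "sign p"] M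
    by simp
qed

lemma minus_one_pow: "((-1) ^ k :: ('a::field) mpoly) = sgl 0 ((-1) ^ k)"
  by (induction k) (simp_all add: single_uminus)

lemma H_PR: "p \<in> Vars n \<Longrightarrow> H n p \<in> PR (Vars n)"
  unfolding cofac_def genX_X minus_one_pow
  by (intro PR_mult PR_single minor_PR PR_X) (auto simp: Vars_def)

lemma homog_H: "homog (H n p) (int (n - 1))"
proof -
  have "homog (sgl 0 ((-1) ^ (fst p + snd p)) * minor_del n genX (fst p) (snd p)) (0 + int (n - 1))"
    by (intro homog_mult homog_minor) (use homog_single[of 0] homog_X in \<open>auto simp: genX_X\<close>)
  then show ?thesis by (simp add: cofac_def minus_one_pow)
qed

lemma kill_cofac: "kill U (cofac n M p) = cofac n (\<lambda>i j. kill U (M i j)) p"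
  by (simp add: cofac_def kill_mult kill_minor_del minus_one_pow) (simp add: kill_def flt_single)

lemma kill_genX: "n > 1 \<Longrightarrow> (\<lambda>i j. kill (setW n) (genX i j)) = (matY n :: nat \<Rightarrow> nat \<Rightarrow> ('a::field) mpoly)"
  by (simp add: genX_X matY_kill fun_eq_iff)

lemma kill_H_ex:
  assumes "n > 1" "p \<in> Vars n"
  shows "\<exists>e::'a::field. e * e = 1 \<and> kill (setW n) (H n p) = sgl (sqm (Em n p)) e"
proof -
  obtain e where e: "e = 1 \<or> e = -1" "minor_del n (matY n) (fst p) (snd p) = (of_int e * monom (sqm (Em n p)) :: 'a mpoly)"
    using minor_matY[OF assms] by blast
  have "kill (setW n) (H n p) = (sgl 0 ((-1) ^ (fst p + snd p)) * (sgl 0 (of_int e) * monom (sqm (Em n p))) :: 'a mpoly)"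
    unfolding kill_cofac kill_genX[OF assms(1)] unfolding cofac_def minus_one_pow by (simp add: e(2))
  then have "kill (setW n) (H n p) = (sgl (sqm (Em n p)) ((-1) ^ (fst p + snd p) * of_int e) :: 'a mpoly)"
    by (simp add: monom_def mult_single del: single_of_int)
  moreover have "(-1) ^ (fst p + snd p) * of_int e * ((-1) ^ (fst p + snd p) * of_int e) = (1::'a)"
    using e(1) by (auto simp flip: power_mult_distrib)
  ultimately show ?thesis by blast
qed

text \<open>The sign with which the signed minor specializes to its monomial. It is specified by its
  square because being its own inverse is what normalizing a generator requires.\<close>

definition eps :: "nat \<Rightarrow> var \<Rightarrow> 'a::field" where
  "eps n p = (SOME e. e * e = 1 \<and> kill (setW n) (H n p) = sgl (sqm (Em n p)) e)"

lemma eps: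
  assumes "n > 1" "p \<in> Vars n"
  shows "eps n p * eps n p = (1 :: 'a::field)" "kill (setW n) (H n p) = sgl (sqm (Em n p)) (eps n p :: 'a)"
  using someI_ex[OF kill_H_ex[OF assms, where 'a = 'a]] unfolding eps_def by blast+

text \<open>The generators are specialized while the coefficients may still involve variables of
  \<open>U\<close>. Values at indices outside \<open>Vars n\<close> are unconstrained, so syzygies
  are compared on \<open>Vars n\<close>.\<close>

definition Syz :: "nat \<Rightarrow> var set \<Rightarrow> (var \<Rightarrow> ('a::field) mpoly) set" where
  "Syz n U = {c. (\<forall>p\<in>Vars n. c p \<in> PR (Vars n)) \<and> (\<Sum>p\<in>Vars n. c p * kill U (H n p)) = 0}"

text \<open>The syzygies of the specialized minors that lift to syzygies of the minors of X.\<close>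
definition Lam :: "nat \<Rightarrow> (var \<Rightarrow> ('a::field) mpoly) set" where
  "Lam n = {c. \<exists>c'\<in>Syz n {}. \<forall>p\<in>Vars n. c p = kill (setW n) (c' p)}"

lemma kill_empty [simp]: "kill {} p = p"
  by (simp add: kill_def flt_id)

lemma Syz_0: "(\<lambda>_. 0) \<in> Syz n U" by (simp add: Syz_def)

lemma Syz_add: "c \<in> Syz n U \<Longrightarrow> d \<in> Syz n U \<Longrightarrow> (\<lambda>p. c p + d p) \<in> Syz n U"
  by (simp add: Syz_def PR_add distrib_right sum.distrib)

lemma Syz_smult: "c \<in> Syz n U \<Longrightarrow> q \<in> PR (Vars n) \<Longrightarrow> (\<lambda>p. q * c p) \<in> Syz n U"
  by (simp add: Syz_def PR_mult mult.assoc flip: sum_distrib_left)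

lemma Syz_diff: "c \<in> Syz n U \<Longrightarrow> d \<in> Syz n U \<Longrightarrow> (\<lambda>p. c p - d p) \<in> Syz n U"
  by (simp add: Syz_def PR_diff left_diff_distrib sum_subtractf)

lemma Syz_kill: "c \<in> Syz n {} \<Longrightarrow> (\<lambda>p. kill U (c p)) \<in> Syz n U"
proof -
  assume c: "c \<in> Syz n {}"
  have "(\<Sum>p\<in>Vars n. kill U (c p) * kill U (H n p)) = kill U (\<Sum>p\<in>Vars n. c p * H n p)"
    by (simp add: kill_sum kill_mult)
  then show ?thesis using c by (simp add: Syz_def kill_PR')
qed

lemma Syz_cong: "c \<in> Syz n U \<Longrightarrow> (\<And>p. p \<in> Vars n \<Longrightarrow> c p = d p) \<Longrightarrow> d \<in> Syz n U"
  by (simp add: Syz_def)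

lemma Lam_Syz: "c \<in> Lam n \<Longrightarrow> c \<in> Syz n (setW n)"
proof -
  assume "c \<in> Lam n"
  then obtain c' where c': "c' \<in> Syz n {}" "\<forall>p\<in>Vars n. c p = kill (setW n) (c' p)" by (auto simp: Lam_def)
  show ?thesis by (rule Syz_cong[OF Syz_kill[OF c'(1), of "setW n"]]) (use c'(2) in simp)
qed

lemma Lam_0: "(\<lambda>_. 0) \<in> Lam n"
  unfolding Lam_def by (rule CollectI, rule bexI[OF _ Syz_0]) simp

lemma Lam_cong: "c \<in> Lam n \<Longrightarrow> (\<And>p. p \<in> Vars n \<Longrightarrow> c p = d p) \<Longrightarrow> d \<in> Lam n"
  by (simp add: Lam_def)

lemma Lam_add: "c \<in> Lam n \<Longrightarrow> d \<in> Lam n \<Longrightarrow> (\<lambda>p. c p + d p) \<in> Lam n"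
proof -
  assume "c \<in> Lam n" "d \<in> Lam n"
  then obtain c' d' where "c' \<in> Syz n {}" "d' \<in> Syz n {}" "\<forall>p\<in>Vars n. c p = kill (setW n) (c' p)" "\<forall>p\<in>Vars n. d p = kill (setW n) (d' p)"
    unfolding Lam_def by blast
  then show ?thesis unfolding Lam_def
    by (intro CollectI bexI[OF _ Syz_add[of c' n "{}" d']]) (simp_all add: kill_add)
qed

lemma Lam_smult: "c \<in> Lam n \<Longrightarrow> q \<in> PR (Vars n - setW n) \<Longrightarrow> (\<lambda>p. q * c p) \<in> Lam n"
proof -
  assume c: "c \<in> Lam n" and q: "q \<in> PR (Vars n - setW n)"
  then obtain c' where "c' \<in> Syz n {}" "\<forall>p\<in>Vars n. c p = kill (setW n) (c' p)" unfolding Lam_def by blast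
  moreover have "kill (setW n) q = q" "q \<in> PR (Vars n)" using q kill_id[OF q] PR_mono[OF q] by auto
  ultimately show ?thesis unfolding Lam_def
    by (intro CollectI bexI[OF _ Syz_smult[of c' n "{}" q]]) (simp_all add: kill_mult)
qed

text \<open>Equality, modulo liftable syzygies, of the monomial multiples t and t' of the generators p and p'.\<close>
definition eqv :: "('a::field) itself \<Rightarrow> nat \<Rightarrow> mon \<Rightarrow> var \<Rightarrow> mon \<Rightarrow> var \<Rightarrow> bool" where
  "eqv _ n t p t' p' \<longleftrightarrow> (\<lambda>q. (if q = p then sgl t (eps n p) else 0) - (if q = p' then sgl t' (eps n p') else 0) :: 'a mpoly) \<in> Lam n"

lemma eqv_refl: "eqv T n t p t p"
  unfolding eqv_def by (simp add: Lam_0)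

lemma eqv_trans: "eqv T n t p t' p' \<Longrightarrow> eqv T n t' p' t'' p'' \<Longrightarrow> eqv T n t p t'' p''"
proof -
  assume a: "eqv T n t p t' p'" and b: "eqv T n t' p' t'' p''"
  show ?thesis unfolding eqv_def by (rule Lam_cong[OF Lam_add[OF a[unfolded eqv_def] b[unfolded eqv_def]]]) simp
qed

lemma eqv_sym: "eqv T n t p t' p' \<Longrightarrow> eqv T n t' p' t p"
proof -
  assume "eqv T n t p t' p'"
  from Lam_smult[OF this[unfolded eqv_def], of "-1"]
  have "(\<lambda>q. - 1 * ((if q = p then sgl t (eps n p) else 0) - (if q = p' then sgl t' (eps n p') else 0) :: 'a mpoly)) \<in> Lam n"
    by (simp add: PR_uminus)
  then show ?thesis unfolding eqv_def by (rule Lam_cong) simp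
qed

lemma eqv_mult:
  assumes "eqv (T :: 'a::field itself) n t p t' p'" "kys s \<subseteq> Vars n - setW n"
  shows "eqv T n (s + t) p (s + t') p'"
proof -
  have "(\<lambda>q. monom s * ((if q = p then sgl t (eps n p) else 0) - (if q = p' then sgl t' (eps n p') else 0) :: 'a mpoly)) \<in> Lam n"
    using Lam_smult[OF assms(1)[unfolded eqv_def]] PR_monom[OF assms(2)] by blast
  then show ?thesis unfolding eqv_def
    by (rule Lam_cong) (simp add: right_diff_distrib mult_single monom_def)
qed

text \<open>In a syzygy of monomials with two nonzero monomial coefficients the two terms must
  cancel, which forces their signs to be opposite. After rescaling, every such liftable syzygy
  therefore says that the two normalized multiples are equal, and the signs of the minors need no
  computation.\<close>

lemma eqv_two:
  assumes n: "n > 1" and p: "p \<in> Vars n" "p' \<in> Vars n" "p \<noteq> p'"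
    and c: "(c :: var \<Rightarrow> ('a::field) mpoly) \<in> Lam n" "c p = sgl t u" "c p' = sgl t' u'" "\<And>q. q \<in> Vars n \<Longrightarrow> q \<noteq> p \<Longrightarrow> q \<noteq> p' \<Longrightarrow> c q = 0"
    and u: "u * u = 1" "u' * u' = 1"
  shows "eqv (T :: 'a itself) n t p t' p'"
proof -
  let ?e = "eps n p :: 'a" and ?e' = "eps n p' :: 'a"
  have "(\<Sum>q\<in>Vars n. c q * kill (setW n) (H n q)) = 0"
    using Lam_Syz[OF c(1)] by (simp add: Syz_def)
  moreover have "(\<Sum>q\<in>Vars n. c q * kill (setW n) (H n q)) = (\<Sum>q\<in>{p, p'}. c q * kill (setW n) (H n q))"
    by (rule sum.mono_neutral_right) (use p c in auto)
  ultimately have z: "sgl (t + sqm (Em n p)) (u * ?e) + sgl (t' + sqm (Em n p')) (u' * ?e') = 0"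
    using p c eps(2)[OF n p(1), where 'a = 'a] eps(2)[OF n p(2), where 'a = 'a] by (simp add: mult_single)
  have e: "?e * ?e = 1" "?e' * ?e' = 1" using eps(1)[OF n p(1)] eps(1)[OF n p(2)] by simp_all
  have "lkp (sgl (t + sqm (Em n p)) (u * ?e) + sgl (t' + sqm (Em n p')) (u' * ?e')) (t + sqm (Em n p)) = 0"
    using z by simp
  then have "u * ?e + (if t' + sqm (Em n p') = t + sqm (Em n p) then u' * ?e' else 0) = 0"
    by (simp only: lookup_add lookup_single when_def) simp
  moreover have "u * ?e \<noteq> 0" using u e by auto
  ultimately have s: "u * ?e = - (u' * ?e')" by (auto simp: eq_neg_iff_add_eq_0 split: if_splits)
  have s2: "u' * (u * ?e) = - ?e'" unfolding s using u(2) by (simp add: mult.assoc[symmetric])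
  have "(\<lambda>q. sgl 0 (u * ?e) * c q) \<in> Lam n"
    by (rule Lam_smult[OF c(1)]) (simp add: PR_single)
  then show ?thesis unfolding eqv_def
  proof (rule Lam_cong)
    fix q assume q: "q \<in> Vars n"
    show "sgl 0 (u * ?e) * c q = (if q = p then sgl t ?e else 0) - (if q = p' then sgl t' ?e' else 0)"
      using p c(2,3) c(4)[OF q] u s2
      by (auto simp: mult_single mult_ac single_uminus) (metis mult.assoc mult.left_neutral)
  qed
qed

section \<open>Two-term syzygies from the adjugate relations\<close>

lemma sum_Vars: "(\<Sum>q\<in>Vars n. f q) = (\<Sum>a\<in>{1..n}. \<Sum>b\<in>{1..n}. f (a, b))"
  by (simp add: Vars_def sum.cartesian_product)

text \<open>Coefficients of the signed minors in the \<open>(i, a)\<close> entry of X times its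
  adjugate. In the same way \<open>cv\<close> takes column \<open>j\<close> of X against the
  cofactors of column \<open>b\<close>.\<close>

definition rv :: "nat \<Rightarrow> nat \<Rightarrow> var \<Rightarrow> ('a::field) mpoly" where
  "rv i a q = (if fst q = a then X (i, snd q) else 0)"
definition cv :: "nat \<Rightarrow> nat \<Rightarrow> var \<Rightarrow> ('a::field) mpoly" where
  "cv j b q = (if snd q = b then X (fst q, j) else 0)"

lemma row_sum:
  assumes "i \<in> {1..n}" "a \<in> {1..n}"
  shows "(\<Sum>q\<in>Vars n. rv i a q * H n q) = (if i = a then det_sq n (\<lambda>i j. genX (i + 1) (j + 1)) else 0 :: ('a::field) mpoly)"
proof -
  have "(\<Sum>q\<in>Vars n. rv i a q * H n q) = (\<Sum>a'\<in>{1..n}. if a' = a then (\<Sum>b\<in>{1..n}. genX i b * H n (a, b)) else 0 :: 'a mpoly)"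
    unfolding sum_Vars by (intro sum.cong refl) (auto simp: genX_X rv_def cv_def)
  also have "\<dots> = (\<Sum>b\<in>{1..n}. genX i b * H n (a, b))" using assms by (simp add: sum.delta)
  finally show ?thesis using row_rel[OF assms, of genX] by simp
qed

lemma col_sum:
  assumes "j \<in> {1..n}" "b \<in> {1..n}"
  shows "(\<Sum>q\<in>Vars n. cv j b q * H n q) = (if j = b then det_sq n (\<lambda>i j. genX (i + 1) (j + 1)) else 0 :: ('a::field) mpoly)"
proof -
  have "(\<Sum>q\<in>Vars n. cv j b q * H n q) = (\<Sum>a'\<in>{1..n}. \<Sum>b'\<in>{1..n}. if b' = b then genX a' j * H n (a', b) else 0 :: 'a mpoly)"
    unfolding sum_Vars by (intro sum.cong refl) (auto simp: genX_X rv_def cv_def)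
  also have "\<dots> = (\<Sum>a'\<in>{1..n}. genX a' j * H n (a', b))" using assms by (simp add: sum.delta)
  finally show ?thesis using col_rel[OF assms, of genX] by simp
qed

lemma rv_PR: "i \<in> {1..n} \<Longrightarrow> q \<in> Vars n \<Longrightarrow> rv i a q \<in> PR (Vars n)"
  by (auto simp: rv_def Vars_def intro!: PR_X)
lemma cv_PR: "j \<in> {1..n} \<Longrightarrow> q \<in> Vars n \<Longrightarrow> cv j b q \<in> PR (Vars n)"
  by (auto simp: cv_def Vars_def intro!: PR_X)

lemma rv_Syz: "i \<in> {1..n} \<Longrightarrow> a \<in> {1..n} \<Longrightarrow> i \<noteq> a \<Longrightarrow> rv i a \<in> Syz n {}"
  by (simp add: Syz_def row_sum rv_PR)

lemma cv_Syz: "j \<in> {1..n} \<Longrightarrow> b \<in> {1..n} \<Longrightarrow> j \<noteq> b \<Longrightarrow> cv j b \<in> Syz n {}"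
  by (simp add: Syz_def col_sum cv_PR)

lemma rv_cv_Syz: "i \<in> {1..n} \<Longrightarrow> j \<in> {1..n} \<Longrightarrow> (\<lambda>q. rv i i q - cv j j q) \<in> Syz n {}"
  by (simp add: Syz_def PR_diff left_diff_distrib sum_subtractf row_sum col_sum rv_PR cv_PR)

lemma kill_X_Vars:
  assumes "n > 1" "i \<in> {1..n}" "j \<in> {1..n}"
  shows "kill (setW n) (X (i, j)) = (if j = i \<or> j = nx n i then sgl (sgl (i, j) 1) 1 else 0)"
proof -
  have "(i, j) \<in> Vars n" using assms by (simp add: Vars_def)
  then have "(i, j) \<in> setW n \<longleftrightarrow> \<not> (j = i \<or> j = nx n i)"
    using assms(2) by (simp only: setW_iff setV_iff[OF assms(1)]) blast
  then show ?thesis unfolding kill_X by (simp only: X_def monom_def) presburger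
qed

lemma kill_rv:
  assumes "n > 1" "i \<in> {1..n}" "q \<in> Vars n"
  shows "kill (setW n) (rv i a q) = (if fst q = a \<and> (snd q = i \<or> snd q = nx n i) then sgl (sgl (i, snd q) 1) 1 else 0)"
proof -
  have "snd q \<in> {1..n}" using assms(3) by (auto simp: Vars_def)
  from kill_X_Vars[OF assms(1,2) this] show ?thesis by (cases "fst q = a") (simp_all add: rv_def)
qed

lemma kill_cv:
  assumes "n > 1" "i \<in> {1..n}" "q \<in> Vars n" "j = nx n i"
  shows "kill (setW n) (cv j b q) = (if snd q = b \<and> (fst q = j \<or> fst q = i) then sgl (sgl (fst q, j) 1) 1 else 0)"
proof -
  have k: "fst q \<in> {1..n}" using assms(3) by (auto simp: Vars_def)
  have j: "j \<in> {1..n}" using nx_in[OF assms(2)] assms(4) by simp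
  have "j = fst q \<or> j = nx n (fst q) \<longleftrightarrow> fst q = j \<or> fst q = i"
    using nx_inj[OF assms(2) k] assms(4) by metis
  with kill_X_Vars[OF assms(1) k j] show ?thesis by (cases "snd q = b") (simp_all add: cv_def)
qed

text \<open>Row \<open>i\<close> of Y has two nonzero entries, so the relation between row
  \<open>i\<close> and the cofactors of another row \<open>a\<close> specializes to two
  terms.\<close>

lemma eqv_row:
  assumes n: "n > 1" and i: "i \<in> {1..n}" "a \<in> {1..n}" "i \<noteq> a"
  shows "eqv (T :: 'a::field itself) n (sgl (i, i) 1) (a, i) (sgl (i, nx n i) 1) (a, nx n i)"
proof (rule eqv_two[OF n, where u = 1 and u' = 1])
  show V: "(a, i) \<in> Vars n" "(a, nx n i) \<in> Vars n" using i nx_in[OF i(1)] by (simp_all add: Vars_def)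
  show "(a, i) \<noteq> (a, nx n i)" using nx_neq[OF n, of i] by simp
  show "(\<lambda>q. kill (setW n) (rv i a q) :: 'a mpoly) \<in> Lam n"
    unfolding Lam_def by (intro CollectI bexI[OF _ rv_Syz[OF i]]) simp
  show "kill (setW n) (rv i a (a, i)) = (sgl (sgl (i, i) 1) 1 :: 'a mpoly)"
    by (simp add: kill_rv[OF n i(1) V(1)])
  show "kill (setW n) (rv i a (a, nx n i)) = (sgl (sgl (i, nx n i) 1) 1 :: 'a mpoly)"
    by (simp add: kill_rv[OF n i(1) V(2)])
  show "kill (setW n) (rv i a q) = (0 :: 'a mpoly)" if "q \<in> Vars n" "q \<noteq> (a, i)" "q \<noteq> (a, nx n i)" for q
  proof -
    have c: "\<not> (fst q = a \<and> (snd q = i \<or> snd q = nx n i))" using that(2,3) by (cases q) auto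
    show ?thesis by (simp only: kill_rv[OF n i(1) that(1)] c if_False)
  qed
qed simp_all

lemma eqv_col:
  assumes n: "n > 1" and i: "i \<in> {1..n}" "b \<in> {1..n}" "j = nx n i" "j \<noteq> b"
  shows "eqv (T :: 'a::field itself) n (sgl (j, j) 1) (j, b) (sgl (i, j) 1) (i, b)"
proof (rule eqv_two[OF n, where u = 1 and u' = 1])
  have j: "j \<in> {1..n}" "j \<noteq> i" using i(3) nx_in[OF i(1)] nx_neq[OF n, of i] by simp_all
  show V: "(j, b) \<in> Vars n" "(i, b) \<in> Vars n" using i(1,2) j by (simp_all add: Vars_def)
  show "(j, b) \<noteq> (i, b)" using j(2) by simp
  show "(\<lambda>q. kill (setW n) (cv j b q) :: 'a mpoly) \<in> Lam n"
    unfolding Lam_def by (intro CollectI bexI[OF _ cv_Syz[OF j(1) i(2,4)]]) simp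
  show "kill (setW n) (cv j b (j, b)) = (sgl (sgl (j, j) 1) 1 :: 'a mpoly)"
    by (simp add: kill_cv[OF n i(1) V(1) i(3)])
  show "kill (setW n) (cv j b (i, b)) = (sgl (sgl (i, j) 1) 1 :: 'a mpoly)"
    by (simp add: kill_cv[OF n i(1) V(2) i(3)])
  show "kill (setW n) (cv j b q) = (0 :: 'a mpoly)" if "q \<in> Vars n" "q \<noteq> (j, b)" "q \<noteq> (i, b)" for q
  proof -
    have c: "\<not> (snd q = b \<and> (fst q = j \<or> fst q = i))" using that(2,3) by (cases q) auto
    show ?thesis by (simp only: kill_cv[OF n i(1) that(1) i(3)] c if_False)
  qed
qed simp_all

text \<open>Expanding the determinant along row \<open>i\<close> and along column
  \<open>j = nx n i\<close> gives two surviving terms each. The term at \<open>(i, j)\<close> is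
  common and cancels in the difference, leaving two neighbouring diagonal entries.\<close>

lemma eqv_x:
  assumes n: "n > 1" and i: "i \<in> {1..n}" "j = nx n i"
  shows "eqv (T :: 'a::field itself) n (sgl (i, i) 1) (i, i) (sgl (j, j) 1) (j, j)"
proof (rule eqv_two[OF n, where u = 1 and u' = "-1"])
  have j: "j \<in> {1..n}" "j \<noteq> i" using i(2) nx_in[OF i(1)] nx_neq[OF n, of i] by simp_all
  show "(\<lambda>q. kill (setW n) (rv i i q - cv j j q) :: 'a mpoly) \<in> Lam n"
    unfolding Lam_def by (intro CollectI bexI[OF _ rv_cv_Syz[OF i(1) j(1)]]) simp
  show V: "(i, i) \<in> Vars n" "(j, j) \<in> Vars n" "(i, i) \<noteq> (j, j)" using i(1) j by (simp_all add: Vars_def)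
  show "kill (setW n) (rv i i (i, i) - cv j j (i, i)) = (sgl (sgl (i, i) 1) 1 :: 'a mpoly)"
    using j(2) by (simp add: kill_rv[OF n i(1) V(1)] kill_cv[OF n i(1) V(1) i(2)] kill_diff)
  show "kill (setW n) (rv i i (j, j) - cv j j (j, j)) = (sgl (sgl (j, j) 1) (-1) :: 'a mpoly)"
    using j(2) by (simp add: kill_rv[OF n i(1) V(2)] kill_cv[OF n i(1) V(2) i(2)] kill_diff single_uminus)
  show "kill (setW n) (rv i i q - cv j j q) = (0 :: 'a mpoly)" if q: "q \<in> Vars n" "q \<noteq> (i, i)" "q \<noteq> (j, j)" for q
  proof (cases "q = (i, j)")
    case True
    have q1: "(i, j) \<in> Vars n" using q(1) True by simp
    show ?thesis unfolding True
      by (simp add: kill_diff kill_rv[OF n i(1) q1] kill_cv[OF n i(1) q1 i(2)] i(2)[symmetric])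
  next
    case False
    then have c: "\<not> (fst q = i \<and> (snd q = i \<or> snd q = nx n i))" "\<not> (snd q = j \<and> (fst q = j \<or> fst q = i))"
      using q(2,3) unfolding i(2)[symmetric] by (cases q; auto)+
    show ?thesis by (simp only: kill_diff kill_rv[OF n i(1) q(1)] kill_cv[OF n i(1) q(1) i(2)] c if_False diff_zero)
  qed
qed simp_all

text \<open>Here row \<open>j\<close> and column \<open>j\<close> are compared: they share the
  diagonal entry \<open>(j, j)\<close>, so the difference relates two neighbouring off-diagonal
  entries.\<close>

lemma eqv_y:
  assumes n: "n > 1" and i: "i \<in> {1..n}" "j = nx n i"
  shows "eqv (T :: 'a::field itself) n (sgl (j, nx n j) 1) (j, nx n j) (sgl (i, j) 1) (i, j)"
proof (rule eqv_two[OF n, where u = 1 and u' = "-1"])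
  have j: "j \<in> {1..n}" "j \<noteq> i" using i(2) nx_in[OF i(1)] nx_neq[OF n, of i] by simp_all
  have nj: "nx n j \<noteq> j" "nx n j \<in> {1..n}" using nx_in[OF j(1)] nx_neq[OF n, of j] by simp_all
  show "(\<lambda>q. kill (setW n) (rv j j q - cv j j q) :: 'a mpoly) \<in> Lam n"
    unfolding Lam_def by (intro CollectI bexI[OF _ rv_cv_Syz[OF j(1) j(1)]]) simp
  show V: "(j, nx n j) \<in> Vars n" "(i, j) \<in> Vars n" "(j, nx n j) \<noteq> (i, j)" using i(1) j nj by (simp_all add: Vars_def)
  show "kill (setW n) (rv j j (j, nx n j) - cv j j (j, nx n j)) = (sgl (sgl (j, nx n j) 1) 1 :: 'a mpoly)"
    using nj(1) by (simp add: kill_rv[OF n j(1) V(1)] kill_cv[OF n i(1) V(1) i(2)] kill_diff)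
  show "kill (setW n) (rv j j (i, j) - cv j j (i, j)) = (sgl (sgl (i, j) 1) (-1) :: 'a mpoly)"
    using j(2) by (simp add: kill_rv[OF n j(1) V(2)] kill_cv[OF n i(1) V(2) i(2)] kill_diff single_uminus)
  show "kill (setW n) (rv j j q - cv j j q) = (0 :: 'a mpoly)" if q: "q \<in> Vars n" "q \<noteq> (j, nx n j)" "q \<noteq> (i, j)" for q
  proof (cases "q = (j, j)")
    case True
    have q1: "(j, j) \<in> Vars n" using q(1) True by simp
    show ?thesis unfolding True
      by (simp add: kill_diff kill_rv[OF n j(1) q1] kill_cv[OF n i(1) q1 i(2)])
  next
    case False
    then have c: "\<not> (fst q = j \<and> (snd q = j \<or> snd q = nx n j))" "\<not> (snd q = j \<and> (fst q = j \<or> fst q = i))"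
      using q(2,3) by (cases q; auto)+
    show ?thesis by (simp only: kill_diff kill_rv[OF n j(1) q(1)] kill_cv[OF n i(1) q(1) i(2)] c if_False diff_zero)
  qed
qed simp_all

lemma eqv_xx:
  assumes n: "n > 1" and i: "i \<in> {1..n}" "j \<in> {1..n}"
  shows "eqv (T :: 'a::field itself) n (sgl (i, i) 1) (i, i) (sgl (j, j) 1) (j, j)"
proof -
  have "{j \<in> {1..n}. eqv T n (sgl (i, i) 1) (i, i) (sgl (j, j) 1) (j, j)} = {1..n}"
  proof (rule nx_closed)
    show "{j \<in> {1..n}. eqv T n (sgl (i, i) 1) (i, i) (sgl (j, j) 1) (j, j)} \<noteq> {}"
      using i(1) eqv_refl[of T n "sgl (i, i) 1" "(i, i)"] by auto
  next
    fix k assume "k \<in> {j \<in> {1..n}. eqv T n (sgl (i, i) 1) (i, i) (sgl (j, j) 1) (j, j)}"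
    then have k: "k \<in> {1..n}" "eqv T n (sgl (i, i) 1) (i, i) (sgl (k, k) 1) (k, k)" by auto
    show "nx n k \<in> {j \<in> {1..n}. eqv T n (sgl (i, i) 1) (i, i) (sgl (j, j) 1) (j, j)}"
      using nx_in[OF k(1)] eqv_trans[OF k(2) eqv_x[OF n k(1) refl]] by simp
  qed auto
  then show ?thesis using i by blast
qed

lemma eqv_yy:
  assumes n: "n > 1" and i: "i \<in> {1..n}" "j \<in> {1..n}"
  shows "eqv (T :: 'a::field itself) n (sgl (i, nx n i) 1) (i, nx n i) (sgl (j, nx n j) 1) (j, nx n j)"
proof -
  have "{j \<in> {1..n}. eqv T n (sgl (i, nx n i) 1) (i, nx n i) (sgl (j, nx n j) 1) (j, nx n j)} = {1..n}"
  proof (rule nx_closed)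
    show "{j \<in> {1..n}. eqv T n (sgl (i, nx n i) 1) (i, nx n i) (sgl (j, nx n j) 1) (j, nx n j)} \<noteq> {}"
      using i(1) eqv_refl[of T n "sgl (i, nx n i) 1" "(i, nx n i)"] by auto
  next
    fix k assume "k \<in> {j \<in> {1..n}. eqv T n (sgl (i, nx n i) 1) (i, nx n i) (sgl (j, nx n j) 1) (j, nx n j)}"
    then have k: "k \<in> {1..n}" "eqv T n (sgl (i, nx n i) 1) (i, nx n i) (sgl (k, nx n k) 1) (k, nx n k)" by auto
    show "nx n k \<in> {j \<in> {1..n}. eqv T n (sgl (i, nx n i) 1) (i, nx n i) (sgl (j, nx n j) 1) (j, nx n j)}"
      using nx_in[OF k(1)] eqv_trans[OF k(2) eqv_sym[OF eqv_y[OF n k(1) refl]]] by simp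
  qed auto
  then show ?thesis using i by blast
qed

text \<open>If \<open>e\<close> and \<open>f\<close> share a row, a row relation applies, and a
  column relation if they share a column. Otherwise the omitted positions are \<open>f\<close> and
  \<open>e\<close> themselves, and adding \<open>f\<close> to the matching of \<open>p\<close> gives
  a full transversal of the cycle. Such a transversal is entirely diagonal or entirely off-diagonal,
  so \<open>eqv_xx\<close> or \<open>eqv_yy\<close> applies.\<close>

lemma eqv_exchange:
  assumes n: "n > 1" and p: "p \<in> Vars n" "p' \<in> Vars n"
    and S': "Em n p' = insert f (Em n p - {e})" and e: "e \<in> Em n p" and f: "f \<notin> Em n p"
  shows "eqv (T :: 'a::field itself) n (sgl f 1) p (sgl e 1) p'"
proof -
  define S where "S = Em n p"
  define S' where "S' = Em n p'"
  have ef: "e \<in> S" "f \<notin> S" "f \<in> S'" "e \<notin> S'" "S' = insert f (S - {e})" using S' e f by (auto simp: S_def S'_def)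
  have m: "matching n p S" "matching n p' S'" unfolding S_def S'_def using Em_matching[OF n] p by auto
  have inj: "inj_on fst S" "inj_on snd S" "inj_on fst S'" "inj_on snd S'" using m by (auto simp: matching_def indep_def)
  have im: "fst ` S = {1..n} - {fst p}" "snd ` S = {1..n} - {snd p}" "fst ` S' = {1..n} - {fst p'}" "snd ` S' = {1..n} - {snd p'}"
    using m by (auto simp: matching_def)
  have V: "e \<in> setV n" "f \<in> setV n" using m ef by (auto simp: matching_def indep_def)
  then have Vr: "e \<in> Vars n" "f \<in> Vars n" using setV_Vars[OF n] by auto
  \<comment> \<open>When \<open>e\<close> and \<open>f\<close> lie in different rows, the row of
    \<open>f\<close> cannot occur in \<open>S\<close>, since it would be used twice in
    \<open>S'\<close>; so it is the omitted row. The next three facts are the analogues for columns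
    and for \<open>e\<close>.\<close>
  have fstf: "fst f = fst p" if "fst e \<noteq> fst f"
  proof -
    have "fst f \<notin> fst ` S"
    proof
      assume "fst f \<in> fst ` S"
      then obtain g where g: "g \<in> S" "fst g = fst f" by auto
      then have "g \<in> S'" using that ef by auto
      then have "g = f" using inj_onD[OF inj(3) g(2)] ef(3) by simp
      then show False using g ef by auto
    qed
    then show ?thesis using Vr im by (cases f) (auto simp: Vars_def)
  qed
  have sndf: "snd f = snd p" if "snd e \<noteq> snd f"
  proof -
    have "snd f \<notin> snd ` S"
    proof
      assume "snd f \<in> snd ` S"
      then obtain g where g: "g \<in> S" "snd g = snd f" by auto
      then have "g \<in> S'" using that ef by auto
      then have "g = f" using inj_onD[OF inj(4) g(2)] ef(3) by simp
      then show False using g ef by auto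
    qed
    then show ?thesis using Vr im by (cases f) (auto simp: Vars_def)
  qed
  have fste: "fst e = fst p'" if "fst e \<noteq> fst f"
  proof -
    have "fst e \<notin> fst ` S'"
    proof
      assume "fst e \<in> fst ` S'"
      then obtain g where g: "g \<in> S'" "fst g = fst e" by auto
      then have "g \<in> S" using that ef by auto
      then have "g = e" using inj_onD[OF inj(1) g(2)] ef(1) by simp
      then show False using g ef by auto
    qed
    then show ?thesis using Vr im by (cases e) (auto simp: Vars_def)
  qed
  have snde: "snd e = snd p'" if "snd e \<noteq> snd f"
  proof -
    have "snd e \<notin> snd ` S'"
    proof
      assume "snd e \<in> snd ` S'"
      then obtain g where g: "g \<in> S'" "snd g = snd e" by auto
      then have "g \<in> S" using that ef by auto
      then have "g = e" using inj_onD[OF inj(2) g(2)] ef(1) by simp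
      then show False using g ef by auto
    qed
    then show ?thesis using Vr im by (cases e) (auto simp: Vars_def)
  qed
  have ne: "e \<noteq> f" using ef by auto
  have SS': "fst ` S' = insert (fst f) (fst ` (S - {e}))" "snd ` S' = insert (snd f) (snd ` (S - {e}))" using ef(5) by auto
  obtain i j k l where [simp]: "e = (i, j)" "f = (k, l)" by (cases e, cases f)
  have rng: "i \<in> {1..n}" "j \<in> {1..n}" "k \<in> {1..n}" "l \<in> {1..n}" using Vr by (auto simp: Vars_def)
  consider (row) "i = k" | (col) "i \<noteq> k" "j = l" | (none) "i \<noteq> k" "j \<noteq> l" by blast
  then show ?thesis
  proof cases
    case row
    then have jl: "j \<noteq> l" using ne by simp
    have "fst ` S = insert i (fst ` (S - {e}))" using ef(1) by force
    then have "fst ` S' = fst ` S" using SS'(1) row by simp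
    then have "{1..n} - {fst p'} = {1..n} - {fst p}" using im by simp
    moreover have "fst p \<in> {1..n}" "fst p' \<in> {1..n}" using p by (auto simp: Vars_def)
    ultimately have a: "fst p = fst p'" by blast
    have "i \<in> fst ` S" using ef(1) by force
    then have ia: "i \<noteq> fst p" using im by auto
    have pp: "p = (fst p, l)" "p' = (fst p, j)" using sndf snde jl a by (simp_all add: prod_eq_iff)
    have ap: "fst p \<in> {1..n}" using p by (auto simp: Vars_def)
    have "(j = i \<and> l = nx n i) \<or> (j = nx n i \<and> l = i)" using V row jl by (auto simp: setV_iff[OF n])
    then show ?thesis
    proof
      assume jl': "j = i \<and> l = nx n i"
      show ?thesis using eqv_sym[OF eqv_row[OF n rng(1) ap ia, of T]] pp jl' row by simp
    next
      assume jl': "j = nx n i \<and> l = i"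
      show ?thesis using eqv_row[OF n rng(1) ap ia, of T] pp jl' row by simp
    qed
  next
    case col
    have "snd ` S = insert j (snd ` (S - {e}))" using ef(1) by force
    then have "snd ` S' = snd ` S" using SS'(2) col by simp
    then have "{1..n} - {snd p'} = {1..n} - {snd p}" using im by simp
    moreover have "snd p \<in> {1..n}" "snd p' \<in> {1..n}" using p by (auto simp: Vars_def)
    ultimately have a: "snd p = snd p'" by blast
    have "j \<in> snd ` S" using ef(1) by force
    then have ja: "j \<noteq> snd p" using im by auto
    have pp: "p = (k, snd p)" "p' = (i, snd p)" using fstf fste col a by (simp_all add: prod_eq_iff)
    have ap: "snd p \<in> {1..n}" using p by (auto simp: Vars_def)
    have "(i = j \<and> nx n k = j) \<or> (k = j \<and> nx n i = j)"
      using V col nx_inj[of i n k] rng by (auto simp: setV_iff[OF n])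
    then show ?thesis
    proof
      assume h: "i = j \<and> nx n k = j"
      show ?thesis using eqv_sym[OF eqv_col[OF n rng(3) ap, of j T]] h ja pp col by simp
    next
      assume h: "k = j \<and> nx n i = j"
      show ?thesis using eqv_col[OF n rng(1) ap, of j T] h ja pp col by simp
    qed
  next
    case none
    have pf: "p = f" "p' = e" using fstf sndf fste snde none by (simp_all add: prod_eq_iff)
    \<comment> \<open>\<open>U\<close> uses every row and every column. Once it contains one
      diagonal entry, the next column can only be covered by the next diagonal entry, since the row
      before is already occupied.\<close>
    define U where "U = insert f S"
    have "fst f \<notin> fst ` S" using im(1) pf(1) by blast
    then have "fst f \<notin> fst ` (S - {f})" by blast
    then have fU: "inj_on fst U" unfolding U_def inj_on_insert using inj(1) by (rule conjI[rotated])
    have sU: "snd ` U = {1..n}" unfolding U_def using im(2) pf rng by auto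
    have UV: "U \<subseteq> setV n" using m(1) V by (auto simp: U_def matching_def indep_def)
    have eU: "e \<in> U" "f \<in> U" using ef by (auto simp: U_def)
    have diag: "(b, b) \<in> U" if ab: "(a, a) \<in> U" "b \<in> {1..n}" for a b
    proof -
      have "{a \<in> {1..n}. (a, a) \<in> U} = {1..n}"
      proof (rule nx_closed)
        have "(a, a) \<in> setV n" using ab(1) UV by blast
        then have "a \<in> {1..n}" using setV_iff[OF n] by blast
        then show "{a \<in> {1..n}. (a, a) \<in> U} \<noteq> {}" using ab(1) by blast
      next
        fix c assume "c \<in> {a \<in> {1..n}. (a, a) \<in> U}"
        then have c: "c \<in> {1..n}" "(c, c) \<in> U" by auto
        have "nx n c \<in> snd ` U" using sU nx_in[OF c(1)] by simp
        then obtain d where d: "(d, nx n c) \<in> U" by auto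
        then have "d \<in> {1..n}" "nx n c = d \<or> nx n c = nx n d" using UV by (auto simp: setV_iff[OF n])
        moreover have "d \<noteq> c" 
        proof
          assume "d = c"
          then have "(c, nx n c) = (c, c)" using inj_onD[OF fU _ d c(2)] by simp
          then show False using nx_neq[OF n] by simp
        qed
        ultimately have "nx n c = d" using nx_inj c(1) by metis
        then show "nx n c \<in> {a \<in> {1..n}. (a, a) \<in> U}" using d nx_in[OF c(1)] by simp
      qed auto
      then show ?thesis using ab(2) by blast
    qed
    have uniq: "y = z" if "(x, y) \<in> U" "(x, z) \<in> U" for x y z
      using inj_onD[OF fU _ that] by simp
    show ?thesis
    proof (cases "k = l")
      case True
      then have "(i, i) \<in> U" using diag[of k i] eU rng by simp
      then have "j = i" using uniq[of i i j] eU by simp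
      then show ?thesis using eqv_xx[OF n rng(3) rng(1), of T] pf True by simp
    next
      case False
      have "i \<noteq> j"
      proof
        assume "i = j"
        then have "(k, k) \<in> U" using diag[of i k] eU rng by simp
        then show False using uniq[of k k l] eU False by simp
      qed
      then have "l = nx n k" "j = nx n i" using V False by (auto simp: setV_iff[OF n])
      then show ?thesis using eqv_yy[OF n rng(3) rng(1), of T] pf by simp
    qed
  qed
qed

lemma Em_sub: "n > 1 \<Longrightarrow> p \<in> Vars n \<Longrightarrow> Em n p \<subseteq> setV n \<and> finite (Em n p)"
  using Em_indep[of n p] indep_finite[of n "Em n p"] by (auto simp: indep_def)

lemma V_diff_W: "n > 1 \<Longrightarrow> Vars n - setW n = setV n"
  using setV_Vars[of n] by (auto simp: setW_def)

lemma setW_Vars: "setW n \<subseteq> Vars n"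
  by (auto simp: setW_def)

lemma Em_inj:
  assumes n: "n > 1" and p: "p \<in> Vars n" "q \<in> Vars n" and eq: "Em n p = Em n q"
  shows "p = q"
proof -
  have "{1..n} - {fst p} = {1..n} - {fst q}" "{1..n} - {snd p} = {1..n} - {snd q}"
    using Em_matching[OF n p(1)] Em_matching[OF n p(2)] eq by (simp_all add: matching_def)
  moreover have "fst p \<in> {1..n}" "snd p \<in> {1..n}" "fst q \<in> {1..n}" "snd q \<in> {1..n}"
    using p by (auto simp: Vars_def)
  ultimately have "fst p = fst q" "snd p = snd q" by blast+
  then show ?thesis by (rule prod_eqI)
qed

lemma sqm_exchange:
  assumes "finite S" "e \<in> S" "f \<notin> S"
  shows "sqm (insert f (S - {e})) + sgl e 1 = sqm S + sgl f 1"
proof -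
  have "sqm S = sgl e 1 + sqm (S - {e})" unfolding sqm_def using assms by (simp add: sum.remove)
  moreover have "sqm (insert f (S - {e})) = sgl f 1 + sqm (S - {e})" unfolding sqm_def using assms by simp
  ultimately show ?thesis by (simp add: add_ac)
qed

text \<open>Induction on how much the two supports differ: an exchange replaces one entry of the
  first support by one of the second, and each exchange is a two-term relation multiplied by a
  monomial in V. So the exchange relations generate all pairwise syzygies.\<close>

lemma eqv_all:
  assumes n: "n > 1" and p: "p \<in> Vars n" "p' \<in> Vars n" and t: "kys t \<subseteq> setV n" 
    and eq: "sqm (Em n p) + t = sqm (Em n p') + t'"
  shows "eqv (T :: 'a::field itself) n t p t' p'"
  using p(1) t eq
proof (induction "card (Em n p' - Em n p)" arbitrary: p t rule: less_induct)
  case less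
  note p1 = less.prems(1)
  note S = Em_indep[OF n p1] and S' = Em_indep[OF n p(2)]
  have fin: "finite (Em n p)" "finite (Em n p')" using Em_sub[OF n] p1 p(2) by auto
  show ?case
  proof (cases "Em n p = Em n p'")
    case True
    then have "p = p'" using Em_inj[OF n p1 p(2)] by simp
    then show ?thesis using less.prems(3) eqv_refl by simp
  next
    case False
    obtain e f where ef: "e \<in> Em n p - Em n p'" "f \<in> Em n p' - Em n p" "indep n (insert f (Em n p - {e}))"
      using exchange[OF n] S S' False by metis
    have "card (insert f (Em n p - {e})) = n - 1"
      using ef fin S n by (simp add: card_insert_if)
    then obtain q where q: "q \<in> Vars n" "insert f (Em n p - {e}) = Em n q"
      using indep_matching[OF n ef(3)] by blast
    \<comment> \<open>The variable \<open>f\<close> divides the common monomial through the second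
      support but does not lie in the first, so it divides \<open>t\<close>.\<close>
    have "lkp (sqm (Em n p) + t) f \<ge> 1" using ef fin by (simp add: less.prems(3) lookup_add lookup_sqm)
    then have tf: "lkp t f \<ge> 1" using ef fin by (simp add: lookup_add lookup_sqm)
    define s where "s = t - sgl f 1"
    have t: "t = s + sgl f 1"
    proof (rule poly_mapping_eqI)
      fix v show "lkp t v = lkp (s + sgl f 1) v"
        using tf by (cases "v = f") (simp_all add: s_def lookup_add lookup_minus lookup_single_not_eq)
    qed
    have sV: "kys s \<subseteq> setV n" using less.prems(2) unfolding t keys_add_nat by simp
    have eV: "e \<in> setV n" using Em_sub[OF n p1] ef by auto
    have "eqv T n (sgl f 1) p (sgl e 1) q"
      by (rule eqv_exchange[OF n p1 q(1) q(2)[symmetric]]) (use ef in auto)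
    then have "eqv T n (s + sgl f 1) p (s + sgl e 1) q"
      by (rule eqv_mult) (use sV V_diff_W[OF n] in simp)
    moreover have "eqv T n (s + sgl e 1) q t' p'"
    proof (rule less.hyps[OF _ q(1)])
      have "Em n p' - Em n q = (Em n p' - Em n p) - {f}" using ef unfolding q(2)[symmetric] by blast
      then show "card (Em n p' - Em n q) < card (Em n p' - Em n p)"
        using ef(2) fin by (simp only:) (rule card_Diff1_less, auto)
      show "kys (s + sgl e 1) \<subseteq> setV n" using sV eV unfolding keys_add_nat by simp
      have "sqm (Em n q) + sgl e 1 = sqm (Em n p) + sgl f 1"
        unfolding q(2)[symmetric] by (rule sqm_exchange) (use ef fin in auto)
      then have "sqm (Em n q) + (s + sgl e 1) = sqm (Em n p) + t"
        by (simp add: t add_ac)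
      then show "sqm (Em n q) + (s + sgl e 1) = sqm (Em n p') + t'" using less.prems(3) by simp
    qed
    ultimately show ?thesis unfolding t by (rule eqv_trans)
  qed
qed

text \<open>Every syzygy of the monomials is, term by term, a combination of the pairwise ones.\<close>
lemma base_lift:
  assumes n: "n > 1"
  shows "(c :: var \<Rightarrow> ('a::field) mpoly) \<in> Syz n (setW n) \<Longrightarrow> (\<And>p. p \<in> Vars n \<Longrightarrow> c p \<in> PR (setV n)) \<Longrightarrow> c \<in> Lam n"
proof (induction "\<Sum>p\<in>Vars n. card (kys (c p))" arbitrary: c rule: less_induct)
  case less
  show ?case
  proof (cases "\<forall>p\<in>Vars n. c p = 0")
    case True
    then show ?thesis using Lam_cong[OF Lam_0] by metis
  next
    case False
    then obtain p where p: "p \<in> Vars n" "c p \<noteq> 0" by blast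
    then have "kys (c p) \<noteq> {}" by simp
    then obtain t where t: "t \<in> kys (c p)" by blast
    define K :: "var \<Rightarrow> 'a mpoly" where "K q = kill (setW n) (H n q)" for q
    have K: "K q = (sgl (sqm (Em n q)) (eps n q) :: 'a mpoly)" "eps n q * eps n q = (1::'a)" if "q \<in> Vars n" for q
      using eps[OF n that, where 'a = 'a] by (simp_all add: K_def)
    define mu where "mu = sqm (Em n p) + t"
    have cz: "(\<Sum>q\<in>Vars n. c q * K q) = 0" using less.prems(1) by (simp add: Syz_def K_def)
    have "(\<Sum>q\<in>Vars n. lkp (c q * K q) mu) = 0"
      unfolding lookup_sum[symmetric] cz by simp
    moreover have lp: "lkp (c p * K p) mu = lkp (c p) t * eps n p"
      unfolding mu_def K(1)[OF p(1)] by (simp add: mult.commute[of "c p"] lookup_single_mult)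
    moreover have "lkp (c p) t * eps n p \<noteq> 0" using t K(2)[OF p(1)] by (auto simp: in_keys_iff)
    \<comment> \<open>The contribution of the chosen term to the monomial \<open>mu\<close> is
      nonzero while the total is 0, so another generator contributes to \<open>mu\<close> as
      well.\<close>
    ultimately have "\<exists>q\<in>Vars n - {p}. lkp (c q * K q) mu \<noteq> 0"
      using p(1) by (metis (no_types, lifting) add.right_neutral finite_Vars sum.neutral sum.remove)
    then obtain q where q: "q \<in> Vars n" "q \<noteq> p" "lkp (c q * K q) mu \<noteq> 0" by blast
    then have "mu \<in> kys (sgl (sqm (Em n q)) (eps n q) * c q)"
      by (simp add: in_keys_iff K(1) mult.commute)
    then obtain t' where t': "t' \<in> kys (c q)" "mu = sqm (Em n q) + t'"
      using keys_single_mult by blast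
    have tV: "kys t \<subseteq> setV n" "kys t' \<subseteq> setV n" using less.prems(2) p(1) q(1) t t' by (auto simp: PR_def)
    have ev: "eqv TYPE('a) n t p t' q"
      by (rule eqv_all[OF n p(1) q(1) tV(1)]) (use t' in \<open>simp add: mu_def\<close>)
    \<comment> \<open>As \<open>eps n p\<close> squares to 1, this factor makes \<open>v p\<close>
      exactly the term of \<open>c p\<close> at \<open>t\<close>. Subtracting \<open>v\<close>
      deletes that term and can only alter an existing term of \<open>c q\<close>.\<close>
    define l where "l = lkp (c p) t * eps n p"
    define v where "v = (\<lambda>r. sgl 0 l * ((if r = p then sgl t (eps n p) else 0) - (if r = q then sgl t' (eps n q) else 0)) :: 'a mpoly)"
    have vL: "v \<in> Lam n" unfolding v_def
      by (rule Lam_smult[OF ev[unfolded eqv_def]]) (simp add: PR_single)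
    have vp: "v p = sgl t (lkp (c p) t)" using q(2) K(2)[OF p(1)] by (simp add: v_def mult_single l_def mult.assoc)
    have vq: "v q = - sgl t' (l * eps n q)" using q(2) by (simp add: v_def mult_single)
    have vo: "v r = 0" if "r \<noteq> p" "r \<noteq> q" for r using that by (simp add: v_def)
    define d where "d = (\<lambda>r. c r - v r)"
    have kp: "kys (d p) \<subseteq> kys (c p) - {t}"
      by (auto simp: d_def vp in_keys_iff lookup_minus lookup_single when_def split: if_splits)
    have kq: "kys (d q) \<subseteq> kys (c q)"
    proof -
      have "d q = c q + sgl t' (l * eps n q)" by (simp add: d_def vq)
      then have "kys (d q) \<subseteq> kys (c q) \<union> kys (sgl t' (l * eps n q))" using keys_add by metis
      then show ?thesis using t'(1) by (auto split: if_splits)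
    qed
    have ko: "kys (d r) \<subseteq> kys (c r)" for r
      using kp kq vo[of r] by (cases "r = p"; cases "r = q") (auto simp: d_def)
    have "d \<in> Lam n"
    proof (rule less.hyps)
      have le: "card (kys (d r)) \<le> card (kys (c r))" for r by (rule card_mono[OF finite_keys ko])
      have "card (kys (d p)) \<le> card (kys (c p) - {t})" using kp by (intro card_mono) auto
      also have "\<dots> < card (kys (c p))" using t by (intro card_Diff1_less) auto
      finally show "(\<Sum>r\<in>Vars n. card (kys (d r))) < (\<Sum>r\<in>Vars n. card (kys (c r)))"
        using p(1) le by (intro sum_strict_mono_ex1) auto
      show "d \<in> Syz n (setW n)" unfolding d_def by (rule Syz_diff[OF less.prems(1) Lam_Syz[OF vL]])
      show "d r \<in> PR (setV n)" if "r \<in> Vars n" for r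
        using less.prems(2)[OF that] ko[of r] by (auto simp: PR_def)
    qed
    then have "(\<lambda>r. d r + v r) \<in> Lam n" using vL by (rule Lam_add)
    then show ?thesis by (simp add: d_def)
  qed
qed

section \<open>Restoring the variables of W in a syzygy\<close>

lemma Syz_hc: "c \<in> Syz n U \<Longrightarrow> (\<lambda>p. hc D (c p)) \<in> Syz n U"
proof -
  assume c: "c \<in> Syz n U"
  have h: "homog (kill U (H n p)) (int (n - 1))" for p by (intro homog_kill homog_H)
  have "(\<Sum>p\<in>Vars n. hc D (c p) * kill U (H n p)) = (\<Sum>p\<in>Vars n. hc (D + int (n - 1)) (c p * kill U (H n p)))"
    by (rule sum.cong[OF refl]) (subst hc_mult_homog[OF h], simp)
  also have "\<dots> = hc (D + int (n - 1)) (\<Sum>p\<in>Vars n. c p * kill U (H n p))" by (simp add: hc_sum)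
  also have "\<dots> = 0" using c by (simp add: Syz_def)
  finally show ?thesis using c by (simp add: Syz_def hc_PR)
qed

text \<open>\<open>B\<close> is the set of restored variables, and it grows by one variable
  \<open>w\<close> at a time. Modulo \<open>w\<close> the syzygy lifts by induction; the difference
  to the lift is \<open>X w * q\<close> with \<open>q\<close> again a syzygy, one degree lower, so a
  second induction on the degree finishes. Degrees are written \<open>int D - 1\<close> so that the
  base case is degree -1, where everything is 0.\<close>

lemma lift_homog:
  assumes n: "n > 1" and B: "finite B" 
  shows "B \<subseteq> setW n \<Longrightarrow> (c :: var \<Rightarrow> ('a::field) mpoly) \<in> Syz n (setW n - B) \<Longrightarrow>
    (\<And>p. p \<in> Vars n \<Longrightarrow> c p \<in> PR (Vars n - (setW n - B)) \<and> homog (c p) (int D - 1)) \<Longrightarrow>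
    \<exists>c'\<in>Syz n {}. \<forall>p\<in>Vars n. c p = kill (setW n - B) (c' p)"
  using B
proof (induction B arbitrary: c D rule: finite_induct)
  case empty
  then have "c \<in> Lam n" by (intro base_lift[OF n]) (simp_all add: V_diff_W[OF n])
  then show ?case by (simp add: Lam_def)
next
  case (insert w B)
  define U where "U = setW n - insert w B"
  have wU: "w \<notin> U" "insert w U = setW n - B" "w \<in> Vars n" using insert.prems(1) insert.hyps(2) setW_Vars by (auto simp: U_def)
  have kk: "kill {w} (kill U p) = kill (setW n - B) p" for p :: "'a mpoly"
    by (simp add: kill_kill flip: wU(2))
  have "\<exists>c'\<in>Syz n {}. \<forall>p\<in>Vars n. c p = kill U (c' p)"
    if "c \<in> Syz n U" "\<And>p. p \<in> Vars n \<Longrightarrow> c p \<in> PR (Vars n - U) \<and> homog (c p) (int D - 1)" for c :: "var \<Rightarrow> 'a mpoly" and D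
    using that
  proof (induction D arbitrary: c)
    case 0
    then have "c p = kill U 0" if "p \<in> Vars n" for p using homog_neg[of "c p" "-1"] that by simp
    then show ?case using Syz_0[of n "{}"] by (intro bexI[of _ "\<lambda>_. 0"]) auto
  next
    case (Suc D)
    have ku: "kill U (c p) = c p" if "p \<in> Vars n" for p using kill_id[of "c p" "Vars n - U" U] Suc.prems(2)[OF that] by auto
    define a where "a = (\<lambda>p. kill {w} (c p))"
    have aS: "a \<in> Syz n (setW n - B)"
    proof -
      have "(\<Sum>p\<in>Vars n. a p * kill (setW n - B) (H n p)) = kill {w} (\<Sum>p\<in>Vars n. c p * kill U (H n p))"
        by (simp add: kill_sum kill_mult kk a_def)
      then show ?thesis using Suc.prems(1) by (simp add: Syz_def a_def kill_PR')
    qed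
    have aP: "a p \<in> PR (Vars n - (setW n - B)) \<and> homog (a p) (int (Suc D) - 1)" if "p \<in> Vars n" for p
    proof -
      have "Vars n - U - {w} = Vars n - (setW n - B)" using wU(2) by auto
      then show ?thesis using kill_PR[of "c p" "Vars n - U" "{w}"] Suc.prems(2)[OF that]
        by (simp add: a_def homog_kill)
    qed
    have "B \<subseteq> setW n" using insert.prems(1) by simp
    from insert.IH[OF this aS aP] obtain b where b: "b \<in> Syz n {}" "\<forall>p\<in>Vars n. a p = kill (setW n - B) (b p)"
      by blast
    \<comment> \<open>All signed minors have the same degree, so the component in degree
      \<open>int D\<close> of the lift is again a syzygy. It still lifts \<open>a\<close> and makes
      the difference homogeneous.\<close>
    define b' where "b' = (\<lambda>p. hc (int D) (b p))"
    have b'S: "b' \<in> Syz n {}" unfolding b'_def by (rule Syz_hc[OF b(1)])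
    have b'PR: "b' p \<in> PR (Vars n)" if "p \<in> Vars n" for p using b'S that by (simp add: Syz_def)
    have kb: "kill {w} (c p) = kill {w} (kill U (b' p))" if "p \<in> Vars n" for p
    proof -
      have "kill {w} (kill U (b' p)) = hc (int D) (a p)" using b(2) that by (simp add: kk b'_def flip: hc_kill)
      also have "\<dots> = a p" using Suc.prems(2)[OF that] by (intro hc_homog) (simp add: a_def homog_kill)
      finally show ?thesis by (simp add: a_def)
    qed
    define c1 where "c1 = (\<lambda>p. c p - kill U (b' p))"
    have c1S: "c1 \<in> Syz n U" unfolding c1_def by (rule Syz_diff[OF Suc.prems(1) Syz_kill[OF b'S]])
    define q where "q = (\<lambda>p. quo w (c1 p))"
    have c1q: "c1 p = X w * q p" if "p \<in> Vars n" for p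
      unfolding q_def by (rule kill_eq_0) (simp add: c1_def kill_diff kb[OF that])
    have c1PR: "c1 p \<in> PR (Vars n - U)" "homog (c1 p) (int D)" if "p \<in> Vars n" for p
      using Suc.prems(2)[OF that] kill_PR[OF b'PR[OF that], of U]
      by (auto simp: c1_def b'_def intro!: PR_diff homog_diff homog_kill homog_hc)
    have qPR: "q p \<in> PR (Vars n - U) \<and> homog (q p) (int D - 1)" if "p \<in> Vars n" for p
      using c1PR[OF that] by (simp add: q_def PR_quo homog_quo)
    have "X w * (\<Sum>p\<in>Vars n. q p * kill U (H n p)) = (\<Sum>p\<in>Vars n. c1 p * kill U (H n p))"
      unfolding sum_distrib_left by (rule sum.cong[OF refl]) (simp add: c1q mult.assoc)
    also have "\<dots> = 0" using c1S by (simp add: Syz_def)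
    finally have "(\<Sum>p\<in>Vars n. q p * kill U (H n p)) = 0" by (rule X_mult_0)
    then have qS: "q \<in> Syz n U" using qPR PR_mono[of _ "Vars n - U" "Vars n"] by (auto simp: Syz_def)
    obtain g where g: "g \<in> Syz n {}" "\<forall>p\<in>Vars n. q p = kill U (g p)"
      using Suc.IH[OF qS qPR] by blast
    have "(\<lambda>p. b' p + X w * g p) \<in> Syz n {}"
      by (intro Syz_add Syz_smult b'S g(1) PR_X wU(3))
    moreover have "c p = kill U (b' p + X w * g p)" if "p \<in> Vars n" for p
    proof -
      have "kill U (X w * g p) = X w * q p" using g(2) that wU(1) by (simp add: kill_mult kill_X)
      then show ?thesis using c1q[OF that] by (simp add: kill_add c1_def diff_eq_eq add.commute)
    qed
    ultimately show ?case by (intro bexI[of _ "\<lambda>p. b' p + X w * g p"]) auto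
  qed
  then show ?case using insert.prems unfolding U_def by blast
qed

lemma Syz_sum: "(\<And>d. d \<in> Ds \<Longrightarrow> f d \<in> Syz n U) \<Longrightarrow> (\<lambda>p. \<Sum>d\<in>Ds. f d p) \<in> Syz n U"
  by (induction Ds rule: infinite_finite_induct) (auto simp: Syz_0 Syz_add)

lemma lift_syz:
  assumes n: "n > 1" and U: "U \<subseteq> setW n" and c: "(c :: var \<Rightarrow> ('a::field) mpoly) \<in> Syz n U"
    "\<And>p. p \<in> Vars n \<Longrightarrow> c p \<in> PR (Vars n - U)"
  shows "\<exists>c'\<in>Syz n {}. \<forall>p\<in>Vars n. c p = kill U (c' p)"
proof -
  define Ds where "Ds = (\<Union>p\<in>Vars n. (\<lambda>m. mdeg m) ` kys (c p))"
  have fin: "finite Ds" by (simp add: Ds_def)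
  have BU: "setW n - (setW n - U) = U" using U by auto
  have finB: "finite (setW n - U)" using finite_subset[OF setW_Vars] by auto
  \<comment> \<open>The bound \<open>Suc d\<close> corresponds to degree \<open>d\<close> because of
    the shift in \<open>lift_homog\<close>.\<close>
  have "\<exists>c'\<in>Syz n {}. \<forall>p\<in>Vars n. hc (int d) (c p) = kill U (c' p)" for d
    using lift_homog[OF n finB Diff_subset, of "\<lambda>p. hc (int d) (c p)" "Suc d"] Syz_hc[OF c(1), of "int d"] c(2)
    unfolding BU by (simp add: hc_PR homog_hc)
  then obtain F where F: "\<And>d. F d \<in> Syz n {}" "\<And>d p. p \<in> Vars n \<Longrightarrow> hc (int d) (c p) = kill U (F d p)"
    by metis
  have "c p = kill U (\<Sum>d\<in>Ds. F d p)" if p: "p \<in> Vars n" for p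
  proof -
    have "c p = (\<Sum>e\<in>int ` Ds. hc e (c p))"
      by (rule hc_expand) (use fin p in \<open>auto simp: Ds_def\<close>)
    also have "\<dots> = (\<Sum>d\<in>Ds. hc (int d) (c p))" by (subst sum.reindex) (auto simp: inj_on_def)
    also have "\<dots> = (\<Sum>d\<in>Ds. kill U (F d p))" by (rule sum.cong) (use F p in auto)
    finally show ?thesis by (simp add: kill_sum)
  qed
  then show ?thesis using Syz_sum[of Ds F n "{}"] F(1) by (intro bexI[of _ "\<lambda>p. \<Sum>d\<in>Ds. F d p"]) auto
qed

text \<open>The ideal of the specialized minors in the polynomial ring without the variables in U.\<close>
definition IU :: "nat \<Rightarrow> var set \<Rightarrow> ('a::field) mpoly set" where
  "IU n U = {f. \<exists>c. (\<forall>p\<in>Vars n. c p \<in> PR (Vars n - U)) \<and> f = (\<Sum>p\<in>Vars n. c p * kill U (H n p))}"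

text \<open>Modulo \<open>w\<close>, an expression of \<open>X w * f\<close> in the generators
  becomes a syzygy. Its lift is a relation that can be subtracted, and then every coefficient is
  divisible by \<open>w\<close>; cancelling \<open>X w\<close> expresses \<open>f\<close>. This is
  where liftability of syzygies becomes regularity.\<close>

lemma IU_reg:
  assumes n: "n > 1" and U: "U \<subseteq> setW n" and w: "w \<in> setW n" "w \<notin> U" 
    and f: "X w * f \<in> IU n U"
  shows "(f :: ('a::field) mpoly) \<in> IU n U"
proof -
  obtain c where c: "\<And>p. p \<in> Vars n \<Longrightarrow> c p \<in> PR (Vars n - U)" "X w * f = (\<Sum>p\<in>Vars n. c p * kill U (H n p))"
    using f by (auto simp: IU_def)
  have kk: "kill {w} (kill U p) = kill (insert w U) p" for p :: "'a mpoly" by (simp add: kill_kill)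
  have UV: "Vars n - U - {w} = Vars n - insert w U" by auto
  define a where "a = (\<lambda>p. kill {w} (c p))"
  have aPR: "a p \<in> PR (Vars n - insert w U)" if "p \<in> Vars n" for p
    using kill_PR[OF c(1)[OF that], of "{w}"] by (simp add: a_def UV)
  have "(\<Sum>p\<in>Vars n. a p * kill (insert w U) (H n p)) = kill {w} (\<Sum>p\<in>Vars n. c p * kill U (H n p))"
    by (simp add: kill_sum kill_mult kk a_def)
  also have "\<dots> = 0" by (simp flip: c(2))
  finally have aS: "a \<in> Syz n (insert w U)"
    using aPR PR_mono[of _ "Vars n - insert w U" "Vars n"] by (auto simp: Syz_def)
  have "insert w U \<subseteq> setW n" using w U by auto
  then obtain b where b: "b \<in> Syz n {}" "\<forall>p\<in>Vars n. a p = kill (insert w U) (b p)"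
    using lift_syz[OF n _ aS aPR] by blast
  have bPR: "b p \<in> PR (Vars n)" if "p \<in> Vars n" for p using b(1) that by (simp add: Syz_def)
  define d where "d = (\<lambda>p. c p - kill U (b p))"
  have dq: "d p = X w * quo w (d p)" if "p \<in> Vars n" for p
    by (rule kill_eq_0) (use b(2) that in \<open>simp add: d_def kill_diff kk flip: a_def\<close>, simp add: a_def)
  have dPR: "d p \<in> PR (Vars n - U)" if "p \<in> Vars n" for p
    unfolding d_def by (intro PR_diff c(1) that kill_PR bPR)
  have "(\<Sum>p\<in>Vars n. kill U (b p) * kill U (H n p)) = 0" using Syz_kill[OF b(1), of U] by (simp add: Syz_def)
  then have "X w * f = (\<Sum>p\<in>Vars n. d p * kill U (H n p))"
    by (simp add: c(2) d_def left_diff_distrib sum_subtractf)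
  also have "\<dots> = X w * (\<Sum>p\<in>Vars n. quo w (d p) * kill U (H n p))"
    unfolding sum_distrib_left by (rule sum.cong[OF refl]) (subst dq, auto simp: mult.assoc)
  finally have "f = (\<Sum>p\<in>Vars n. quo w (d p) * kill U (H n p))" by (rule X_mult_cancel)
  moreover have "\<forall>p\<in>Vars n. quo w (d p) \<in> PR (Vars n - U)" using dPR by (intro ballI PR_quo)
  ultimately show ?thesis unfolding IU_def
    by (intro CollectI exI[of _ "\<lambda>p. quo w (d p)"] conjI)
qed

section \<open>Ideals\<close>

definition ideal_in :: "nat \<Rightarrow> ('a::field) mpoly set \<Rightarrow> bool" where
  "ideal_in n K \<longleftrightarrow> 0 \<in> K \<and> (\<forall>f\<in>K. \<forall>g\<in>K. f + g \<in> K) \<and> (\<forall>p\<in>PRing n. \<forall>f\<in>K. p * f \<in> K)"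

lemma ideal_in_sum: "ideal_in n K \<Longrightarrow> (\<And>x. x \<in> B \<Longrightarrow> f x \<in> K) \<Longrightarrow> sum f B \<in> K"
  by (induction B rule: infinite_finite_induct) (auto simp: ideal_in_def)

lemma ideal_gen_least: "ideal_in n K \<Longrightarrow> G \<subseteq> K \<Longrightarrow> ideal_gen n G \<subseteq> K"
proof
  fix f assume K: "ideal_in n K" "G \<subseteq> K" and "f \<in> ideal_gen n G"
  then obtain F c where F: "finite F" "F \<subseteq> G" "\<forall>g\<in>F. c g \<in> PRing n" "f = (\<Sum>g\<in>F. c g * g)"
    unfolding ideal_gen_def by blast
  show "f \<in> K" unfolding F(4)
    by (rule ideal_in_sum[OF K(1)]) (use K F in \<open>auto simp: ideal_in_def\<close>)
qed

lemma ideal_gen_ideal: "ideal_in n (ideal_gen n (G :: ('a::field) mpoly set))"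
  unfolding ideal_in_def
proof (intro conjI ballI)
  show "0 \<in> ideal_gen n G" unfolding ideal_gen_def
    by (intro CollectI exI[of _ "{}"] exI[of _ "\<lambda>_. 0"]) simp
next
  fix f g assume "f \<in> ideal_gen n G" "g \<in> ideal_gen n G"
  then obtain F c F' c' where F: "finite F" "F \<subseteq> G" "\<forall>g\<in>F. c g \<in> PRing n" "f = (\<Sum>g\<in>F. c g * g)"
    and F': "finite F'" "F' \<subseteq> G" "\<forall>g\<in>F'. c' g \<in> PRing n" "g = (\<Sum>g\<in>F'. c' g * g)"
    unfolding ideal_gen_def by blast
  define d where "d = (\<lambda>g. (if g \<in> F then c g else 0) + (if g \<in> F' then c' g else 0))"
  have 1: "(\<Sum>g\<in>F. c g * g) = (\<Sum>g\<in>F \<union> F'. (if g \<in> F then c g else 0) * g)"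
    by (rule sum.mono_neutral_cong_left) (use F F' in auto)
  have 2: "(\<Sum>g\<in>F'. c' g * g) = (\<Sum>g\<in>F \<union> F'. (if g \<in> F' then c' g else 0) * g)"
    by (rule sum.mono_neutral_cong_left) (use F F' in auto)
  have "f + g = (\<Sum>g\<in>F \<union> F'. d g * g)"
    unfolding F(4) F'(4) 1 2 d_def by (simp only: sum.distrib[symmetric] distrib_right)
  moreover have "\<forall>g\<in>F \<union> F'. d g \<in> PRing n"
    using F(3) F'(3) by (auto simp: d_def PRing_PR intro!: PR_add)
  moreover have "finite (F \<union> F')" "F \<union> F' \<subseteq> G" using F F' by auto
  ultimately show "f + g \<in> ideal_gen n G" unfolding ideal_gen_def
    by (intro CollectI exI[of _ "F \<union> F'"] exI[of _ d] conjI)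
next
  fix p f :: "'a mpoly" assume p: "p \<in> PRing n" and "f \<in> ideal_gen n G"
  then obtain F c where F: "finite F" "F \<subseteq> G" "\<forall>g\<in>F. c g \<in> PRing n" "f = (\<Sum>g\<in>F. c g * g)"
    unfolding ideal_gen_def by blast
  have "p * f = (\<Sum>g\<in>F. (p * c g) * g)" by (simp add: F(4) sum_distrib_left mult.assoc)
  moreover have "\<forall>g\<in>F. p * c g \<in> PRing n" using F(3) p by (auto simp: PRing_PR intro: PR_mult)
  ultimately show "p * f \<in> ideal_gen n G" unfolding ideal_gen_def using F(1,2)
    by (intro CollectI exI[of _ F] exI[of _ "\<lambda>g. p * c g"] conjI)
qed

lemma ideal_gen_base: "g \<in> G \<Longrightarrow> g \<in> ideal_gen n G"
  unfolding ideal_gen_def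
  by (intro CollectI exI[of _ "{g}"] exI[of _ "\<lambda>_. 1"]) (simp add: PRing_PR)

lemma ideal_gen_mult: "p \<in> PRing n \<Longrightarrow> f \<in> ideal_gen n G \<Longrightarrow> p * f \<in> ideal_gen n G"
  using ideal_gen_ideal[of n G] by (simp add: ideal_in_def)

lemma ideal_gen_add: "f \<in> ideal_gen n G \<Longrightarrow> g \<in> ideal_gen n G \<Longrightarrow> f + g \<in> ideal_gen n G"
  using ideal_gen_ideal[of n G] by (simp add: ideal_in_def)

lemma IU_ideal: "ideal_in n (IU n {})"
  unfolding ideal_in_def IU_def
proof (intro conjI ballI CollectI)
  show "\<exists>c. (\<forall>p\<in>Vars n. c p \<in> PR (Vars n - {})) \<and> 0 = (\<Sum>p\<in>Vars n. c p * kill {} (H n p))"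
    by (intro exI[of _ "\<lambda>_. 0"]) simp
next
  fix f g :: "'a mpoly" assume "f \<in> {f. \<exists>c. (\<forall>p\<in>Vars n. c p \<in> PR (Vars n - {})) \<and> f = (\<Sum>p\<in>Vars n. c p * kill {} (H n p))}"
   "g \<in> {f. \<exists>c. (\<forall>p\<in>Vars n. c p \<in> PR (Vars n - {})) \<and> f = (\<Sum>p\<in>Vars n. c p * kill {} (H n p))}"
  then obtain c d where "\<forall>p\<in>Vars n. c p \<in> PR (Vars n - {})" "f = (\<Sum>p\<in>Vars n. c p * kill {} (H n p))"
     "\<forall>p\<in>Vars n. d p \<in> PR (Vars n - {})" "g = (\<Sum>p\<in>Vars n. d p * kill {} (H n p))" by blast
  then show "\<exists>c. (\<forall>p\<in>Vars n. c p \<in> PR (Vars n - {})) \<and> f + g = (\<Sum>p\<in>Vars n. c p * kill {} (H n p))"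
    by (intro exI[of _ "\<lambda>p. c p + d p"]) (simp add: PR_add distrib_right sum.distrib)
next
  fix q f :: "'a mpoly" assume q: "q \<in> PRing n" and "f \<in> {f. \<exists>c. (\<forall>p\<in>Vars n. c p \<in> PR (Vars n - {})) \<and> f = (\<Sum>p\<in>Vars n. c p * kill {} (H n p))}"
  then obtain c where "\<forall>p\<in>Vars n. c p \<in> PR (Vars n - {})" "f = (\<Sum>p\<in>Vars n. c p * kill {} (H n p))" by blast
  then show "\<exists>c. (\<forall>p\<in>Vars n. c p \<in> PR (Vars n - {})) \<and> q * f = (\<Sum>p\<in>Vars n. c p * kill {} (H n p))"
    using q by (intro exI[of _ "\<lambda>p. q * c p"]) (simp add: PR_mult PRing_PR sum_distrib_left mult.assoc)
qed

lemma sum_single_coeff: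
  fixes h :: "var \<Rightarrow> 'a::comm_ring_1"
  shows "finite B \<Longrightarrow> p \<in> B \<Longrightarrow> (\<Sum>q\<in>B. (if q = p then c else 0) * h q) = c * h p"
proof -
  assume B: "finite B" "p \<in> B"
  have "(\<Sum>q\<in>B. (if q = p then c else 0) * h q) = (\<Sum>q\<in>B. if q = p then c * h p else 0)"
    by (rule sum.cong) auto
  then show ?thesis using B by simp
qed

lemma H_IU: "p \<in> Vars n \<Longrightarrow> kill U (H n p) \<in> IU n U"
  unfolding IU_def
  by (intro CollectI exI[of _ "\<lambda>q. if q = p then 1 else 0"]) (simp add: sum_single_coeff)

lemma minor_H: "minor_del n genX a b = (-1) ^ (a + b) * H n (a, b)"
proof -
  have "(-1) ^ (a + b) * ((-1) ^ (a + b) * minor_del n genX a b) = minor_del n genX a b"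
    by (simp add: mult.assoc[symmetric] flip: power_add mult_2)
  then show ?thesis by (simp add: cofac_def)
qed

lemma minus_one_PR: "(-1) ^ k \<in> PR A"
  unfolding minus_one_pow by (rule PR_single) simp

lemma minor_maxminors: "p \<in> Vars n \<Longrightarrow> minor_del n M (fst p) (snd p) \<in> maxminors n M"
  unfolding maxminors_def by (intro CollectI exI[of _ "fst p"] exI[of _ "snd p"]) (auto simp: Vars_def)

lemma IU_0: "0 \<in> IU n U"
  unfolding IU_def by (intro CollectI exI[of _ "\<lambda>_. 0"]) simp

lemma ideal_X: "ideal_gen n (maxminors n genX) = (IU n {} :: ('a::field) mpoly set)"
proof
  show "ideal_gen n (maxminors n genX) \<subseteq> (IU n {} :: 'a mpoly set)"
  proof (rule ideal_gen_least[OF IU_ideal], rule subsetI)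
    fix g :: "'a mpoly" assume "g \<in> maxminors n genX"
    then obtain a b where ab: "a \<in> {1..n}" "b \<in> {1..n}" "g = minor_del n genX a b" by (auto simp: maxminors_def)
    then have "(a, b) \<in> Vars n" by (simp add: Vars_def)
    from H_IU[OF this, of "{}"] have "H n (a, b) \<in> (IU n {} :: 'a mpoly set)" by simp
    then show "g \<in> IU n {}" unfolding ab(3) minor_H
      using IU_ideal minus_one_PR[of "a + b" "Vars n"] unfolding ideal_in_def PRing_PR by blast
  qed
  show "(IU n {} :: 'a mpoly set) \<subseteq> ideal_gen n (maxminors n genX)"
  proof
    fix f :: "'a mpoly" assume "f \<in> IU n {}"
    then obtain c where c: "\<forall>p\<in>Vars n. c p \<in> PR (Vars n)" "f = (\<Sum>p\<in>Vars n. c p * H n p)" by (auto simp: IU_def)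
    show "f \<in> ideal_gen n (maxminors n genX)" unfolding c(2)
    proof (rule ideal_in_sum[OF ideal_gen_ideal])
      fix p assume p: "p \<in> Vars n"
      then have m: "minor_del n genX (fst p) (snd p) \<in> (maxminors n genX :: 'a mpoly set)" by (rule minor_maxminors)
      have "c p * (-1) ^ (fst p + snd p) \<in> PRing n"
        unfolding PRing_PR by (intro PR_mult minus_one_PR) (use c(1) p in simp)
      from ideal_gen_mult[OF this ideal_gen_base[OF m]]
      show "c p * H n p \<in> ideal_gen n (maxminors n genX)"
        by (simp add: cofac_def mult.assoc)
    qed
  qed
qed

section \<open>The monomial ideal of the specialized minors\<close>

definition inJ :: "nat \<Rightarrow> mon \<Rightarrow> bool" where
  "inJ n m \<longleftrightarrow> (\<exists>p\<in>Vars n. mdvd (sqm (Em n p)) m)"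

text \<open>The ideal is described through its terms rather than its generators, so that leading
  monomials can be tested for membership one by one.\<close>

definition JJ :: "nat \<Rightarrow> ('a::field) mpoly set" where
  "JJ n = {f \<in> PR (Vars n). \<forall>m\<in>kys f. inJ n m}"

lemma mdvd_add: "mdvd a m \<Longrightarrow> mdvd a (t + m)"
  by (auto simp: mdvd_def) (metis add.left_commute)

lemma inJ_add: "inJ n m \<Longrightarrow> inJ n (t + m)"
  unfolding inJ_def using mdvd_add by blast

lemma JJ_ideal: "ideal_in n (JJ n :: ('a::field) mpoly set)"
  unfolding ideal_in_def
proof (intro conjI ballI)
  show "0 \<in> (JJ n :: 'a mpoly set)" by (simp add: JJ_def)
next
  fix f g :: "'a mpoly" assume "f \<in> JJ n" "g \<in> JJ n"
  then show "f + g \<in> JJ n" using keys_add[of f g] by (auto simp: JJ_def PR_add)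
next
  fix p f :: "'a mpoly" assume p: "p \<in> PRing n" "f \<in> JJ n"
  have "inJ n m" if m: "m \<in> kys (p * f)" for m
  proof -
    obtain a b where "a \<in> kys p" "b \<in> kys f" "m = a + b" using m keys_mult[of p f] by blast
    then show ?thesis using p(2) inJ_add by (auto simp: JJ_def)
  qed
  then show "p * f \<in> JJ n" using p by (auto simp: JJ_def PRing_PR PR_mult)
qed

lemma sqm_in_JJ: "n > 1 \<Longrightarrow> p \<in> Vars n \<Longrightarrow> sgl (sqm (Em n p)) c \<in> JJ n"
proof -
  assume n: "n > 1" and p: "p \<in> Vars n"
  have "kys (sqm (Em n p)) \<subseteq> Vars n" using Em_sub[OF n p] setV_Vars[OF n] by (simp add: keys_sqm) blast
  moreover have "inJ n (sqm (Em n p))" unfolding inJ_def mdvd_def using p by (intro bexI[of _ p] exI[of _ 0]) simp_all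
  ultimately show ?thesis by (simp add: JJ_def PR_single)
qed

lemma JJ_least:
  assumes n: "n > 1" and K: "ideal_in n K" and g: "\<And>p. p \<in> Vars n \<Longrightarrow> monom (sqm (Em n p)) \<in> (K :: ('a::field) mpoly set)"
  shows "JJ n \<subseteq> K"
proof
  fix f :: "'a mpoly" assume f: "f \<in> JJ n"
  have "sgl m (lkp f m) \<in> K" if m: "m \<in> kys f" for m
  proof -
    obtain p t where p: "p \<in> Vars n" "m = sqm (Em n p) + t" using f m by (auto simp: JJ_def inJ_def mdvd_def)
    have "kys m \<subseteq> Vars n" using f m by (auto simp: JJ_def PR_def)
    then have "sgl t (lkp f m) \<in> PRing n" unfolding PRing_PR p(2) keys_add_nat by (intro PR_single) simp
    then have "sgl t (lkp f m) * monom (sqm (Em n p)) \<in> K" using K g[OF p(1)] by (simp add: ideal_in_def)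
    then show ?thesis by (simp add: monom_def mult_single p(2) add.commute)
  qed
  then have "(\<Sum>m\<in>kys f. sgl m (lkp f m)) \<in> K" by (rule ideal_in_sum[OF K])
  then show "f \<in> K" using poly_expand[of f] by simp
qed

lemma ideal_Y:
  assumes n: "n > 1"
  shows "ideal_gen n (maxminors n (matY n)) = (JJ n :: ('a::field) mpoly set)"
proof
  have e: "\<exists>e::'a. e * e = 1 \<and> minor_del n (matY n) (fst p) (snd p) = sgl (sqm (Em n p)) e" if p: "p \<in> Vars n" for p
  proof -
    obtain e :: int where e: "e = 1 \<or> e = -1" "minor_del n (matY n) (fst p) (snd p) = (of_int e * monom (sqm (Em n p)) :: 'a mpoly)"
      using minor_matY[OF n p, where 'a = 'a] by blast
    have "of_int e * monom (sqm (Em n p)) = (sgl (sqm (Em n p)) (of_int e) :: 'a mpoly)"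
      using e(1) by (auto simp: monom_def single_uminus)
    moreover have "of_int e * of_int e = (1 :: 'a)" using e(1) by auto
    ultimately show ?thesis using e(2) by (intro exI[of _ "of_int e"]) simp
  qed
  show "ideal_gen n (maxminors n (matY n)) \<subseteq> (JJ n :: 'a mpoly set)"
  proof (rule ideal_gen_least[OF JJ_ideal], rule subsetI)
    fix g :: "'a mpoly" assume "g \<in> maxminors n (matY n)"
    then obtain a b where ab: "a \<in> {1..n}" "b \<in> {1..n}" "g = minor_del n (matY n) a b" by (auto simp: maxminors_def)
    then have p: "(a, b) \<in> Vars n" by (simp add: Vars_def)
    from e[OF p] ab(3) show "g \<in> JJ n" using sqm_in_JJ[OF n p] by auto
  qed
  show "JJ n \<subseteq> ideal_gen n (maxminors n (matY n :: nat \<Rightarrow> nat \<Rightarrow> 'a mpoly))"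
  proof (rule JJ_least[OF n ideal_gen_ideal])
    fix p assume p: "p \<in> Vars n"
    obtain e :: 'a where ee: "e * e = 1" "minor_del n (matY n) (fst p) (snd p) = sgl (sqm (Em n p)) e" using e[OF p] by blast
    have "minor_del n (matY n) (fst p) (snd p) \<in> (maxminors n (matY n) :: 'a mpoly set)" by (rule minor_maxminors[OF p])
    then have "sgl 0 e * minor_del n (matY n) (fst p) (snd p) \<in> ideal_gen n (maxminors n (matY n :: nat \<Rightarrow> nat \<Rightarrow> 'a mpoly))"
      by (intro ideal_gen_mult ideal_gen_base) (simp_all add: PRing_PR PR_single)
    then show "monom (sqm (Em n p)) \<in> ideal_gen n (maxminors n (matY n :: nat \<Rightarrow> nat \<Rightarrow> 'a mpoly))"
      by (simp add: ee mult_single monom_def)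
  qed
qed

lemma JJ_squarefree:
  assumes n: "n > 1"
  shows "squarefree_monomial_ideal n (JJ n :: ('a::field) mpoly set)"
  unfolding squarefree_monomial_ideal_def
proof (intro exI conjI)
  let ?G = "(\<lambda>p. sqm (Em n p)) ` Vars n"
  show "\<forall>m\<in>?G. kys m \<subseteq> Vars n \<and> (\<forall>v. lkp m v \<le> 1)"
  proof
    fix m assume "m \<in> ?G"
    then obtain p where p: "p \<in> Vars n" "m = sqm (Em n p)" by blast
    have "finite (Em n p)" "Em n p \<subseteq> Vars n" using Em_sub[OF n p(1)] setV_Vars[OF n] by auto
    then show "kys m \<subseteq> Vars n \<and> (\<forall>v. lkp m v \<le> 1)" unfolding p(2) by (simp add: keys_sqm lookup_sqm)
  qed
  show "JJ n = ideal_gen n (monom ` ?G :: 'a mpoly set)"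
  proof
    show "JJ n \<subseteq> ideal_gen n (monom ` ?G :: 'a mpoly set)"
      by (rule JJ_least[OF n ideal_gen_ideal]) (intro ideal_gen_base imageI)
    show "ideal_gen n (monom ` ?G) \<subseteq> (JJ n :: 'a mpoly set)"
      by (rule ideal_gen_least[OF JJ_ideal]) (use sqm_in_JJ[OF n] in \<open>auto simp: monom_def\<close>)
  qed
qed

lemma IU_W_inJ:
  assumes n: "n > 1" and f: "(f :: ('a::field) mpoly) \<in> IU n (setW n)" and m: "m \<in> kys f"
  shows "inJ n m"
proof -
  obtain c where c: "f = (\<Sum>p\<in>Vars n. c p * kill (setW n) (H n p))" using f by (auto simp: IU_def)
  have "m \<in> (\<Union>p\<in>Vars n. kys (c p * kill (setW n) (H n p)))"
  proof (rule ccontr)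
    assume "\<not> ?thesis"
    then have "\<And>p. p \<in> Vars n \<Longrightarrow> lkp (c p * kill (setW n) (H n p)) m = 0" by (simp add: in_keys_iff)
    then have "lkp f m = 0" unfolding c lookup_sum by (rule sum.neutral[OF ballI])
    then show False using m by (simp add: in_keys_iff)
  qed
  then obtain p where p: "p \<in> Vars n" "m \<in> kys (c p * kill (setW n) (H n p))" by blast
  then have "m \<in> kys (sgl (sqm (Em n p)) (eps n p) * c p)" by (simp add: eps(2)[OF n p(1)] mult.commute)
  then obtain t where "m = sqm (Em n p) + t" using keys_single_mult by blast
  then show ?thesis using p(1) unfolding inJ_def mdvd_def by blast
qed

section \<open>The reverse lexicographic order\<close>

definition is_lead :: "nat \<Rightarrow> (var \<Rightarrow> nat) \<Rightarrow> ('a::field) mpoly \<Rightarrow> mon \<Rightarrow> bool" where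
  "is_lead n rnk f m \<longleftrightarrow> m \<in> kys f \<and> (\<forall>m'\<in>kys f. m' \<noteq> m \<longrightarrow> revlex_gt n rnk m m')"

lemma revlex_asym:
  assumes "inj_on rnk (Vars n)" "revlex_gt n rnk m m'" "revlex_gt n rnk m' m"
  shows False
proof -
  have d: "mdeg m = mdeg m'" using assms(2,3) by (auto simp: revlex_gt_def)
  obtain v where v: "v \<in> Vars n" "lkp m v < lkp m' v" "\<And>u. u \<in> Vars n \<Longrightarrow> rnk u < rnk v \<Longrightarrow> lkp m u = lkp m' u"
    using assms(2) d by (auto simp: revlex_gt_def)
  obtain w where w: "w \<in> Vars n" "lkp m' w < lkp m w" "\<And>u. u \<in> Vars n \<Longrightarrow> rnk u < rnk w \<Longrightarrow> lkp m' u = lkp m u"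
    using assms(3) d by (auto simp: revlex_gt_def)
  consider "rnk v < rnk w" | "rnk w < rnk v" | "v = w" using assms(1) v(1) w(1) by (metis inj_onD linorder_cases)
  then show False
  proof cases
    case 1
    then show ?thesis using w(3)[OF v(1)] v(2) by simp
  next
    case 2
    then show ?thesis using v(3)[OF w(1)] w(2) by simp
  next
    case 3
    then show ?thesis using v w by simp
  qed
qed

lemma revlex_total:
  assumes "kys m \<subseteq> Vars n" "kys m' \<subseteq> Vars n" "m \<noteq> m'"
  shows "revlex_gt n rnk m m' \<or> revlex_gt n rnk m' m"
proof (cases "mdeg m = mdeg m'")
  case True
  have "\<exists>v. lkp m v \<noteq> lkp m' v"
  proof (rule ccontr)
    assume "\<not> ?thesis"
    then have "m = m'" by (intro poly_mapping_eqI) blast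
    then show False using assms(3) by simp
  qed
  then obtain v0 where v0: "lkp m v0 \<noteq> lkp m' v0" ..
  define D where "D = {v \<in> Vars n. lkp m v \<noteq> lkp m' v}"
  have "v0 \<in> kys m \<union> kys m'" using v0 by (auto simp: in_keys_iff)
  then have "v0 \<in> D" using v0 assms(1,2) by (auto simp: D_def)
  then obtain v where v: "v \<in> D" "\<And>u. u \<in> D \<Longrightarrow> rnk v \<le> rnk u"
    using ex_has_least_nat[of "\<lambda>v. v \<in> D" v0 rnk] by blast
  have eq: "lkp m u = lkp m' u" if "u \<in> Vars n" "rnk u < rnk v" for u
    using v(2)[of u] that by (force simp: D_def)
  have "v \<in> Vars n" "lkp m v < lkp m' v \<or> lkp m' v < lkp m v" using v(1) by (auto simp: D_def)
  then show ?thesis using True eq unfolding revlex_gt_def by metis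
qed (auto simp: revlex_gt_def)

lemma revlex_trans:
  assumes "inj_on rnk (Vars n)" "revlex_gt n rnk a b" "revlex_gt n rnk b c"
  shows "revlex_gt n rnk a c"
proof (cases "mdeg a = mdeg b \<and> mdeg b = mdeg c")
  case True
  obtain v where v: "v \<in> Vars n" "lkp a v < lkp b v" "\<And>u. u \<in> Vars n \<Longrightarrow> rnk u < rnk v \<Longrightarrow> lkp a u = lkp b u"
    using assms(2) True by (auto simp: revlex_gt_def)
  obtain w where w: "w \<in> Vars n" "lkp b w < lkp c w" "\<And>u. u \<in> Vars n \<Longrightarrow> rnk u < rnk w \<Longrightarrow> lkp b u = lkp c u"
    using assms(3) True by (auto simp: revlex_gt_def)
  consider "rnk v < rnk w" | "rnk w < rnk v" | "v = w" using assms(1) v(1) w(1) by (metis inj_onD linorder_cases)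
  then have "\<exists>v\<in>Vars n. lkp a v < lkp c v \<and> (\<forall>u\<in>Vars n. rnk u < rnk v \<longrightarrow> lkp a u = lkp c u)"
  proof cases
    case 1
    then show ?thesis using v w by (intro bexI[of _ v]) auto
  next
    case 2
    then show ?thesis using v w by (intro bexI[of _ w]) auto
  next
    case 3
    then show ?thesis using v w by (intro bexI[of _ v]) auto
  qed
  then show ?thesis using True by (simp add: revlex_gt_def)
next
  case False
  have "mdeg b \<le> mdeg a" "mdeg c \<le> mdeg b" using assms(2,3) by (auto simp: revlex_gt_def)
  then show ?thesis using False by (auto simp: revlex_gt_def)
qed

lemma revlex_add:
  "revlex_gt n rnk m m' \<Longrightarrow> revlex_gt n rnk (t + m) (t + m')"
  by (simp add: revlex_gt_def mdeg_add lookup_add)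

lemma lead_unique:
  "inj_on rnk (Vars n) \<Longrightarrow> is_lead n rnk f m \<Longrightarrow> is_lead n rnk f m' \<Longrightarrow> m = m'"
  unfolding is_lead_def using revlex_asym by metis

lemma lead_exists:
  assumes rnk: "inj_on rnk (Vars n)" and f: "f \<in> PR (Vars n)" "f \<noteq> 0"
  shows "is_lead n rnk f (lead_mon n rnk f)"
proof -
  have "\<exists>m\<in>S. \<forall>m'\<in>S. m' \<noteq> m \<longrightarrow> revlex_gt n rnk m m'" if "finite S" "S \<noteq> {}" "\<And>m. m \<in> S \<Longrightarrow> kys m \<subseteq> Vars n" for S
    using that
  proof (induction S rule: finite_ne_induct)
    case (insert x S)
    then obtain m where m: "m \<in> S" "\<And>m'. m' \<in> S \<Longrightarrow> m' \<noteq> m \<Longrightarrow> revlex_gt n rnk m m'" by blast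
    have "x \<noteq> m" using insert m by auto
    then consider "revlex_gt n rnk m x" | "revlex_gt n rnk x m" using revlex_total[of x n m rnk] insert.prems m(1) by blast
    then show ?case
    proof cases
      case 1
      then show ?thesis using m by (intro bexI[of _ m]) auto
    next
      case 2
      have "revlex_gt n rnk x m'" if "m' \<in> insert x S" "m' \<noteq> x" for m'
        using that 2 m(2)[of m'] revlex_trans[OF rnk 2, of m'] by (cases "m' = m") auto
      then show ?thesis by blast
    qed
  qed auto
  from this[of "kys f"] have "\<exists>m. is_lead n rnk f m" using f unfolding is_lead_def PR_def by auto
  then have ex: "\<exists>!m. is_lead n rnk f m" using lead_unique[OF rnk] by blast
  have "lead_mon n rnk f = (THE m. is_lead n rnk f m)" by (simp add: lead_mon_def is_lead_def)
  then show ?thesis using theI'[OF ex] by simp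
qed

lemma IU_PR: "f \<in> IU n U \<Longrightarrow> (f :: ('a::field) mpoly) \<in> PR (Vars n - U)"
  unfolding IU_def by (auto intro!: PR_sum PR_mult kill_PR H_PR)

lemma IU_hc: "f \<in> IU n U \<Longrightarrow> hc D f \<in> (IU n U :: ('a::field) mpoly set)"
proof -
  assume "f \<in> IU n U"
  then obtain c where c: "\<forall>p\<in>Vars n. c p \<in> PR (Vars n - U)" "f = (\<Sum>p\<in>Vars n. c p * kill U (H n p))" by (auto simp: IU_def)
  have h: "homog (kill U (H n p)) (int (n - 1))" for p :: var by (intro homog_kill homog_H)
  have "hc D f = (\<Sum>p\<in>Vars n. hc (D - int (n - 1)) (c p) * kill U (H n p))"
    unfolding c(2) hc_sum by (rule sum.cong[OF refl]) (rule hc_mult_homog[OF h])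
  then show ?thesis unfolding IU_def using c(1)
    by (intro CollectI exI[of _ "\<lambda>p. hc (D - int (n - 1)) (c p)"]) (simp add: hc_PR)
qed

lemma IU_kill: "f \<in> IU n U \<Longrightarrow> kill {w} f \<in> (IU n (insert w U) :: ('a::field) mpoly set)"
proof -
  assume "f \<in> IU n U"
  then obtain c where c: "\<forall>p\<in>Vars n. c p \<in> PR (Vars n - U)" "f = (\<Sum>p\<in>Vars n. c p * kill U (H n p))" by (auto simp: IU_def)
  have kk: "kill {w} (kill U p) = kill (insert w U) p" for p :: "'a mpoly" by (simp add: kill_kill)
  have "kill {w} f = (\<Sum>p\<in>Vars n. kill {w} (c p) * kill (insert w U) (H n p))"
    by (simp add: c(2) kill_sum kill_mult kk)
  moreover have "\<forall>p\<in>Vars n. kill {w} (c p) \<in> PR (Vars n - insert w U)"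
    using c(1) kill_PR[of _ "Vars n - U" "{w}"] by (metis Diff_insert2 Diff_insert)
  ultimately show ?thesis unfolding IU_def by (intro CollectI exI[of _ "\<lambda>p. kill {w} (c p)"] conjI)
qed

text \<open>Since W comes last in the order, a monomial without smaller variables beats those with them.\<close>
lemma revlex_smallest:
  assumes VW: "\<forall>v\<in>setV n. \<forall>w\<in>setW n. rnk v > (rnk w :: nat)"
    and deg: "mdeg m = mdeg m'" and w: "w \<in> setW n" "lkp m w < lkp m' w"
    and small: "\<And>u. u \<in> setW n \<Longrightarrow> rnk u < rnk w \<Longrightarrow> lkp m u = lkp m' u"
  shows "revlex_gt n rnk m m'"
proof -
  have "lkp m u = lkp m' u" if "u \<in> Vars n" "rnk u < rnk w" for u
  proof (cases "u \<in> setW n")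
    case False
    then have "u \<in> setV n" using that(1) by (simp add: setW_def)
    then show ?thesis using VW w(1) that(2) by (meson less_asym)
  qed (use small that in auto)
  moreover have "w \<in> Vars n" using w(1) by (simp add: setW_def)
  ultimately show ?thesis using deg w(2) unfolding revlex_gt_def by blast
qed

text \<open>The killed set \<open>U\<close> is an initial segment of W by rank, and \<open>w\<close>
  is the next variable. If \<open>w\<close> divides \<open>f\<close>, the quotient stays in the
  ideal by \<open>IU_reg\<close> and has smaller degree. If not, \<open>f\<close> and its reduction
  modulo \<open>w\<close> have the same leading monomial, and fewer variables remain. This is the
  division property of reverse lexicographic orders by their last variable.\<close>

lemma lead_IU_homog:
  assumes n: "n > 1" and rnk: "inj_on rnk (Vars n)" and VW: "\<forall>v\<in>setV n. \<forall>w\<in>setW n. rnk v > rnk w"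
  shows "U \<subseteq> setW n \<Longrightarrow> (\<And>u w. u \<in> U \<Longrightarrow> w \<in> setW n - U \<Longrightarrow> rnk u < rnk w) \<Longrightarrow>
    (f :: ('a::field) mpoly) \<in> IU n U \<Longrightarrow> f \<noteq> 0 \<Longrightarrow> homog f (int D) \<Longrightarrow> is_lead n rnk f m \<Longrightarrow> inJ n m"
proof (induction "card (setW n - U)" arbitrary: U f D m)
  case 0
  have "finite (setW n - U)" using finite_subset[OF setW_Vars] by auto
  then have "U = setW n" using 0 by auto
  then show ?case using IU_W_inJ[OF n, of f m] 0 by (simp add: is_lead_def)
next
  case (Suc k)
  have fin: "finite (setW n - U)" using finite_subset[OF setW_Vars] by auto
  have "setW n - U \<noteq> {}" using Suc.hyps(2) by (metis card.empty nat.distinct(1))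
  then obtain w0 where "w0 \<in> setW n - U" by blast
  then obtain w where w: "w \<in> setW n - U" "\<And>u. u \<in> setW n - U \<Longrightarrow> rnk w \<le> rnk u"
    using ex_has_least_nat[of "\<lambda>v. v \<in> setW n - U" w0 rnk] by blast
  have card: "k = card (setW n - insert w U)"
  proof -
    have "setW n - insert w U = (setW n - U) - {w}" by auto
    then show ?thesis using Suc.hyps(2) w(1) fin by (simp add: card_Diff_singleton)
  qed
  have init: "rnk u < rnk v" if "u \<in> insert w U" "v \<in> setW n - insert w U" for u v
  proof (cases "u = w")
    case True
    have "rnk w \<noteq> rnk v" using rnk w(1) that(2) setW_Vars by (auto dest: inj_onD)
    then show ?thesis using w(2)[of v] that(2) True by auto
  qed (use Suc.prems(2) that in auto)
  have sub: "insert w U \<subseteq> setW n" using w(1) Suc.prems(1) by auto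
  note outer_U = Suc.prems(1)
  have outer_IH: "inJ n m" if "f \<in> IU n (insert w U)" "f \<noteq> 0" "homog f (int D)" "is_lead n rnk f m" for f :: "'a mpoly" and D m
    by (rule Suc.hyps(1)[OF card sub _ that]) (rule init)
  have "is_lead n rnk f m \<Longrightarrow> f \<in> IU n U \<Longrightarrow> f \<noteq> 0 \<Longrightarrow> homog f (int D) \<Longrightarrow> inJ n m" for f :: "'a mpoly" and D m
  proof (induction D arbitrary: f m)
    case (0 f m)
    show ?case
    proof (cases "kill {w} f = 0")
      case True
      then have "f = X w * quo w f" by (rule kill_eq_0)
      moreover have "quo w f = 0" using homog_neg[OF homog_quo[OF 0(4)], of w] by simp
      ultimately show ?thesis using 0(3) by simp
    next
      case False
      obtain mm where mm: "mm \<in> kys (kill {w} f)" using False by (metis ex_in_conv keys_eq_empty)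
      then have "mm \<in> kys f" by (simp add: kill_def keys_flt)
      have z: "x = 0" if "x \<in> kys f" for x using 0(4) that by (simp add: homog_def mdeg_eq_0_iff)
      have "kys f = {0}" using z \<open>mm \<in> kys f\<close> by auto
      then have kf: "kys (kill {w} f) = {0}" using mm z by (auto simp: kill_def keys_flt)
      have "m = 0" using 0(1) z by (simp add: is_lead_def)
      then have "is_lead n rnk (kill {w} f) m" by (simp add: is_lead_def kf)
      from outer_IH[OF IU_kill[OF 0(2)] False homog_kill[OF 0(4)] this] show ?thesis .
    qed
  next
    case (Suc D f m)
    show ?case
    proof (cases "kill {w} f = 0")
      case True
      then have fq: "f = X w * quo w f" by (rule kill_eq_0)
      define g where "g = quo w f"
      have fg: "f = X w * g" using fq by (simp add: g_def)
      have gI: "g \<in> IU n U"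
        by (rule IU_reg[OF n outer_U, of w]) (use w(1) Suc.prems(2) fg in auto)
      have g0: "g \<noteq> 0" using Suc.prems(3) fg by auto
      have gh: "homog g (int D)" using homog_quo[OF Suc.prems(4), of w] by (simp add: g_def)
      have gP: "g \<in> PR (Vars n)" using PR_mono[OF IU_PR[OF gI]] by auto
      let ?l = "lead_mon n rnk g"
      have l: "is_lead n rnk g ?l" by (rule lead_exists[OF rnk gP g0])
      have "is_lead n rnk f (sgl w 1 + ?l)"
        unfolding is_lead_def
      proof (intro conjI ballI impI)
        have "lkp f (sgl w 1 + ?l) = lkp g ?l"
          unfolding fg X_def monom_def lookup_single_mult by simp
        then show "sgl w 1 + ?l \<in> kys f" using l by (simp add: is_lead_def in_keys_iff)
        fix m' assume m': "m' \<in> kys f" "m' \<noteq> sgl w 1 + ?l"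
        then have "m' \<in> (+) (sgl w 1) ` kys g" using keys_single_mult[of "sgl w 1" "1::'a" g] by (auto simp: fg X_def monom_def)
        then obtain m'' where m'': "m'' \<in> kys g" "m' = sgl w 1 + m''" by auto
        then have "revlex_gt n rnk ?l m''" using l m'(2) by (auto simp: is_lead_def)
        then show "revlex_gt n rnk (sgl w 1 + ?l) m'" unfolding m''(2) by (rule revlex_add)
      qed
      then have "m = sgl w 1 + ?l" using lead_unique[OF rnk Suc.prems(1)] by blast
      then show ?thesis using Suc.IH[OF l gI g0 gh] inJ_add by simp
    next
      case False
      \<comment> \<open>The smaller variables of W do not occur in \<open>f\<close>, so a term
        without \<open>w\<close> beats every term of the same degree with \<open>w\<close>; the
        leading monomial survives the reduction.\<close>
      define g where "g = kill {w} f"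
      have gI: "g \<in> IU n (insert w U)" unfolding g_def by (rule IU_kill[OF Suc.prems(2)])
      have gh: "homog g (int (Suc D))" unfolding g_def by (rule homog_kill[OF Suc.prems(4)])
      have gP: "g \<in> PR (Vars n)" using PR_mono[OF IU_PR[OF gI]] by auto
      have fP: "f \<in> PR (Vars n - U)" by (rule IU_PR[OF Suc.prems(2)])
      let ?l = "lead_mon n rnk g"
      have l: "is_lead n rnk g ?l" by (rule lead_exists[OF rnk gP]) (use False in \<open>simp add: g_def\<close>)
      have kg: "kys g = {m \<in> kys f. w \<notin> kys m}" by (auto simp: g_def kill_def keys_flt)
      have lf: "?l \<in> kys f" "w \<notin> kys ?l" using l kg by (auto simp: is_lead_def)
      have "is_lead n rnk f ?l"
        unfolding is_lead_def
      proof (intro conjI ballI impI)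
        show "?l \<in> kys f" by (rule lf)
        fix m' assume m': "m' \<in> kys f" "m' \<noteq> ?l"
        show "revlex_gt n rnk ?l m'"
        proof (cases "w \<in> kys m'")
          case False
          then show ?thesis using l m' by (simp add: is_lead_def kg)
        next
          case True
          show ?thesis
          proof (rule revlex_smallest[OF VW])
            show "mdeg ?l = mdeg m'" using Suc.prems(4) lf(1) m'(1) by (simp add: homog_def) (metis of_nat_eq_iff)
            show "w \<in> setW n" using w(1) by simp
            show "lkp ?l w < lkp m' w" using lf(2) True by (simp add: in_keys_iff)
            fix u assume u: "u \<in> setW n" "rnk u < rnk w"
            then have "u \<in> U" using w(2)[of u] by auto
            then have "u \<notin> kys ?l" "u \<notin> kys m'" using fP lf(1) m'(1) by (auto simp: PR_def)
            then show "lkp ?l u = lkp m' u" by (simp add: in_keys_iff)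
          qed
        qed
      qed
      then have "m = ?l" using lead_unique[OF rnk Suc.prems(1)] by blast
      then have "is_lead n rnk g m" using l by simp
      moreover have "g \<noteq> 0" using False by (simp add: g_def)
      ultimately show ?thesis using outer_IH[OF gI _ gh] by blast
    qed
  qed
  then show ?case using Suc.prems by blast
qed

lemma lead_I:
  assumes n: "n > 1" and rnk: "inj_on rnk (Vars n)" and VW: "\<forall>v\<in>setV n. \<forall>w\<in>setW n. rnk v > rnk w"
    and f: "(f :: ('a::field) mpoly) \<in> IU n {}" "f \<noteq> 0"
  shows "inJ n (lead_mon n rnk f) \<and> kys (lead_mon n rnk f) \<subseteq> Vars n"
proof -
  let ?l = "lead_mon n rnk f"
  have fP: "f \<in> PR (Vars n)" using IU_PR[OF f(1)] by simp
  have l: "is_lead n rnk f ?l" by (rule lead_exists[OF rnk fP f(2)])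
  \<comment> \<open>The ideal is homogeneous, so the component carrying the leading monomial lies in
    it and has the same leading monomial.\<close>
  define g where "g = hc (int (mdeg ?l)) f"
  have kg: "kys g = {m \<in> kys f. mdeg m = mdeg ?l}" by (simp add: g_def hc_def keys_flt)
  have "is_lead n rnk g ?l" using l by (simp add: is_lead_def kg)
  moreover have "g \<noteq> 0" using l kg by (auto simp: is_lead_def)
  moreover have "g \<in> IU n {}" unfolding g_def by (rule IU_hc[OF f(1)])
  moreover have "homog g (int (mdeg ?l))" unfolding g_def by (rule homog_hc)
  ultimately have "inJ n ?l" using lead_IU_homog[OF n rnk VW, of "{}" g "mdeg ?l" ?l] by simp
  moreover have "kys ?l \<subseteq> Vars n" using l fP by (auto simp: is_lead_def PR_def)
  ultimately show ?thesis by simp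
qed

text \<open>Specialization leaves a single term of the minor, so every other term contains a
  variable of W. At the smallest such variable it loses against the surviving term, which has the
  same degree because the minor is homogeneous.\<close>

lemma lead_H:
  assumes n: "n > 1" and rnk: "inj_on rnk (Vars n)" and VW: "\<forall>v\<in>setV n. \<forall>w\<in>setW n. rnk v > rnk w"
    and p: "p \<in> Vars n"
  shows "(H n p :: ('a::field) mpoly) \<noteq> 0 \<and> lead_mon n rnk (H n p :: 'a mpoly) = sqm (Em n p)"
proof -
  let ?h = "H n p :: 'a mpoly" and ?m = "sqm (Em n p)"
  have e: "eps n p * eps n p = (1::'a)" "kill (setW n) ?h = sgl ?m (eps n p)" using eps[OF n p, where 'a = 'a] by auto
  then have "eps n p \<noteq> (0::'a)" by auto
  then have k: "kys (kill (setW n) ?h) = {?m}" using e(2) by simp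
  then have km: "{m \<in> kys ?h. kys m \<inter> setW n = {}} = {?m}" by (simp add: kill_def keys_flt)
  then have mh: "?m \<in> kys ?h" by blast
  then have h0: "?h \<noteq> 0" by auto
  have mW: "kys ?m \<inter> setW n = {}" using km by blast
  have "is_lead n rnk ?h ?m"
    unfolding is_lead_def
  proof (intro conjI ballI impI mh)
    fix m' assume m': "m' \<in> kys ?h" "m' \<noteq> ?m"
    then have "kys m' \<inter> setW n \<noteq> {}" using km by blast
    then obtain w0 where "w0 \<in> kys m' \<inter> setW n" by blast
    then obtain w where w: "w \<in> kys m' \<inter> setW n" "\<And>u. u \<in> kys m' \<inter> setW n \<Longrightarrow> rnk w \<le> rnk u"
      using ex_has_least_nat[of "\<lambda>v. v \<in> kys m' \<inter> setW n" w0 rnk] by blast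
    show "revlex_gt n rnk ?m m'"
    proof (rule revlex_smallest[OF VW])
      have "int (mdeg ?m) = int (n - 1)" "int (mdeg m') = int (n - 1)"
        using homog_H[of n p, where 'a = 'a] mh m'(1) unfolding homog_def by blast+
      then show "mdeg ?m = mdeg m'" by simp
      show "w \<in> setW n" using w(1) by simp
      have "w \<notin> kys ?m" using w(1) mW by blast
      then show "lkp ?m w < lkp m' w" using w(1) by (simp add: in_keys_iff)
      fix u assume u: "u \<in> setW n" "rnk u < rnk w"
      then have "u \<notin> kys m'" using w(2)[of u] by auto
      moreover have "u \<notin> kys ?m" using u(1) mW by blast
      ultimately show "lkp ?m u = lkp m' u" by (simp add: in_keys_iff)
    qed
  qed
  then have "lead_mon n rnk ?h = ?m" using lead_unique[OF rnk _ lead_exists[OF rnk H_PR[OF p] h0]] by metis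
  then show ?thesis using h0 by blast
qed

lemma initial_ideal_JJ:
  assumes n: "n > 1" and rnk: "inj_on rnk (Vars n)" and VW: "\<forall>v\<in>setV n. \<forall>w\<in>setW n. rnk v > rnk w"
  shows "initial_ideal n rnk (IU n {} :: ('a::field) mpoly set) = JJ n"
  unfolding initial_ideal_def
proof
  let ?G = "{monom (lead_mon n rnk p) | p. p \<in> (IU n {} :: 'a mpoly set) \<and> p \<noteq> 0}"
  show "ideal_gen n ?G \<subseteq> JJ n"
  proof (rule ideal_gen_least[OF JJ_ideal], rule subsetI)
    fix g assume "g \<in> ?G"
    then obtain p where p: "g = monom (lead_mon n rnk p)" "p \<in> (IU n {} :: 'a mpoly set)" "p \<noteq> 0" by blast
    from lead_I[OF n rnk VW p(2,3)] show "g \<in> JJ n" unfolding p(1) by (simp add: JJ_def PR_monom) (simp add: monom_def)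
  qed
  show "JJ n \<subseteq> ideal_gen n ?G"
  proof (rule JJ_least[OF n ideal_gen_ideal], rule ideal_gen_base)
    fix p assume p: "p \<in> Vars n"
    have "H n p \<in> (IU n {} :: 'a mpoly set)" using H_IU[OF p, of "{}"] by simp
    then show "monom (sqm (Em n p)) \<in> ?G" using lead_H[OF n rnk VW p, where 'a = 'a]
      by (intro CollectI exI[of _ "H n p"]) simp
  qed
qed

section \<open>The regular sequence\<close>

lemma kill_in_ideal:
  assumes "(q :: ('a::field) mpoly) \<in> PR (Vars n)" "kill U q = 0" "X ` U \<subseteq> G"
  shows "q \<in> ideal_gen n G"
proof -
  have "sgl m (lkp q m) \<in> ideal_gen n G" if m: "m \<in> kys q" for m
  proof -
    have "m \<notin> kys (kill U q)" using assms(2) by simp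
    then have "kys m \<inter> U \<noteq> {}" using m by (simp add: kill_def keys_flt)
    then obtain u where u: "u \<in> kys m" "u \<in> U" by blast
    define t where "t = m - sgl u 1"
    have mt: "m = t + sgl u 1"
    proof (rule poly_mapping_eqI)
      fix v show "lkp m v = lkp (t + sgl u 1) v"
        using u(1) by (cases "v = u") (simp_all add: t_def lookup_add lookup_minus lookup_single_not_eq in_keys_iff)
    qed
    have "kys m \<subseteq> Vars n" using assms(1) m by (auto simp: PR_def)
    then have "sgl t (lkp q m) \<in> PRing n" unfolding PRing_PR mt keys_add_nat by (intro PR_single) simp
    moreover have "X u \<in> ideal_gen n G" using u(2) assms(3) by (intro ideal_gen_base) blast
    ultimately have "sgl t (lkp q m) * X u \<in> ideal_gen n G" by (rule ideal_gen_mult)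
    then show ?thesis by (simp add: X_def monom_def mult_single mt)
  qed
  then have "(\<Sum>m\<in>kys q. sgl m (lkp q m)) \<in> ideal_gen n G" by (rule ideal_in_sum[OF ideal_gen_ideal])
  then show ?thesis using poly_expand[of q] by simp
qed

lemma IU_killU: "f \<in> IU n {} \<Longrightarrow> kill U f \<in> (IU n U :: ('a::field) mpoly set)"
proof -
  assume "f \<in> IU n {}"
  then obtain c where c: "\<forall>p\<in>Vars n. c p \<in> PR (Vars n)" "f = (\<Sum>p\<in>Vars n. c p * H n p)" by (auto simp: IU_def)
  have "kill U f = (\<Sum>p\<in>Vars n. kill U (c p) * kill U (H n p))" by (simp add: c(2) kill_sum kill_mult)
  then show ?thesis unfolding IU_def using c(1)
    by (intro CollectI exI[of _ "\<lambda>p. kill U (c p)"]) (simp add: kill_PR)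
qed

lemma IU_lift: "g \<in> IU n U \<Longrightarrow> \<exists>h\<in>IU n {}. (g :: ('a::field) mpoly) = kill U h"
proof -
  assume "g \<in> IU n U"
  then obtain c where c: "\<forall>p\<in>Vars n. c p \<in> PR (Vars n - U)" "g = (\<Sum>p\<in>Vars n. c p * kill U (H n p))" by (auto simp: IU_def)
  have "c p \<in> PR (Vars n) \<and> kill U (c p) = c p" if "p \<in> Vars n" for p
    using c(1) that PR_mono[of "c p" "Vars n - U" "Vars n"] kill_id[of "c p" "Vars n - U" U] by auto
  then show ?thesis unfolding IU_def
    by (intro bexI[of _ "\<Sum>p\<in>Vars n. c p * H n p"] CollectI exI[of _ c]) (simp_all add: c(2) kill_sum kill_mult)
qed

lemma IU_smult_add:
  "ideal_in n {g \<in> PR (Vars n). kill U g \<in> (IU n U :: ('a::field) mpoly set)}"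
  unfolding ideal_in_def
proof (intro conjI ballI CollectI)
  show "kill U 0 \<in> (IU n U :: 'a mpoly set)" by (simp add: IU_0)
  show "0 \<in> PR (Vars n)" by simp
next
  fix f g :: "'a mpoly" assume f: "f \<in> {g \<in> PR (Vars n). kill U g \<in> IU n U}" and g: "g \<in> {g \<in> PR (Vars n). kill U g \<in> IU n U}"
  then show "f + g \<in> PR (Vars n)" by (simp add: PR_add)
  obtain f' g' where h: "f' \<in> IU n {}" "g' \<in> IU n {}" "kill U f = kill U f'" "kill U g = kill U g'"
    using f g IU_lift by blast
  then have "f' + g' \<in> IU n {}" using IU_ideal[of n] unfolding ideal_in_def by blast
  from IU_killU[OF this, of U] show "kill U (f + g) \<in> IU n U" by (simp add: kill_add h)
next
  fix p f :: "'a mpoly" assume p: "p \<in> PRing n" and f: "f \<in> {g \<in> PR (Vars n). kill U g \<in> IU n U}"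
  then show "p * f \<in> PR (Vars n)" by (simp add: PR_mult PRing_PR)
  obtain f' where h: "f' \<in> IU n {}" "kill U f = kill U f'" using f IU_lift by blast
  then have "p * f' \<in> IU n {}" using IU_ideal[of n] p unfolding ideal_in_def by blast
  from IU_killU[OF this, of U] show "kill U (p * f) \<in> IU n U" by (simp add: kill_mult h)
qed

text \<open>A polynomial differs from its value under \<open>kill U\<close> by multiples of
  variables in \<open>U\<close>. Membership modulo these variables is thus membership in the
  specialized ideal of the smaller ring, and \<open>IU_reg\<close> transfers to the quotients that
  define a regular sequence.\<close>

lemma ideal_mod_iff:
  assumes U: "U \<subseteq> setW n"
  shows "g \<in> ideal_gen n (IU n {} \<union> X ` U) \<longleftrightarrow> g \<in> PR (Vars n) \<and> kill U g \<in> (IU n U :: ('a::field) mpoly set)"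
proof
  assume g: "g \<in> ideal_gen n (IU n {} \<union> X ` U)"
  have "ideal_gen n (IU n {} \<union> X ` U) \<subseteq> {g \<in> PR (Vars n). kill U g \<in> (IU n U :: 'a mpoly set)}"
  proof (rule ideal_gen_least[OF IU_smult_add], rule subsetI)
    fix x :: "'a mpoly" assume "x \<in> IU n {} \<union> X ` U"
    then consider "x \<in> IU n {}" | u where "u \<in> U" "x = X u" by blast
    then show "x \<in> {g \<in> PR (Vars n). kill U g \<in> IU n U}"
    proof cases
      case 1
      then show ?thesis using IU_PR[of x n "{}"] IU_killU[of x n U] by simp
    next
      case 2
      have "X u \<in> PR (Vars n)" using 2 U setW_Vars by (intro PR_X) blast
      then show ?thesis using 2 by (simp add: kill_X IU_0)
    qed
  qed
  then show "g \<in> PR (Vars n) \<and> kill U g \<in> IU n U" using g by blast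
next
  assume g: "g \<in> PR (Vars n) \<and> kill U g \<in> IU n U"
  then obtain h where h: "h \<in> IU n {}" "kill U g = kill U h" using IU_lift by blast
  have "g - h \<in> ideal_gen n (IU n {} \<union> X ` U)"
    by (rule kill_in_ideal[of _ n U]) (use g h IU_PR[OF h(1)] in \<open>auto simp: kill_diff PR_diff\<close>)
  moreover have "h \<in> ideal_gen n (IU n {} \<union> X ` U)" by (rule ideal_gen_base) (use h in simp)
  ultimately have "(g - h) + h \<in> ideal_gen n (IU n {} \<union> X ` U)" by (rule ideal_gen_add)
  then show "g \<in> ideal_gen n (IU n {} \<union> X ` U)" by simp
qed

lemma one_notin_IU_W: "n > 1 \<Longrightarrow> (1 :: ('a::field) mpoly) \<notin> IU n (setW n)"
proof
  assume n: "n > 1" and o: "(1 :: 'a mpoly) \<in> IU n (setW n)"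
  have "inJ n 0" by (rule IU_W_inJ[OF n o]) simp
  then obtain p where p: "p \<in> Vars n" "mdvd (sqm (Em n p)) 0" by (auto simp: inJ_def)
  have fin: "finite (Em n p)" using Em_sub[OF n p(1)] by simp
  obtain v where "v \<in> Em n p" using Em_indep[OF n p(1)] n by (cases "Em n p = {}") auto
  then have "lkp (sqm (Em n p)) v = 1" using fin by (simp add: lookup_sqm)
  then show False using p(2) unfolding mdvd_iff by (metis lookup_zero not_one_le_zero)
qed

text \<open>Since \<open>IU_reg\<close> covers every killed subset of W, an arbitrary listing of W
  serves as the sequence.\<close>

lemma regular_W:
  assumes n: "n > 1"
  shows "regular_sequence_mod n (IU n {} :: ('a::field) mpoly set) (setW n)"
proof -
  have "finite (setW n)" by (rule finite_subset[OF setW_Vars]) simp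
  then obtain ws where ws: "set ws = setW n" "distinct ws" using finite_distinct_list by blast
  have im: "{var_x (fst w) (snd w) | w. w \<in> U} = (X ` U :: 'a mpoly set)" for U
    by (auto simp: var_x_X image_iff)
  have reg: "f \<in> ideal_gen n (IU n {} \<union> X ` set (take k ws))"
    if k: "k < length ws" and f: "f \<in> PRing n" and m: "X (ws ! k) * f \<in> ideal_gen n (IU n {} \<union> X ` set (take k ws))" for k and f :: "'a mpoly"
  proof -
    have U: "set (take k ws) \<subseteq> setW n" using ws(1) set_take_subset by metis
    have w: "ws ! k \<in> setW n" "ws ! k \<notin> set (take k ws)"
      using k ws nth_mem[OF k] by (auto simp: set_conv_nth nth_eq_iff_index_eq)
    have "kill (set (take k ws)) (X (ws ! k) * f) \<in> IU n (set (take k ws))" using m unfolding ideal_mod_iff[OF U] by simp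
    then have "X (ws ! k) * kill (set (take k ws)) f \<in> IU n (set (take k ws))" using w(2) by (simp add: kill_mult kill_X)
    then have "kill (set (take k ws)) f \<in> IU n (set (take k ws))" by (rule IU_reg[OF n U w])
    then show ?thesis unfolding ideal_mod_iff[OF U] using f by (simp add: PRing_PR)
  qed
  have "1 \<notin> ideal_gen n (IU n {} \<union> X ` setW n :: 'a mpoly set)"
    unfolding ideal_mod_iff[OF subset_refl] using one_notin_IU_W[OF n] by simp
  then show ?thesis unfolding regular_sequence_mod_def im
    using ws reg by (intro exI[of _ ws]) (simp add: var_x_X)
qed

section \<open>Specializing the resolution\<close>

lemma kill_kill_insert: "kill {w} (kill U p) = kill (insert w U) p"
  by (simp add: kill_kill)

lemma vec_X: "(\<lambda>k. X w * vec f k) = vec (X w * f)"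
  by (auto simp: vec_def fun_eq_iff)

lemma gsub_I: "gsub (Vars n) 1 (\<lambda>_. 0) (vec ` (IU n {} :: ('a::field) mpoly set))"
proof -
  have I: "ideal_in n (IU n {} :: 'a mpoly set)" by (rule IU_ideal)
  have pr: "f \<in> PR (Vars n)" if "f \<in> (IU n {} :: 'a mpoly set)" for f using IU_PR[OF that] by simp
  have "vec f \<in> free (Vars n) 1" if "f \<in> (IU n {} :: 'a mpoly set)" for f
    using pr[OF that] by (auto simp: free_def vec_def)
  then have 1: "vec ` IU n {} \<subseteq> (free (Vars n) 1 :: (nat \<Rightarrow> 'a mpoly) set)" by blast
  have z: "(\<lambda>_. 0) = vec (0 :: 'a mpoly)" by (simp add: vec_def fun_eq_iff)
  have a: "(\<lambda>l. vec f l + vec g l) = vec (f + g)" "(\<lambda>l. p * vec f l) = vec (p * f)" for f g p :: "'a mpoly"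
    by (simp_all add: vec_def fun_eq_iff)
  have h: "hcv (\<lambda>_. 0) d (vec f) = vec (hc d f)" for d and f :: "'a mpoly"
    by (simp add: hcv_def vec_def fun_eq_iff hc_0)
  have "(0 :: 'a mpoly) \<in> IU n {}" using I by (simp add: ideal_in_def)
  moreover have "f + g \<in> IU n {}" if "f \<in> IU n {}" "g \<in> IU n {}" for f g :: "'a mpoly"
    using I that by (simp add: ideal_in_def)
  moreover have "p * f \<in> IU n {}" if "p \<in> PR (Vars n)" "f \<in> IU n {}" for p f :: "'a mpoly"
    using I that by (simp add: ideal_in_def PRing_PR)
  moreover have "hc d f \<in> IU n {}" if "f \<in> IU n {}" for d and f :: "'a mpoly"
    using that by (rule IU_hc)
  ultimately show ?thesis
    unfolding gsub_def ball_simps using 1 by (simp add: z a h)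
qed

text \<open>In contrast to \<open>mcx_kill_exact\<close> no position is lost: at position 0 the
  regularity of \<open>w\<close> is supplied by \<open>IU_reg\<close>, and at the later ones by
  exactness one position before. Killing variables changes neither degrees nor constant terms, so
  the complex stays graded and minimal.\<close>

lemma mcx_specialize:
  fixes M :: "nat \<Rightarrow> nat \<Rightarrow> nat \<Rightarrow> ('a::field) mpoly"
  assumes n: "n > 1" and M: "mcx (Vars n) (vec ` IU n {}) r s M" and B: "finite B"
  shows "B \<subseteq> setW n \<Longrightarrow> mcx (Vars n - B) (vec ` IU n B) r s (\<lambda>i k l. kill B (M i k l))"
  using B
proof (induction B rule: finite_induct)
  case empty
  then show ?case using M by simp
next
  case (insert w B)
  have wB: "w \<in> setW n" "w \<notin> B" "B \<subseteq> setW n" "w \<in> Vars n - B" using insert setW_Vars by auto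
  have IH: "mcx (Vars n - B) (vec ` IU n B) r s (\<lambda>i k l. kill B (M i k l))" using insert.IH wB(3) by simp
  have r0: "r 0 = 1" "s 0 0 = 0"
    and ent: "\<And>i k l. k < r i \<Longrightarrow> l < r (Suc i) \<Longrightarrow> kill B (M i k l) \<in> PR (Vars n - B) \<and> homog (kill B (M i k l)) (s (Suc i) l - s i k)"
    and im0: "img (Vars n - B) (r 0) (r (Suc 0)) (\<lambda>k l. kill B (M 0 k l)) = vec ` IU n B"
    and ex: "\<And>i. ker (Vars n - B) (r i) (r (Suc i)) (\<lambda>k l. kill B (M i k l)) =
        img (Vars n - B) (r (Suc i)) (r (Suc (Suc i))) (\<lambda>k l. kill B (M (Suc i) k l))"
    and mn: "\<And>i k l. k < r (Suc i) \<Longrightarrow> l < r (Suc (Suc i)) \<Longrightarrow> lkp (kill B (M (Suc i) k l)) 0 = 0"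
    using IH unfolding mcx_def by blast+
  have V: "Vars n - B - {w} = Vars n - insert w B" by auto
  have kf: "(\<lambda>k l. kill {w} (kill B (M i k l))) = (\<lambda>k l. kill (insert w B) (M i k l))" for i
    by (simp only: kill_kill_insert)
  have reg: "u \<in> img (Vars n - B) (r i) (r (Suc i)) (\<lambda>k l. kill B (M i k l))"
    if u: "u \<in> free (Vars n - B) (r i)" "(\<lambda>k. X w * u k) \<in> img (Vars n - B) (r i) (r (Suc i)) (\<lambda>k l. kill B (M i k l))" for u i
  proof (cases i)
    case 0
    have "u = vec (u 0)" using u(1) r0 0 by (auto simp: free_def vec_def fun_eq_iff)
    then have "vec (X w * u 0) \<in> vec ` IU n B" using u(2) im0 0 vec_X[of w "u 0"] by simp
    then have "X w * u 0 \<in> IU n B" by (auto simp: vec_def fun_eq_iff split: if_splits)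
    then have "u 0 \<in> IU n B" by (rule IU_reg[OF n wB(3,1,2)])
    then show ?thesis using \<open>u = vec (u 0)\<close> im0 0 by auto
  next
    case (Suc j)
    from ex[of j] have "ker (Vars n - B) (r j) (r i) (\<lambda>k l. kill B (M j k l)) =
        img (Vars n - B) (r i) (r (Suc i)) (\<lambda>k l. kill B (M i k l))" by (simp only: Suc)
    from exact_reg[OF this u] show ?thesis .
  qed
  have ex': "ker (Vars n - insert w B) (r i) (r (Suc i)) (\<lambda>k l. kill (insert w B) (M i k l)) =
        img (Vars n - insert w B) (r (Suc i)) (r (Suc (Suc i))) (\<lambda>k l. kill (insert w B) (M (Suc i) k l))" for i
    unfolding V[symmetric] kf[symmetric]
    by (rule kill_exact[OF wB(4) _ _ reg ex]) (use ent in auto)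
  have im': "img (Vars n - insert w B) (r 0) (r (Suc 0)) (\<lambda>k l. kill (insert w B) (M 0 k l)) = vec ` IU n (insert w B)"
  proof (intro equalityI subsetI)
    fix v assume "v \<in> img (Vars n - insert w B) (r 0) (r (Suc 0)) (\<lambda>k l. kill (insert w B) (M 0 k l))"
    then obtain x where x: "x \<in> free (Vars n - B - {w}) (r (Suc 0))" "v = gmap (r 0) (r (Suc 0)) (\<lambda>k l. kill {w} (kill B (M 0 k l))) x"
      unfolding V[symmetric] kf[symmetric] img_def by blast
    have xk: "x = (\<lambda>l. kill {w} (x l))" using free_kill_id[OF x(1)] by simp
    have "v = (\<lambda>k. kill {w} (gmap (r 0) (r (Suc 0)) (\<lambda>k l. kill B (M 0 k l)) x k))"
      unfolding x(2) by (subst xk) (rule gmap_kill)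
    moreover have "gmap (r 0) (r (Suc 0)) (\<lambda>k l. kill B (M 0 k l)) x \<in> vec ` IU n B"
      unfolding im0[symmetric] img_def by (rule imageI) (rule free_mono[OF x(1)], blast)
    ultimately obtain h where h: "h \<in> IU n B" "v = (\<lambda>k. kill {w} (vec h k))" by auto
    have "v = vec (kill {w} h)" by (auto simp: h(2) vec_def fun_eq_iff)
    then show "v \<in> vec ` IU n (insert w B)" using IU_kill[OF h(1)] by blast
  next
    fix v assume "v \<in> vec ` (IU n (insert w B) :: 'a mpoly set)"
    then obtain g where g: "v = vec g" "g \<in> IU n (insert w B)" by blast
    obtain h where h: "h \<in> IU n {}" "g = kill (insert w B) h" using IU_lift[OF g(2)] by blast
    have hB: "kill B h \<in> IU n B" by (rule IU_killU[OF h(1)])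
    then have "vec (kill B h) \<in> img (Vars n - B) (r 0) (r (Suc 0)) (\<lambda>k l. kill B (M 0 k l))" unfolding im0 by blast
    then obtain x where x: "x \<in> free (Vars n - B) (r (Suc 0))" "vec (kill B h) = gmap (r 0) (r (Suc 0)) (\<lambda>k l. kill B (M 0 k l)) x"
      unfolding img_def by blast
    have "v = (\<lambda>k. kill {w} (vec (kill B h) k))"
      unfolding g(1) h(2) kill_kill_insert[of w B h, symmetric] by (auto simp: vec_def fun_eq_iff)
    also have "\<dots> = gmap (r 0) (r (Suc 0)) (\<lambda>k l. kill {w} (kill B (M 0 k l))) (\<lambda>l. kill {w} (x l))"
      unfolding x(2) by (rule gmap_kill[symmetric])
    finally show "v \<in> img (Vars n - insert w B) (r 0) (r (Suc 0)) (\<lambda>k l. kill (insert w B) (M 0 k l))"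
      unfolding V[symmetric] kf[symmetric] img_def using free_kill[OF x(1)] by blast
  qed
  have ent': "kill (insert w B) (M i k l) \<in> PR (Vars n - insert w B) \<and> homog (kill (insert w B) (M i k l)) (s (Suc i) l - s i k)"
    if "k < r i" "l < r (Suc i)" for i k l
    using ent[OF that] kill_PR[of "kill B (M i k l)" "Vars n - B" "{w}"] homog_kill[of "kill B (M i k l)" _ "{w}"]
    by (simp add: kill_kill_insert V)
  have mn': "lkp (kill (insert w B) (M (Suc i) k l)) 0 = 0" if "k < r (Suc i)" "l < r (Suc (Suc i))" for i k l
    using mn[OF that] by (simp add: lookup_0_kill)
  show ?case unfolding mcx_def using r0 ent' im' ex' mn' by blast
qed

text \<open>The specialized complex is exact over the ring without W, but both resolutions must be
  over the full ring. Adjoining the variables of W again preserves exactness, and the image of the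
  augmentation becomes the ideal generated in the full ring.\<close>

lemma mcx_Y:
  fixes M :: "nat \<Rightarrow> nat \<Rightarrow> nat \<Rightarrow> ('a::field) mpoly"
  assumes n: "n > 1" and M: "mcx (Vars n) (vec ` IU n {}) r s M"
  shows "mcx (Vars n) (vec ` JJ n) r s (\<lambda>i k l. kill (setW n) (M i k l))"
proof -
  let ?M = "\<lambda>i k l. kill (setW n) (M i k l)"
  have fin: "finite (setW n)" using finite_subset[OF setW_Vars] by simp
  have W: "mcx (Vars n - setW n) (vec ` IU n (setW n)) r s ?M"
    by (rule mcx_specialize[OF n M fin subset_refl])
  have r0: "r 0 = 1" "s 0 0 = 0"
    and ent: "\<And>i k l. k < r i \<Longrightarrow> l < r (Suc i) \<Longrightarrow> ?M i k l \<in> PR (Vars n - setW n) \<and> homog (?M i k l) (s (Suc i) l - s i k)"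
    and im0: "img (Vars n - setW n) (r 0) (r (Suc 0)) (?M 0) = vec ` IU n (setW n)"
    and ex: "\<And>i. ker (Vars n - setW n) (r i) (r (Suc i)) (?M i) =
        img (Vars n - setW n) (r (Suc i)) (r (Suc (Suc i))) (?M (Suc i))"
    and mn: "\<And>i k l. k < r (Suc i) \<Longrightarrow> l < r (Suc (Suc i)) \<Longrightarrow> lkp (?M (Suc i) k l) 0 = 0"
    using W unfolding mcx_def by blast+
  have U: "setW n \<union> (Vars n - setW n) = Vars n" using setW_Vars by auto
  have ex': "ker (Vars n) (r i) (r (Suc i)) (?M i) = img (Vars n) (r (Suc i)) (r (Suc (Suc i))) (?M (Suc i))" for i
    using ker_ext[OF fin _ _ ex[of i]] ent unfolding U by blast
  have ent': "?M i k l \<in> PR (Vars n) \<and> homog (?M i k l) (s (Suc i) l - s i k)" if "k < r i" "l < r (Suc i)" for i k l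
    using ent[OF that] PR_mono by blast
  have IJ: "IU n (setW n) \<subseteq> (JJ n :: 'a mpoly set)"
    using IU_W_inJ[OF n] IU_PR PR_mono by (fastforce simp: JJ_def)
  have im': "img (Vars n) (r 0) (r (Suc 0)) (?M 0) = vec ` JJ n"
  proof (intro equalityI subsetI)
    fix v assume "v \<in> img (Vars n) (r 0) (r (Suc 0)) (?M 0)"
    then obtain x where x: "x \<in> free (Vars n) (r (Suc 0))" "v = gmap (r 0) (r (Suc 0)) (?M 0) x" by (auto simp: img_def)
    have v: "v = vec (\<Sum>l<r (Suc 0). ?M 0 0 l * x l)" by (auto simp: x(2) gmap_def vec_def fun_eq_iff r0)
    have "(\<Sum>l<r (Suc 0). ?M 0 0 l * x l) \<in> JJ n"
    proof (rule ideal_in_sum[OF JJ_ideal])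
      fix l assume "l \<in> {..<r (Suc 0)}"
      then have l: "l < r (Suc 0)" by simp
      have "vec (?M 0 0 l) \<in> img (Vars n - setW n) (r 0) (r (Suc 0)) (?M 0)"
        by (rule img_column[OF l]) (simp_all add: vec_def r0)
      then have "?M 0 0 l \<in> IU n (setW n)" unfolding im0 by (auto simp: vec_def fun_eq_iff split: if_splits)
      then have "x l * ?M 0 0 l \<in> JJ n"
        using IJ JJ_ideal[of n, where 'a = 'a] free_PR[OF x(1), of l] unfolding ideal_in_def PRing_PR by blast
      then show "?M 0 0 l * x l \<in> JJ n" by (simp only: mult.commute)
    qed
    then show "v \<in> vec ` JJ n" using v by blast
  next
    \<comment> \<open>The polynomials in the image of the augmentation form an ideal of the full
      ring, so it suffices to find the monomial generators in it.\<close>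
    define K where "K = {f :: 'a mpoly. vec f \<in> img (Vars n) (r 0) (r (Suc 0)) (?M 0)}"
    have vp: "vec (f + g) = (\<lambda>l. vec f l + vec g l)" "vec (p * f) = (\<lambda>l. p * vec f l)" for f g p :: "'a mpoly"
      by (auto simp: vec_def fun_eq_iff)
    have v0: "vec 0 = (\<lambda>_. 0 :: 'a mpoly)" by (simp add: vec_def fun_eq_iff)
    have "ideal_in n K" unfolding ideal_in_def
    proof (intro conjI ballI)
      have "(\<lambda>_. 0) \<in> free (Vars n) (r (Suc 0))" by (simp add: free_def)
      then show "0 \<in> K" unfolding K_def v0 img_mem mem_Collect_eq by (rule bexI[rotated]) simp
      show "f + g \<in> K" if "f \<in> K" "g \<in> K" for f g
        using that unfolding K_def vp mem_Collect_eq by (rule img_add)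
      show "p * f \<in> K" if "p \<in> PRing n" "f \<in> K" for p f
        using that unfolding K_def vp PRing_PR mem_Collect_eq by (rule img_smult)
    qed
    moreover have "monom (sqm (Em n p)) \<in> K" if p: "p \<in> Vars n" for p
    proof -
      have "kill (setW n) (H n p) \<in> (IU n (setW n) :: 'a mpoly set)" by (rule H_IU[OF p])
      then have "vec (kill (setW n) (H n p)) \<in> img (Vars n - setW n) (r 0) (r (Suc 0)) (?M 0)" unfolding im0 by blast
      then obtain x where x: "x \<in> free (Vars n - setW n) (r (Suc 0))" "vec (kill (setW n) (H n p)) = gmap (r 0) (r (Suc 0)) (?M 0) x"
        unfolding img_def by blast
      have "x \<in> free (Vars n) (r (Suc 0))" by (rule free_mono[OF x(1)]) blast
      then have "kill (setW n) (H n p) \<in> K" unfolding K_def img_mem using x(2) by blast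
      moreover have "sgl 0 (eps n p) \<in> (PRing n :: 'a mpoly set)" by (simp add: PRing_PR PR_single)
      ultimately have "sgl 0 (eps n p) * kill (setW n) (H n p) \<in> K" using \<open>ideal_in n K\<close> unfolding ideal_in_def by blast
      then show ?thesis by (simp add: eps[OF n p] mult_single monom_def)
    qed
    ultimately have "JJ n \<subseteq> K" by (rule JJ_least[OF n])
    moreover fix v assume "v \<in> vec ` (JJ n :: 'a mpoly set)"
    ultimately show "v \<in> img (Vars n) (r 0) (r (Suc 0)) (?M 0)" by (auto simp: K_def)
  qed
  show ?thesis unfolding mcx_def using r0 ent' im' ex' mn by blast
qed

lemma same_betti:
  assumes n: "n > 1"
  shows "same_graded_betti n (JJ n) (IU n {} :: ('a::field) mpoly set)"
proof -
  obtain r s and M :: "nat \<Rightarrow> nat \<Rightarrow> nat \<Rightarrow> 'a mpoly" where M: "mcx (Vars n) (vec ` IU n {}) r s M"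
    using mcx_exists[OF finite_Vars gsub_I] by blast
  have fin: "r (Suc i) = 0" if "i > card (Vars n)" for i by (rule mcx_finite[OF finite_Vars M that])
  let ?R = "mk_res r s M" and ?R' = "mk_res r s (\<lambda>i k l. kill (setW n) (M i k l))"
  have "minimal_graded_free_resolution n (IU n {}) ?R" by (rule mcx_resolution[OF M fin])
  moreover have "minimal_graded_free_resolution n (JJ n) ?R'" by (rule mcx_resolution[OF mcx_Y[OF n M] fin])
  moreover have "betti ?R' i j = betti ?R i j" for i j by (simp add: betti_def mk_res_def)
  ultimately show ?thesis unfolding same_graded_betti_def by blast
qed

section \<open>The initial complex\<close>

lemma SR_JJ:
  assumes n: "n > 1"
  shows "F \<in> SR_complex n (JJ n :: ('a::field) mpoly set) \<longleftrightarrow> F \<subseteq> Vars n \<and> (\<forall>S\<subseteq>F. indep n S \<longrightarrow> card S \<noteq> n - 1)"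
proof (cases "F \<subseteq> Vars n")
  case True
  have fF: "finite F" by (rule finite_subset[OF True]) simp
  have "sqfree_monom F \<in> (JJ n :: 'a mpoly set) \<longleftrightarrow> inJ n (sqm F)"
    using fF True unfolding sqfree_monom_def sqm_def[symmetric] monom_def by (simp add: JJ_def PR_single keys_sqm)
  also have "\<dots> \<longleftrightarrow> (\<exists>p\<in>Vars n. Em n p \<subseteq> F)"
  proof -
    have "mdvd (sqm (Em n p)) (sqm F) \<longleftrightarrow> Em n p \<subseteq> F" if "p \<in> Vars n" for p
    proof -
      have fin: "finite (Em n p)" using Em_sub[OF n that] by simp
      show ?thesis
      proof
        assume d: "mdvd (sqm (Em n p)) (sqm F)"
        show "Em n p \<subseteq> F"
        proof
          fix v assume "v \<in> Em n p"
          moreover have "lkp (sqm (Em n p)) v \<le> lkp (sqm F) v" using d unfolding mdvd_iff by (rule spec)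
          ultimately show "v \<in> F" using fin fF by (simp add: lookup_sqm split: if_splits)
        qed
      next
        assume sub: "Em n p \<subseteq> F"
        show "mdvd (sqm (Em n p)) (sqm F)" unfolding mdvd_iff
          using sub by (intro allI) (simp add: lookup_sqm fin fF, blast)
      qed
    qed
    then show ?thesis by (simp add: inJ_def)
  qed
  also have "\<dots> \<longleftrightarrow> (\<exists>S\<subseteq>F. indep n S \<and> card S = n - 1)"
    using indep_matching[OF n] Em_indep[OF n] by metis
  finally show ?thesis using True by (auto simp: SR_complex_def)
qed (simp add: SR_complex_def)

text \<open>The diagonal and the off-diagonal entries are full transversals. Dropping a row other
  than that of \<open>v\<close> from the one containing \<open>v\<close> leaves \<open>n - 1\<close>
  independent entries. This shows later that \<open>v\<close> avoids some facet.\<close>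

lemma indep_card: "n > 1 \<Longrightarrow> v \<in> setV n \<Longrightarrow> \<exists>S. v \<in> S \<and> indep n S \<and> card S = n - 1"
proof -
  assume n: "n > 1" and v: "v \<in> setV n"
  obtain i j where ij: "v = (i, j)" by (cases v)
  have i: "i \<in> {1..n}" "j = i \<or> j = nx n i" using v unfolding ij setV_iff[OF n] by auto
  obtain a where a: "a \<in> {1..n}" "a \<noteq> i"
    using n that[of 1] that[of 2] by (cases "i = 1") auto
  have main: "\<exists>S. (i, g i) \<in> S \<and> indep n S \<and> card S = n - 1" if g: "inj_on g {1..n}" "\<And>k. k \<in> {1..n} \<Longrightarrow> g k = k \<or> g k = nx n k" for g
  proof -
    define S where "S = (\<lambda>k. (k, g k)) ` ({1..n} - {a})"
    have "card S = n - 1" unfolding S_def using a by (subst card_image) (auto simp: inj_on_def)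
    moreover have "S \<subseteq> setV n" unfolding S_def using g(2) by (auto simp: setV_iff[OF n] simp del: atLeastAtMost_iff)
    moreover have "inj_on fst S" by (rule inj_onI) (auto simp: S_def)
    moreover have "inj_on snd S"
    proof (rule inj_onI)
      fix x y assume "x \<in> S" "y \<in> S" "snd x = snd y"
      then obtain k l where kl: "x = (k, g k)" "y = (l, g l)" "k \<in> {1..n}" "l \<in> {1..n}" "g k = g l" unfolding S_def by auto
      then show "x = y" using inj_onD[OF g(1) kl(5) kl(3,4)] by simp
    qed
    moreover have "(i, g i) \<in> S" using i a by (auto simp: S_def)
    ultimately show ?thesis unfolding indep_def by blast
  qed
  from i(2) show ?thesis
  proof
    assume "j = i"
    then show ?thesis using main[of "\<lambda>k. k"] ij by simp
  next
    assume "j = nx n i"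
    moreover have "inj_on (nx n) {1..n}" by (rule inj_onI) (rule nx_inj)
    ultimately show ?thesis using main[of "nx n"] ij by simp
  qed
qed

lemma card_subset_sing_neq: "n > 2 \<Longrightarrow> S \<subseteq> {v} \<Longrightarrow> card S \<noteq> n - 1"
  using card_mono[of "{v}" S] by simp

text \<open>A vertex outside V lies in no independent set, so it can be added to any face and
  belongs to every facet. A vertex \<open>v\<close> of V lies in an independent set \<open>S\<close>
  of size \<open>n - 1\<close>; the face \<open>S - {v}\<close> extends to a facet, and this facet
  cannot contain \<open>v\<close>.\<close>

lemma core_JJ:
  assumes n: "n > 2"
  shows "core (SR_complex n (JJ n :: ('a::field) mpoly set)) = {F. F \<subseteq> setV n \<and> (\<forall>S\<subseteq>F. indep n S \<longrightarrow> card S \<noteq> n - 1)}"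
proof -
  have n1: "n > 1" using n by simp
  define D where "D = SR_complex n (JJ n :: 'a mpoly set)"
  have D: "F \<in> D \<longleftrightarrow> F \<subseteq> Vars n \<and> (\<forall>S\<subseteq>F. indep n S \<longrightarrow> card S \<noteq> n - 1)" for F
    unfolding D_def by (rule SR_JJ[OF n1])
  have UD: "v \<in> \<Union>D \<longleftrightarrow> v \<in> Vars n" for v
  proof
    assume v: "v \<in> Vars n"
    have "{v} \<in> D" using v unfolding D
      by (intro conjI allI impI) (simp, rule card_subset_sing_neq[OF n], assumption)
    then show "v \<in> \<Union>D" by blast
  qed (use D in blast)
  have U: "{v \<in> \<Union>D. \<exists>G\<in>facets D. v \<notin> G} = setV n"
  proof (intro equalityI subsetI)
    fix v assume "v \<in> {v \<in> \<Union>D. \<exists>G\<in>facets D. v \<notin> G}"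
    then obtain G where v: "v \<in> Vars n" "G \<in> facets D" "v \<notin> G" using UD by blast
    have G: "G \<in> D" "\<And>G'. G' \<in> D \<Longrightarrow> G \<subseteq> G' \<Longrightarrow> G' = G" using v(2) by (auto simp: facets_def)
    show "v \<in> setV n"
    proof (rule ccontr)
      assume nv: "v \<notin> setV n"
      have "insert v G \<in> D" unfolding D
      proof (intro conjI allI impI)
        show "insert v G \<subseteq> Vars n" using v(1) G(1) D by blast
        fix S assume S: "S \<subseteq> insert v G" "indep n S"
        then have "S \<subseteq> G" using nv by (auto simp: indep_def)
        then show "card S \<noteq> n - 1" using G(1) S(2) unfolding D by blast
      qed
      then have "insert v G = G" using G(2) by blast
      then show False using v(3) by blast
    qed
  next
    fix v assume v: "v \<in> setV n"
    then obtain S where S: "v \<in> S" "indep n S" "card S = n - 1" using indep_card[OF n1] by blast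
    have fS: "finite S" by (rule indep_finite[OF n1 S(2)])
    have SvD: "S - {v} \<in> D" unfolding D
    proof (intro conjI allI impI)
      show "S - {v} \<subseteq> Vars n" using S(2) setV_Vars[OF n1] unfolding indep_def by blast
      fix T assume "T \<subseteq> S - {v}"
      then have "card T \<le> card (S - {v})" using fS by (intro card_mono) auto
      also have "\<dots> < card S" using fS S(1) by (rule card_Diff1_less)
      finally show "card T \<noteq> n - 1" using S(3) by simp
    qed
    have finD: "finite D" by (rule finite_subset[of _ "Pow (Vars n)"]) (use D in auto)
    obtain G where G: "G \<in> D" "S - {v} \<subseteq> G" "\<And>G'. G' \<in> D \<Longrightarrow> G \<subseteq> G' \<Longrightarrow> G = G'"
      using finite_has_maximal2[OF finD SvD] by (elim bexE conjE) (rule that, auto)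
    have "v \<notin> G"
    proof
      assume "v \<in> G"
      then have "S \<subseteq> G" using G(2) by blast
      then show False using G(1) S(2,3) unfolding D by blast
    qed
    moreover have "G \<in> facets D" using G(1,3) by (auto simp: facets_def)
    moreover have "v \<in> \<Union>D" using UD v setV_Vars[OF n1] by blast
    ultimately show "v \<in> {v \<in> \<Union>D. \<exists>G\<in>facets D. v \<notin> G}" by blast
  qed
  have "core D = {F \<in> D. F \<subseteq> setV n}" unfolding core_def U Let_def ..
  also have "\<dots> = {F. F \<subseteq> setV n \<and> (\<forall>S\<subseteq>F. indep n S \<longrightarrow> card S \<noteq> n - 1)}"
    using setV_Vars[OF n1] unfolding D by blast
  finally show ?thesis by (simp add: D_def)
qed

text \<open>Diagonal entries receive the odd labels and the others the even ones, in cyclic order;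
  the corner entry \<open>(n, 1)\<close> receives the last label \<open>2 * n\<close>, so the
  wrap-around matches that of \<open>nx\<close>.\<close>

definition posV :: "var \<Rightarrow> nat" where
  "posV v = (if snd v = fst v then 2 * fst v - 1 else 2 * fst v)"

lemma posV_suc:
  assumes n: "n > 1" and v: "v \<in> setV n"
  shows "posV (sucV n v) = nx (2 * n) (posV v)"
proof -
  obtain i j where ij: "v = (i, j)" by (cases v)
  have i: "i \<in> {1..n}" "j = i \<or> j = nx n i" using v unfolding ij setV_iff[OF n] by auto
  from i(2) show ?thesis
  proof
    assume "j = i"
    then show ?thesis using i(1) nx_neq[OF n, of i] by (simp add: ij sucV_def posV_def nx_def) presburger
  next
    assume j: "j = nx n i"
    then have "posV v = 2 * i" "posV (sucV n v) = 2 * j - 1" using nx_neq[OF n, of i] by (simp_all add: ij sucV_def posV_def)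
    then show ?thesis using i(1) j by (auto simp: nx_def)
  qed
qed

lemma posV_bij:
  assumes n: "n > 1"
  shows "bij_betw posV (setV n) {1..2 * n}"
proof -
  have inj: "inj_on posV (setV n)"
  proof (rule inj_onI)
    fix u v assume uv: "u \<in> setV n" "v \<in> setV n" "posV u = posV v"
    obtain i j k l where e: "u = (i, j)" "v = (k, l)" by (cases u, cases v)
    have i: "i \<ge> 1" "j = i \<or> j = nx n i" "k \<ge> 1" "l = k \<or> l = nx n k" using uv(1,2) unfolding e setV_iff[OF n] by auto
    have p: "(if j = i then 2 * i - 1 else 2 * i) = (if l = k then 2 * k - 1 else 2 * k)" using uv(3) unfolding e posV_def fst_conv snd_conv .
    have "j = i \<longleftrightarrow> l = k" using p i(1,3) by (cases "j = i"; cases "l = k") (simp; presburger)+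
    then have "i = k" using p i(1,3) by (cases "j = i") auto
    then show "u = v" using i(2,4) \<open>j = i \<longleftrightarrow> l = k\<close> by (auto simp: e)
  qed
  have "posV ` setV n \<subseteq> {1..2 * n}"
  proof
    fix x assume "x \<in> posV ` setV n"
    then obtain i j where e: "x = posV (i, j)" "(i, j) \<in> setV n" by auto
    then have "i \<in> {1..n}" unfolding setV_iff[OF n] by simp
    then show "x \<in> {1..2 * n}" by (auto simp: e(1) posV_def)
  qed
  moreover have "card (posV ` setV n) = card {1..2 * n}" using card_image[OF inj] card_setV[OF n] by simp
  ultimately have "posV ` setV n = {1..2 * n}" by (intro card_subset_eq) auto
  then show ?thesis using inj by (simp add: bij_betw_def)
qed

lemma indep_posV:
  assumes n: "n > 1" and S: "S \<subseteq> setV n"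
  shows "indep n S \<longleftrightarrow> cindep (2 * n) (posV ` S)"
proof -
  have inj: "inj_on posV (setV n)" and im: "posV ` setV n = {1..2 * n}" using posV_bij[OF n] by (auto simp: bij_betw_def)
  have "nx (2 * n) (posV v) \<in> posV ` S \<longleftrightarrow> sucV n v \<in> S" if "v \<in> S" for v
  proof -
    have v: "v \<in> setV n" using that S by blast
    show ?thesis unfolding posV_suc[OF n v, symmetric]
      using inj_on_image_mem_iff[OF inj sucV_in[OF n v] S] .
  qed
  moreover have "posV ` S \<subseteq> {1..2 * n}" using S im by blast
  ultimately show ?thesis using S by (simp add: indep_iff[OF n] cindep_def)
qed

lemma core_iso:
  assumes n: "n > 2"
  shows "complex_iso (core (SR_complex n (JJ n :: ('a::field) mpoly set))) (cyclic_boundary (2 * n) (2 * n - 4))"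
proof -
  have n1: "n > 1" using n by simp
  define C where "C = {F. F \<subseteq> setV n \<and> (\<forall>S\<subseteq>F. indep n S \<longrightarrow> card S \<noteq> n - 1)}"
  define E where "E = {F. F \<subseteq> {1..2 * n} \<and> (\<forall>S\<subseteq>F. cindep (2 * n) S \<longrightarrow> card S \<noteq> n - 1)}"
  \<comment> \<open>The dimension equals \<open>2 * m\<close> with \<open>m = n - 2\<close>, so the
    independent sets forbidden for the polytope have size \<open>m + 1 = n - 1\<close>, as in the
    complex.\<close>
  have d: "2 * n - 4 = 2 * (n - 2)" "n - 2 + 1 = n - 1" using n by auto
  have cE: "cyclic_boundary (2 * n) (2 * n - 4) = E"
    unfolding d(1) E_def using cyclic_boundary_faces[of "2 * n" "n - 2"] n unfolding d(2) by simp
  have cC: "core (SR_complex n (JJ n :: 'a mpoly set)) = C" unfolding C_def by (rule core_JJ[OF n])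
  have UC: "\<Union>C = setV n"
  proof (intro equalityI subsetI)
    fix v assume "v \<in> setV n"
    then have "{v} \<in> C" unfolding C_def
      by (intro CollectI conjI allI impI) (simp, rule card_subset_sing_neq[OF n], assumption)
    then show "v \<in> \<Union>C" by blast
  qed (auto simp: C_def)
  have UE: "\<Union>E = {1..2 * n}"
  proof (intro equalityI subsetI)
    fix v assume "v \<in> {1..2 * n}"
    then have "{v} \<in> E" unfolding E_def
      by (intro CollectI conjI allI impI) (simp, rule card_subset_sing_neq[OF n], assumption)
    then show "v \<in> \<Union>E" by blast
  qed (unfold E_def, blast)
  have inj: "inj_on posV (setV n)" and im: "posV ` setV n = {1..2 * n}" using posV_bij[OF n1] by (auto simp: bij_betw_def)
  have "F \<in> C \<longleftrightarrow> posV ` F \<in> E" if F: "F \<subseteq> setV n" for F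
  proof -
    have cd: "card (posV ` S) = card S" if "S \<subseteq> F" for S
      by (rule card_image) (rule inj_on_subset[OF inj], use that F in blast)
    have "(\<exists>S\<subseteq>F. indep n S \<and> card S = n - 1) \<longleftrightarrow> (\<exists>T\<subseteq>posV ` F. cindep (2 * n) T \<and> card T = n - 1)"
    proof
      assume "\<exists>S\<subseteq>F. indep n S \<and> card S = n - 1"
      then obtain S where S: "S \<subseteq> F" "indep n S" "card S = n - 1" by blast
      have "S \<subseteq> setV n" using S(1) F by blast
      then have "cindep (2 * n) (posV ` S)" using S(2) indep_posV[OF n1] by blast
      then show "\<exists>T\<subseteq>posV ` F. cindep (2 * n) T \<and> card T = n - 1"
        using S(1,3) cd[OF S(1)] by (intro exI[of _ "posV ` S"]) auto
    next
      assume "\<exists>T\<subseteq>posV ` F. cindep (2 * n) T \<and> card T = n - 1"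
      then obtain T where T: "T \<subseteq> posV ` F" "cindep (2 * n) T" "card T = n - 1" by blast
      then obtain S where S: "S \<subseteq> F" "T = posV ` S" by (auto simp: subset_image_iff)
      have "S \<subseteq> setV n" using S(1) F by blast
      then have "indep n S" using T(2) S(2) indep_posV[OF n1] by blast
      then show "\<exists>S\<subseteq>F. indep n S \<and> card S = n - 1" using S T(3) cd[OF S(1)] by auto
    qed
    moreover have "posV ` F \<subseteq> {1..2 * n}" using F im by blast
    ultimately show ?thesis using F unfolding C_def E_def by blast
  qed
  moreover have "bij_betw posV (\<Union>C) (\<Union>E)" unfolding UC UE by (rule posV_bij[OF n1])
  ultimately show ?thesis unfolding cE cC complex_iso_def UC by (intro exI[of _ posV]) (simp add: UC)
qed

theorem theorem8p1:
  fixes n :: nat and rk :: "var \<Rightarrow> nat"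
  assumes "n > 2"
    and "inj_on rk (Vars n)"
    and "\<forall>v\<in>setV n. \<forall>w\<in>setW n. rk v > rk w"
  defines "I \<equiv> ideal_gen n (maxminors n (genX :: nat \<Rightarrow> nat \<Rightarrow> 'a::field mpoly))"
  shows "squarefree_monomial_ideal n (initial_ideal n rk I)
       \<and> same_graded_betti n (initial_ideal n rk I) I
       \<and> complex_iso (core (SR_complex n (initial_ideal n rk I))) (cyclic_boundary (2 * n) (2 * n - 4))
       \<and> regular_sequence_mod n I (setW n)
       \<and> initial_ideal n rk I = ideal_gen n (maxminors n (matY n :: nat \<Rightarrow> nat \<Rightarrow> 'a mpoly))"
proof -
  have n1: "n > 1" using assms(1) by simp
  have I: "I = IU n {}" unfolding I_def by (rule ideal_X)
  have J: "initial_ideal n rk (IU n {} :: 'a mpoly set) = JJ n" by (rule initial_ideal_JJ[OF n1 assms(2,3)])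
  show ?thesis
    unfolding I J ideal_Y[OF n1]
    by (intro conjI refl JJ_squarefree[OF n1] same_betti[OF n1] core_iso[OF assms(1)] regular_W[OF n1])
qed

end
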